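(* Let $\theta>0$ be fixed. Then, as $T\to\infty$, $$\max_{|h|\leq (\log T)^\theta} \frac{X_T(h)-\sqrt{1+\theta}\,\log\log T}{\log\log\log T}\ \longrightarrow\ \frac{-1}{4\sqrt{1+\theta}}\quad\text{in probability.}$$
   Context: Let $(G_p)_{p\text{ prime}}$ be i.i.d. standard complex Gaussian random variables (mean $0$, $\mathbb{E}|G_p|^2=1$, with independent real and imaginary parts each $N(0,1/2)$). For $T>1$ and $h\in\mathbb{R}$ define $X_T(h)=\sum_{p\leq T}\frac{\mathrm{Re}(G_p p^{-ih})}{p^{1/2}}$, the sum being over primes $p\le T$. *)

theory Defs
  imports "HOL-Probability.Probability" "HOL-Computational_Algebra.Primes"
begin

definition half_normal_measure :: "real measure" where
  "half_normal_measure = density lborel (normal_density 0 (1 / sqrt 2))"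

definition std_complex_gaussian :: "complex measure" where
  "std_complex_gaussian =
     distr (half_normal_measure \<Otimes>\<^sub>M half_normal_measure) borel (\<lambda>(x, y). Complex x y)"

text \<open>X_T(h) = sum over primes p <= T of Re(G_p p^(-ih)) / sqrt p, where p^(-ih) = cis(-h ln p).\<close>
definition X_T :: "(nat \<Rightarrow> 'a \<Rightarrow> complex) \<Rightarrow> real \<Rightarrow> real \<Rightarrow> 'a \<Rightarrow> real" where
  "X_T G T h \<omega> =
     (\<Sum>p\<in>{p. prime p \<and> real p \<le> T}.
        Re (G p \<omega> * cis (- h * ln (real p))) / sqrt (real p))"

definition normalized_max :: "(nat \<Rightarrow> 'a \<Rightarrow> complex) \<Rightarrow> real \<Rightarrow> real \<Rightarrow> 'a \<Rightarrow> real" where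
  "normalized_max G \<theta> T \<omega> =
     (SUP h\<in>{- (ln T powr \<theta>) .. ln T powr \<theta>}.
        (X_T G T h \<omega> - sqrt (1 + \<theta>) * ln (ln T)) / ln (ln (ln T)))"

end

theory Submission
  imports Defs "HOL-Real_Asymp.Real_Asymp"
begin

text \<open>Write \<open>n = ln (ln T)\<close>, \<open>\<alpha> = sqrt (1 + \<theta>)\<close> and \<open>H = ln T powr \<theta> = exp (\<theta> n)\<close>. The values of the
  field at \<open>h\<close> and \<open>h'\<close> have covariance \<open>K (h - h') / 2\<close>, where \<open>K t\<close> is the sum of \<open>cos (t ln p) / p\<close>
  over \<open>p \<le> T\<close>. Up to a bounded error, \<open>K t\<close> is \<open>ln \<bar>\<zeta> (1 + 1 / ln T + i t)\<bar>\<close>, and elementary bounds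
  for \<open>\<zeta>\<close> to the right of the line of real part one show that \<open>K 0\<close> is \<open>n\<close> and that \<open>K t\<close> is at most
  \<open>- ln \<bar>t\<bar>\<close> for \<open>\<bar>t\<bar> \<le> 1\<close> and at most \<open>ln (ln (\<bar>t\<bar> + 2))\<close> for \<open>\<bar>t\<bar> \<ge> 1\<close>, up to bounded errors.

  Upper bound: at a fixed point the field and its derivative are independent Gaussians, so the expected
  variation of the field above a level \<open>a\<close> is about \<open>H ln T\<close> times the probability of exceeding \<open>a\<close>
  (Rice's formula). This bounds the probability that the maximum exceeds \<open>a + 1\<close>, and is already sharp.

  Lower bound: a second moment argument for the Lebesgue measure of the points at which the field lies in
  a unit window at the predicted level and the contribution of the top \<open>j\<close> scales is at least \<open>\<gamma> j\<close>,
  with \<open>1 < \<gamma> < \<alpha>\<close>. This barrier makes the contribution of nearby pairs negligible. Pairs at large distance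
  decorrelate after discarding the primes up to \<open>exp (n powr e)\<close>, except on a set of pairs of tiny measure. This is a
  mean square estimate for \<open>K\<close>, in which counting all integers near a given prime instead of all primes
  is enough, so that the prime number theorem is not needed.\<close>

text \<open>Origin of the constant: at height \<alpha> n - b a Gaussian of variance n / 2 has a tail
  of order n^(-1/2) exp (- \<alpha>^2 n + 2 \<alpha> b), and H ln T = exp (\<alpha>^2 n), so the two
  balance at b = ln n / (4 \<alpha>). The first moment is already sharp because \<theta> > 0: a path
  reaching the maximum climbs with slope \<alpha>, whereas the exp (\<theta> n + k) points
  distinguishable at scale k allow height sqrt (k (\<theta> n + k)), which exceeds \<alpha> k for
  all k < n. The path is thus far from its constraint except in the last few scales, and a linear
  barrier starting at a fixed number j0 of scales replaces a ballot estimate. The second moment has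
  to be asymptotically, not just up to a constant, the square of the first. Distant points still
  share the small primes, which is why these are removed; and since no pointwise bound makes the
  remaining covariance small, it is only shown to be small on average. A pair with large covariance
  costs at most a power of n, against a superpolynomially small measure of such pairs.\<close>

definition primes_upto :: "real \<Rightarrow> nat set" where
  "primes_upto x = {p. prime p \<and> real p \<le> x}"

lemma finite_primes_upto [simp, intro]: "finite (primes_upto x)"
proof (rule finite_subset)
  show "primes_upto x \<subseteq> {..nat \<lfloor>x\<rfloor>}"
    by (auto simp: primes_upto_def le_nat_floor)
qed auto

lemma primes_upto_mono: "x \<le> y \<Longrightarrow> primes_upto x \<subseteq> primes_upto y"
  by (auto simp: primes_upto_def)

lemma primes_uptoD:
  assumes "p \<in> primes_upto x"
  shows "prime p" "2 \<le> real p" "real p \<le> x" "0 < real p" "ln (real p) > 0"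
  using assms prime_ge_2_nat[of p] by (auto simp: primes_upto_def)

lemma norm_nat_powr_neg: "n > 0 \<Longrightarrow> norm (of_nat n powr (- s) :: complex) = real n powr (- Re s)"
  using norm_powr_real_powr[of "of_nat n" "-s"] by simp

subsection \<open>Sieved Dirichlet series\<close>

definition coprime_to_all :: "nat set \<Rightarrow> nat set" where
  "coprime_to_all P = {n. n > 0 \<and> (\<forall>p\<in>P. \<not> p dvd n)}"

definition dseries :: "complex \<Rightarrow> nat set \<Rightarrow> complex" where
  "dseries s A = (\<Sum>\<^sub>\<infinity>n\<in>A. of_nat n powr (- s))"

lemma summable_on_nat_powr:
  assumes "Re s > 1" "A \<subseteq> {0<..}"
  shows "(\<lambda>n::nat. norm ((of_nat n :: complex) powr (- s))) summable_on A"
proof -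
  have "summable (\<lambda>n. norm (real n powr (- Re s)))"
    using assms by (simp add: summable_real_powr_iff)
  hence "(\<lambda>n. real n powr (- Re s)) summable_on UNIV"
    by (rule norm_summable_imp_summable_on)
  hence "(\<lambda>n. real n powr (- Re s)) summable_on A"
    by (rule summable_on_subset_banach) auto
  also have "?this \<longleftrightarrow> ?thesis"
    using assms by (intro summable_on_cong) (auto simp: norm_nat_powr_neg)
  finally show ?thesis .
qed

lemma summable_on_nat_powr':
  assumes "Re s > 1" "A \<subseteq> {0<..}"
  shows "(\<lambda>n::nat. (of_nat n :: complex) powr (- s)) summable_on A"
  using summable_on_nat_powr[OF assms] by (rule abs_summable_summable)

text \<open>One step of the sieve of Eratosthenes: the integers coprime to \<open>P\<close> are
  those that \<open>p\<close> does not divide together with \<open>p\<close> times the whole set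
  again, since no prime of \<open>P\<close> divides \<open>p\<close>. The second piece contributes
  the factor \<open>of_nat p powr (- s)\<close>.\<close>

lemma dseries_coprime_insert:
  assumes s: "Re s > 1" and p: "prime p" and P: "\<And>q. q \<in> P \<Longrightarrow> prime q" "p \<notin> P"
  shows "dseries s (coprime_to_all (insert p P)) =
           (1 - of_nat p powr (- s)) * dseries s (coprime_to_all P)"
proof -
  let ?f = "\<lambda>n::nat. (of_nat n :: complex) powr (- s)"
  let ?C = "coprime_to_all P" and ?C' = "coprime_to_all (insert p P)"
  have p0: "p > 0" using p prime_gt_0_nat by blast
  have sub: "?C \<subseteq> {0<..}" "?C' \<subseteq> {0<..}" "(*) p ` ?C \<subseteq> {0<..}"
    using p0 by (auto simp: coprime_to_all_def)
  have split: "?C = ?C' \<union> (*) p ` ?C"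
  proof (intro set_eqI iffI)
    fix n assume n: "n \<in> ?C"
    show "n \<in> ?C' \<union> (*) p ` ?C"
    proof (cases "p dvd n")
      case True
      then obtain m where "n = p * m" by blast
      with n have "m \<in> ?C" by (auto simp: coprime_to_all_def)
      with \<open>n = p * m\<close> show ?thesis by blast
    qed (use n in \<open>auto simp: coprime_to_all_def\<close>)
  next
    fix n assume "n \<in> ?C' \<union> (*) p ` ?C"
    thus "n \<in> ?C"
    proof
      assume "n \<in> (*) p ` ?C"
      then obtain m where m: "n = p * m" "m \<in> ?C" by auto
      have "\<not> q dvd p * m" if "q \<in> P" for q
      proof
        assume "q dvd p * m"
        hence "q dvd p \<or> q dvd m" using that P by (simp add: prime_dvd_mult_iff)
        moreover have "\<not> q dvd m" using m that by (auto simp: coprime_to_all_def)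
        ultimately have "q = p" using that P p primes_dvd_imp_eq by blast
        thus False using that P by simp
      qed
      thus ?thesis using m p0 by (auto simp: coprime_to_all_def)
    qed (auto simp: coprime_to_all_def)
  qed
  have "\<not> p dvd n" if "n \<in> ?C'" for n
    using that unfolding coprime_to_all_def by blast
  hence disj: "?C' \<inter> (*) p ` ?C = {}"
    by fastforce
  have "infsum ?f (?C' \<union> (*) p ` ?C) = infsum ?f ?C' + infsum ?f ((*) p ` ?C)"
    by (intro infsum_Un_disjoint summable_on_nat_powr' s sub disj)
  hence "dseries s ?C = infsum ?f ?C' + infsum ?f ((*) p ` ?C)"
    unfolding dseries_def by (simp only: split [symmetric])
  also have "infsum ?f ((*) p ` ?C) = (\<Sum>\<^sub>\<infinity>n\<in>?C. of_nat p powr (- s) * ?f n)"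
    using p0 by (subst infsum_reindex)
      (auto simp: inj_on_def o_def powr_times_real intro!: infsum_cong)
  also have "\<dots> = of_nat p powr (- s) * dseries s ?C"
    unfolding dseries_def by (rule infsum_cmult_right')
  finally show ?thesis by (simp add: dseries_def algebra_simps)
qed

lemma dseries_coprime_prod:
  assumes s: "Re s > 1" and P: "finite P" "\<And>q. q \<in> P \<Longrightarrow> prime q"
  shows "dseries s (coprime_to_all P) = (\<Prod>p\<in>P. 1 - of_nat p powr (- s)) * dseries s {0<..}"
  using P
proof (induction P rule: finite_induct)
  case empty
  show ?case by (simp add: coprime_to_all_def greaterThan_def)
next
  case (insert p P)
  thus ?case using dseries_coprime_insert[OF s, of p P] by simp
qed

text \<open>Sieving by the primes up to \<open>N\<close> leaves only 1 and integers above
  \<open>N\<close>, so the deviation from 1 is bounded by a tail of a convergent series. Together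
  with \<open>dseries_coprime_prod\<close> this serves as the Euler product, with finite products
  only.\<close>

lemma dseries_coprime_tendsto_1:
  assumes s: "Re s > 1"
  shows "(\<lambda>N. dseries s (coprime_to_all (primes_upto (real N)))) \<longlonglongrightarrow> 1"
proof -
  let ?f = "\<lambda>n::nat. (of_nat n :: complex) powr (- s)"
  let ?C = "\<lambda>N::nat. coprime_to_all (primes_upto (real N))"
  have sub: "?C N \<subseteq> insert 1 {N<..}" for N
  proof
    fix n assume n: "n \<in> ?C N"
    show "n \<in> insert 1 {N<..}"
    proof (rule ccontr)
      assume "n \<notin> insert 1 {N<..}"
      hence "n \<noteq> 1" "n \<le> N" by auto
      then obtain p where p: "prime p" "p dvd n" using prime_factor_nat by blast
      moreover have "p \<le> N" using p n \<open>n \<le> N\<close> dvd_imp_le[of p n] by (auto simp: coprime_to_all_def)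
      ultimately show False using n by (auto simp: coprime_to_all_def primes_upto_def)
    qed
  qed
  have sm: "summable (\<lambda>n. norm (real n powr (- Re s)))"
    using s by (simp add: summable_real_powr_iff)
  let ?t = "\<lambda>N. \<Sum>n. real (n + Suc N) powr (- Re s)"
  have bound: "norm (dseries s (?C N) - 1) \<le> ?t N" for N
  proof -
    have one: "1 \<in> ?C N" by (auto simp: coprime_to_all_def dest: primes_uptoD)
    have C: "?C N = insert 1 (?C N - {1})" using one by auto
    have pos: "?C N - {1} \<subseteq> {0<..}" by (auto simp: coprime_to_all_def)
    have "dseries s (?C N) = 1 + infsum ?f (?C N - {1})"
      unfolding dseries_def
      by (subst C, subst infsum_insert) (use pos s in \<open>auto intro!: summable_on_nat_powr'\<close>)
    hence "norm (dseries s (?C N) - 1) = norm (infsum ?f (?C N - {1}))" by simp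
    also have "\<dots> \<le> (\<Sum>\<^sub>\<infinity>n\<in>?C N - {1}. norm (?f n))"
      by (intro norm_infsum_bound summable_on_nat_powr s pos)
    also have "\<dots> \<le> (\<Sum>\<^sub>\<infinity>n\<in>{N<..}. norm (?f n))"
      by (rule infsum_mono_neutral)
         (use sub[of N] pos s in \<open>auto intro!: summable_on_nat_powr\<close>)
    also have "\<dots> = (\<Sum>\<^sub>\<infinity>n\<in>{N<..}. real n powr (- Re s))"
      by (intro infsum_cong) (auto simp: norm_nat_powr_neg)
    also have "bij_betw (\<lambda>n. n + Suc N) UNIV {N<..}"
      by (rule bij_betwI[of _ _ _ "\<lambda>n. n - Suc N"]) auto
    hence "(\<Sum>\<^sub>\<infinity>n\<in>{N<..}. real n powr (- Re s)) = (\<Sum>\<^sub>\<infinity>n. real (n + Suc N) powr (- Re s))"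
      by (rule infsum_reindex_bij_betw[symmetric])
    also have "\<dots> = ?t N"
    proof -
      have "summable (\<lambda>n. norm (real (n + Suc N) powr (- Re s)))"
        using sm by (subst summable_iff_shift[of "\<lambda>n. norm (real n powr (- Re s))"])
      from norm_summable_imp_has_sum[OF this summable_sums[OF summable_norm_cancel[OF this]]] show ?thesis
        by (rule infsumI)
    qed
    finally show ?thesis .
  qed
  have "(\<lambda>N. \<Sum>n. real (n + Suc N) powr (- Re s)) \<longlonglongrightarrow> 0"
  proof -
    have "summable (\<lambda>n. real n powr (- Re s))" using sm by (simp add: summable_norm_cancel)
    from LIMSEQ_Suc[OF suminf_exist_split2[OF this]] show ?thesis by simp
  qed
  hence "(\<lambda>N. dseries s (?C N) - 1) \<longlonglongrightarrow> 0"
    by (rule Lim_null_comparison[rotated]) (use bound in auto)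
  thus ?thesis by (simp add: LIM_zero_iff)
qed

lemma dseries_sums:
  assumes s: "Re s > 1"
  shows "(\<lambda>N. \<Sum>n=1..<N. of_nat n powr (- s)) \<longlonglongrightarrow> dseries s {0<..}"
proof -
  let ?f = "\<lambda>n::nat. (of_nat n :: complex) powr (- s)"
  have "(?f has_sum dseries s {0<..}) {0<..}"
    unfolding dseries_def
    by (intro has_sum_infsum summable_on_nat_powr' s) auto
  hence "((\<lambda>F. sum ?f F) \<longlongrightarrow> dseries s {0<..}) (finite_subsets_at_top {0<..})"
    by (simp add: has_sum_def)
  moreover have "filterlim (\<lambda>N. {1..<N}) (finite_subsets_at_top {0<..}) sequentially"
    unfolding filterlim_finite_subsets_at_top
  proof safe
    fix X :: "nat set" assume X: "finite X" "X \<subseteq> {0<..}"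
    then obtain B where "\<forall>x\<in>X. x < B" using finite_nat_set_iff_bounded by blast
    thus "\<forall>\<^sub>F y in sequentially. finite {1..<y} \<and> X \<subseteq> {1..<y} \<and> {1..<y} \<subseteq> {0<..}"
      using X by (intro eventually_sequentiallyI[of B]) force
  qed
  ultimately show ?thesis using filterlim_compose by blast
qed

subsection \<open>Bounds for the zeta function to the right of the line of real part one\<close>

text \<open>\<open>F n - F (n + 1)\<close> is the integral of \<open>x powr (- s)\<close> over
  [n, n + 1], so this is one step of the comparison of the series with an integral. The integral
  itself is avoided: the mean value inequality is used once for \<open>x powr (- s)\<close> and once
  for a primitive.\<close>

lemma dirichlet_term_approx:
  fixes s :: complex and n :: nat
  assumes "n > 0" "Re s > 1"
  defines "F \<equiv> (\<lambda>x::real. complex_of_real x powr (1 - s) / (s - 1))"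
  shows "norm (of_nat n powr (- s) - (F (real n) - F (real (Suc n)))) \<le> norm s / (real n)\<^sup>2"
proof -
  have s1: "s \<noteq> 1" using assms by auto
  have pw: "norm (complex_of_real x powr (- s) - of_nat n powr (- s)) \<le> norm s / (real n)\<^sup>2"
    if x: "x \<in> {real n..real (Suc n)}" for x
  proof -
    have "norm (complex_of_real x powr (- s) - complex_of_real (real n) powr (- s))
        \<le> norm s / (real n)\<^sup>2 * norm (x - real n)"
    proof (rule differentiable_bound[where f' = "\<lambda>y h. h *\<^sub>R (- s * complex_of_real y powr (- s - 1))" and S = "{real n..real (Suc n)}"])
      fix y assume y: "y \<in> {real n..real (Suc n)}"
      have y0: "y > 0" using y assms by auto
      have "((\<lambda>z. z powr (- s)) has_field_derivative (- s * complex_of_real y powr (- s - 1))) (at (complex_of_real y))"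
        using y0 by (intro has_field_derivative_powr) (auto simp: complex_nonpos_Reals_iff)
      hence "((\<lambda>y. complex_of_real y powr (- s)) has_vector_derivative (- s * complex_of_real y powr (- s - 1))) (at y within {real n..real (Suc n)})"
        by (intro has_vector_derivative_real_field)
      thus "((\<lambda>y. complex_of_real y powr (- s)) has_derivative (\<lambda>h. h *\<^sub>R (- s * complex_of_real y powr (- s - 1)))) (at y within {real n..real (Suc n)})"
        by (simp add: has_vector_derivative_def)
      show "onorm (\<lambda>h. h *\<^sub>R (- s * complex_of_real y powr (- s - 1))) \<le> norm s / (real n)\<^sup>2"
      proof (rule onorm_le)
        fix h :: real
        have "norm (complex_of_real y powr (- s - 1)) = y powr (- Re s - 1)"
          using y0 norm_powr_real_powr[of "of_real y" "- s - 1"] by simp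
        also have "\<dots> \<le> real n powr (- Re s - 1)"
          using y assms by (intro powr_mono2') auto
        also have "\<dots> \<le> real n powr (- 2)"
          using assms by (intro powr_mono) auto
        also have "\<dots> = 1 / (real n)\<^sup>2" using assms by (simp add: powr_minus powr_numeral divide_inverse)
        finally have *: "norm (complex_of_real y powr (- s - 1)) \<le> 1 / (real n)\<^sup>2" .
        have "norm (h *\<^sub>R (- s * complex_of_real y powr (- s - 1)))
             = norm s * norm (complex_of_real y powr (- s - 1)) * norm h" by (simp add: norm_mult)
        also have "\<dots> \<le> norm s * (1 / (real n)\<^sup>2) * norm h"
          by (intro mult_right_mono mult_left_mono *) auto
        finally show "norm (h *\<^sub>R (- s * complex_of_real y powr (- s - 1))) \<le> norm s / (real n)\<^sup>2 * norm h" by simp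
      qed
    qed (use x in auto)
    also have "\<dots> \<le> norm s / (real n)\<^sup>2 * 1"
      using x by (intro mult_left_mono) auto
    finally show ?thesis by simp
  qed
  \<comment> \<open>The derivative is \<open>n powr (- s) - x powr (- s)\<close>, bounded by
    \<open>pw\<close>, and the increment from \<open>n\<close> to \<open>n + 1\<close> is the
    quantity to be estimated.\<close>
  let ?\<phi> = "\<lambda>x::real. F x + x *\<^sub>R of_nat n powr (- s)"
  have "norm (?\<phi> (real (Suc n)) - ?\<phi> (real n)) \<le> norm s / (real n)\<^sup>2 * norm (real (Suc n) - real n)"
  proof (rule differentiable_bound[where f' = "\<lambda>y h. h *\<^sub>R (of_nat n powr (- s) - complex_of_real y powr (- s))" and S = "{real n..real (Suc n)}"])
    fix y assume y: "y \<in> {real n..real (Suc n)}"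
    have y0: "y > 0" using y assms by auto
    have "((\<lambda>z. z powr (1 - s) / (s - 1)) has_field_derivative (- (complex_of_real y powr (- s)))) (at (complex_of_real y))"
    proof -
      have "((\<lambda>z. z powr (1 - s) / (s - 1)) has_field_derivative ((1 - s) * complex_of_real y powr (1 - s - 1) / (s - 1))) (at (complex_of_real y))"
        using y0 by (intro has_field_derivative_powr DERIV_cdivide) (auto simp: complex_nonpos_Reals_iff)
      moreover have "(1 - s) * w / (s - 1) = - w" for w
        using s1 by (simp add: divide_eq_eq algebra_simps)
      ultimately show ?thesis by simp
    qed
    hence "(F has_vector_derivative (- (complex_of_real y powr (- s)))) (at y within {real n..real (Suc n)})"
      unfolding F_def by (intro has_vector_derivative_real_field)
    hence "(?\<phi> has_vector_derivative (- (complex_of_real y powr (- s)) + of_nat n powr (- s))) (at y within {real n..real (Suc n)})"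
      by (auto intro!: derivative_eq_intros)
    thus "(?\<phi> has_derivative (\<lambda>h. h *\<^sub>R (of_nat n powr (- s) - complex_of_real y powr (- s)))) (at y within {real n..real (Suc n)})"
      by (simp add: has_vector_derivative_def add.commute)
    show "onorm (\<lambda>h. h *\<^sub>R (of_nat n powr (- s) - complex_of_real y powr (- s))) \<le> norm s / (real n)\<^sup>2"
    proof (rule onorm_le)
      fix h :: real
      have "norm (h *\<^sub>R (of_nat n powr (- s) - complex_of_real y powr (- s)))
          = norm (complex_of_real y powr (- s) - of_nat n powr (- s)) * norm h"
        by (simp add: norm_minus_commute)
      also have "\<dots> \<le> norm s / (real n)\<^sup>2 * norm h"
        by (intro mult_right_mono pw y) auto
      finally show "norm (h *\<^sub>R (of_nat n powr (- s) - complex_of_real y powr (- s))) \<le> norm s / (real n)\<^sup>2 * norm h" .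
    qed
  qed auto
  thus ?thesis by (simp add: algebra_simps)
qed

lemma sum_inverse_squares_le:
  assumes "1 \<le> N"
  shows "(\<Sum>n=N..<M. 1 / (real n)\<^sup>2) \<le> 2 / real N"
proof -
  \<comment> \<open>The subtracted \<open>1 / M\<close> is what lets the induction telescope through
    1 / m - 1 / (m + 1).\<close>
  have "(\<Sum>n=N..<Suc M. 1 / (real n)\<^sup>2) \<le> 2 / real N - 1 / real M" if "N \<le> M" for M
    using that
  proof (induction M rule: dec_induct)
    case base
    have "1 / (real N)\<^sup>2 \<le> 1 / real N"
      using assms by (simp add: field_simps power2_eq_square)
    thus ?case by simp
  next
    case (step m)
    have "1 / (real (Suc m))\<^sup>2 \<le> 1 / real m - 1 / real (Suc m)"
    proof -
      have m: "real m > 0" using step assms by simp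
      have "1 / real m - 1 / real (Suc m) = 1 / (real m * real (Suc m))"
        using m by (simp add: field_simps)
      moreover have "1 / (real (Suc m))\<^sup>2 \<le> 1 / (real m * real (Suc m))"
        unfolding power2_eq_square using m by (intro divide_left_mono mult_right_mono mult_pos_pos) auto
      ultimately show ?thesis by simp
    qed
    moreover have "(\<Sum>n=N..<Suc (Suc m). 1 / (real n)\<^sup>2) = (\<Sum>n=N..<Suc m. 1 / (real n)\<^sup>2) + 1 / (real (Suc m))\<^sup>2"
      using step by simp
    ultimately show ?case using step by linarith
  qed
  note * = this
  show ?thesis
  proof (cases "N < M")
    case True
    then obtain m where m: "M = Suc m" "N \<le> m" by (cases M) auto
    have "2 / real N - 1 / real m \<le> 2 / real N" by simp
    with *[of m] m show ?thesis by (metis order_trans)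
  qed simp
qed

text \<open>The termwise errors of \<open>dirichlet_term_approx\<close> are summed from
  \<open>N\<close> on, and the boundary term at infinity vanishes as Re s > 1. The cut-off
  \<open>N\<close> stays free: \<open>N = 1\<close> isolates the pole at 1, and \<open>N\<close>
  near |t| balances head and error for large t.\<close>

lemma zeta_approx:
  assumes s: "Re s > 1" and N: "N > 0"
  shows "norm (dseries s {0<..} - (\<Sum>n=1..<N. of_nat n powr (- s)) - of_nat N powr (1 - s) / (s - 1))
           \<le> 2 * norm s / real N"
proof -
  define F where "F = (\<lambda>n::nat. (of_nat n :: complex) powr (1 - s) / (s - 1))"
  let ?f = "\<lambda>n::nat. (of_nat n :: complex) powr (- s)"
  let ?S = "\<lambda>M. (\<Sum>n=1..<M. ?f n)"
  have b: "norm (?S M - ?S N - (F N - F M)) \<le> 2 * norm s / real N" if M: "N \<le> M" for M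
  proof -
    have "?S M - ?S N = (\<Sum>n=N..<M. ?f n)"
      using sum.atLeastLessThan_concat[of 1 N M ?f] N M by (simp add: algebra_simps)
    moreover have "F N - F M = (\<Sum>n=N..<M. F n - F (Suc n))"
      using sum_Suc_diff'[of N M "\<lambda>n. - F n"] M by simp
    ultimately have "norm (?S M - ?S N - (F N - F M)) = norm (\<Sum>n=N..<M. ?f n - (F n - F (Suc n)))"
      by (simp add: sum_subtractf)
    also have "\<dots> \<le> (\<Sum>n=N..<M. norm s * (1 / (real n)\<^sup>2))"
      using dirichlet_term_approx[OF _ s] N
      by (intro sum_norm_le) (auto simp: F_def)
    also have "\<dots> = norm s * (\<Sum>n=N..<M. 1 / (real n)\<^sup>2)"
      by (simp add: sum_distrib_left)
    also have "\<dots> \<le> norm s * (2 / real N)"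
      using N by (intro mult_left_mono sum_inverse_squares_le) auto
    finally show ?thesis by (simp add: mult.commute)
  qed
  have "F \<longlonglongrightarrow> 0"
  proof (rule tendsto_norm_zero_cancel)
    have "(\<lambda>n. real n powr (1 - Re s) / norm (s - 1)) \<longlonglongrightarrow> 0 / norm (s - 1)"
      using s by (intro tendsto_intros tendsto_neg_powr filterlim_real_sequentially) auto
    moreover have "\<forall>\<^sub>F n in sequentially. real n powr (1 - Re s) / norm (s - 1) = norm (F n)"
      using eventually_gt_at_top[of 0]
    proof eventually_elim
      case (elim n)
      thus ?case using norm_powr_real_powr[of "of_nat n" "1 - s"] by (simp add: F_def norm_divide)
    qed
    ultimately show "(\<lambda>n. norm (F n)) \<longlonglongrightarrow> 0"
      by (simp add: tendsto_cong)
  qed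
  hence "(\<lambda>M. norm (?S M - ?S N - (F N - F M))) \<longlonglongrightarrow> norm (dseries s {0<..} - ?S N - (F N - 0))"
    by (intro tendsto_intros dseries_sums s)
  hence "norm (dseries s {0<..} - ?S N - (F N - 0)) \<le> 2 * norm s / real N"
    by (rule tendsto_upperbound) (use b in \<open>auto intro: eventually_sequentiallyI\<close>)
  thus ?thesis by (simp add: F_def)
qed

lemma zeta_bound_small:
  assumes "\<sigma> > 0" "\<sigma> \<le> 1" "\<bar>t\<bar> \<le> 1" "t \<noteq> 0"
  shows "norm (dseries (Complex (1 + \<sigma>) t) {0<..}) \<le> 7 / \<bar>t\<bar>"
proof -
  let ?s = "Complex (1 + \<sigma>) t"
  have 1: "norm (1 / (?s - 1)) \<le> 1 / \<bar>t\<bar>"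
    using assms abs_Im_le_cmod[of "?s - 1"] by (simp add: norm_divide frac_le)
  have 2: "norm ?s \<le> 3" using cmod_le[of ?s] assms by simp
  have "norm (dseries ?s {0<..} - 1 / (?s - 1)) \<le> 2 * norm ?s"
    using zeta_approx[of ?s 1] assms by simp
  hence "norm (dseries ?s {0<..}) \<le> norm (1 / (?s - 1)) + 2 * norm ?s"
    using norm_triangle_ineq2[of "dseries ?s {0<..}" "1 / (?s - 1)"] by linarith
  also have "\<dots> \<le> 1 / \<bar>t\<bar> + 6 / \<bar>t\<bar>"
  proof (intro add_mono 1)
    have "2 * norm ?s \<le> 6" using 2 by simp
    also have "\<dots> \<le> 6 / \<bar>t\<bar>" using assms by (simp add: field_simps)
    finally show "2 * norm ?s \<le> 6 / \<bar>t\<bar>" .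
  qed
  finally show ?thesis by simp
qed

lemma zeta_bound_large:
  assumes "\<sigma> > 0" "\<sigma> \<le> 1" "\<bar>t\<bar> \<ge> 1"
  shows "norm (dseries (Complex (1 + \<sigma>) t) {0<..}) \<le> 10 * ln (\<bar>t\<bar> + 2)"
proof -
  let ?s = "Complex (1 + \<sigma>) t"
  \<comment> \<open>Cutting at height |t| keeps the error 2 |s| / N bounded, while the head is a
    harmonic sum of size ln |t|.\<close>
  define N where "N = nat \<lceil>\<bar>t\<bar>\<rceil>"
  have N: "N > 0" "real N \<ge> \<bar>t\<bar>" "real N \<le> \<bar>t\<bar> + 1" using assms unfolding N_def by linarith+
  have 1: "norm (of_nat N powr (1 - ?s) / (?s - 1)) \<le> 1"
  proof -
    have "norm (of_nat N powr (1 - ?s)) = real N powr (- \<sigma>)"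
      using N norm_powr_real_powr[of "of_nat N" "1 - ?s"] by simp
    also have "\<dots> \<le> real N powr 0"
      using N assms by (intro powr_mono) auto
    finally have "norm (of_nat N powr (1 - ?s)) \<le> 1" using N by simp
    moreover have "norm (?s - 1) \<ge> 1" using assms abs_Im_le_cmod[of "?s - 1"] by simp
    ultimately show ?thesis by (simp add: norm_divide divide_le_eq)
  qed
  have 2: "norm (\<Sum>n=1..<N. of_nat n powr (- ?s) :: complex) \<le> 1 + ln (\<bar>t\<bar> + 2)"
  proof -
    have "norm (\<Sum>n=1..<N. of_nat n powr (- ?s) :: complex) \<le> (\<Sum>n=1..<N. 1 / real n)"
    proof (rule sum_norm_le)
      fix n assume n: "n \<in> {1..<N}"
      have "norm (of_nat n powr (- ?s) :: complex) = real n powr (- (1 + \<sigma>))"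
        using n by (subst norm_nat_powr_neg) auto
      also have "\<dots> \<le> real n powr (- 1)" using n assms by (intro powr_mono) auto
      finally show "norm (of_nat n powr (- ?s) :: complex) \<le> 1 / real n"
        using n by (simp add: powr_minus divide_inverse)
    qed
    also have "\<dots> \<le> (\<Sum>n=1..N. 1 / real n)"
      by (intro sum_mono2) auto
    also have "\<dots> = harm N" by (simp add: harm_def inverse_eq_divide)
    also have "\<dots> \<le> ln (real N) + 1"
      using euler_mascheroni_sequence_decreasing[of 1 N] N by (simp add: harm_expand)
    also have "ln (real N) \<le> ln (\<bar>t\<bar> + 2)" using N by simp
    finally show ?thesis by simp
  qed
  have 3: "2 * norm ?s / real N \<le> 6"
  proof -
    have "norm ?s \<le> 2 + \<bar>t\<bar>" using cmod_le[of ?s] assms by simp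
    hence "2 * norm ?s \<le> 6 * real N" using N assms by linarith
    thus ?thesis using N by (simp add: field_simps)
  qed
  have "norm (dseries ?s {0<..}) \<le> 2 * norm ?s / real N + norm (\<Sum>n=1..<N. of_nat n powr (- ?s) :: complex)
         + norm (of_nat N powr (1 - ?s) / (?s - 1))"
    using zeta_approx[of ?s N] assms N
      norm_triangle_ineq2[of "dseries ?s {0<..} - (\<Sum>n=1..<N. of_nat n powr (- ?s))" "of_nat N powr (1 - ?s) / (?s - 1)"]
      norm_triangle_ineq2[of "dseries ?s {0<..}" "\<Sum>n=1..<N. of_nat n powr (- ?s)"] by simp
  also have "\<dots> \<le> 6 + (1 + ln (\<bar>t\<bar> + 2)) + 1" by (intro add_mono 1 2 3)
  also have "\<dots> \<le> 10 * ln (\<bar>t\<bar> + 2)"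
  proof -
    have "1 \<le> ln (3 :: real)" using exp_le by (subst ln_ge_iff) auto
    also have "\<dots> \<le> ln (\<bar>t\<bar> + 2)" using assms by simp
    finally show ?thesis by simp
  qed
  finally show ?thesis .
qed

lemma zeta_bounds_real:
  assumes "\<sigma> > 0" "\<sigma> \<le> 1"
  shows "norm (dseries (complex_of_real (1 + \<sigma>)) {0<..}) \<le> 5 / \<sigma>"
    and "norm (dseries (complex_of_real (1 + \<sigma>)) {0<..}) \<ge> 1 / \<sigma> - 4"
proof -
  let ?s = "complex_of_real (1 + \<sigma>)"
  have "norm (dseries ?s {0<..} - 1 / (?s - 1)) \<le> 2 * norm ?s"
    using zeta_approx[of ?s 1] assms by simp
  also have "norm ?s = 1 + \<sigma>" using assms by (subst norm_of_real) simp
  finally have 1: "norm (dseries ?s {0<..} - 1 / (?s - 1)) \<le> 4" using assms by simp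
  have 2: "norm (1 / (?s - 1)) = 1 / \<sigma>" using assms by (simp add: norm_divide)
  show "norm (dseries ?s {0<..}) \<ge> 1 / \<sigma> - 4" 
    using norm_triangle_ineq2[of "1 / (?s - 1)" "dseries ?s {0<..}"] 1 2
    by (simp only: norm_minus_commute[of "dseries ?s {0<..}"])
  have "norm (dseries ?s {0<..}) \<le> 1 / \<sigma> + 4"
    using norm_triangle_ineq2[of "dseries ?s {0<..}" "1 / (?s - 1)"] 1 2 by linarith
  also have "\<dots> \<le> 5 / \<sigma>" using assms by (simp add: field_simps)
  finally show "norm (dseries ?s {0<..}) \<le> 5 / \<sigma>" .
qed

subsection \<open>Sums over primes\<close>

lemma sum_ln_prime_divisors_le:
  assumes "m > 0"
  shows "(\<Sum>p | p \<in> primes_upto x \<and> p dvd m. ln (real p)) \<le> ln (real m)"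
proof -
  have "(\<Sum>p | p \<in> primes_upto x \<and> p dvd m. ln (real p)) \<le> (\<Sum>p\<in>prime_factors m. ln (real p))"
    using assms by (intro sum_mono2)
      (auto simp: primes_upto_def prime_factors_dvd dest: prime_ge_1_nat)
  also have "\<dots> \<le> (\<Sum>p\<in>prime_factors m. real (multiplicity p m) * ln (real p))"
  proof (intro sum_mono)
    fix p assume p: "p \<in> prime_factors m"
    hence "multiplicity p m \<ge> 1"
      by (simp add: prime_factors_multiplicity Suc_le_eq)
    hence "1 * ln (real p) \<le> real (multiplicity p m) * ln (real p)"
      using p prime_ge_1_nat[OF in_prime_factors_imp_prime[OF p]] by (intro mult_right_mono) auto
    thus "ln (real p) \<le> real (multiplicity p m) * ln (real p)" by simp
  qed
  also have "\<dots> = ln (\<Prod>p\<in>prime_factors m. real p ^ multiplicity p m)"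
    by (subst ln_prod) (auto simp: ln_realpow prime_gt_0_nat dest!: in_prime_factors_imp_prime intro!: sum.cong)
  also have "(\<Prod>p\<in>prime_factors m. real p ^ multiplicity p m) = real (\<Prod>p\<in>prime_factors m. p ^ multiplicity p m)"
    by simp
  also have "\<dots> = real m" using assms by (subst prod_prime_factors) auto
  finally show ?thesis .
qed

text \<open>Chebyshev's double count: summing ln p over all pairs p dvd m with m at most N gives at
  most the sum of the ln m, hence at most N ln N, while each p occurs N div p times. The 2 pays for
  N div p being at least N / (2 p).\<close>

lemma sum_ln_prime_over_prime_le:
  assumes "x \<ge> 1"
  shows "(\<Sum>p\<in>primes_upto x. ln (real p) / real p) \<le> 2 * ln x"
proof -
  define N where "N = nat \<lfloor>x\<rfloor>"
  have N: "N \<ge> 1" "real N \<le> x" using assms by (auto simp: N_def le_nat_floor)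
  have pN: "p \<le> N" if "p \<in> primes_upto x" for p
    using that by (simp add: N_def primes_upto_def le_nat_floor)
  have "real N / 2 * (\<Sum>p\<in>primes_upto x. ln (real p) / real p)
      \<le> (\<Sum>p\<in>primes_upto x. real (N div p) * ln (real p))"
    unfolding sum_distrib_left
  proof (intro sum_mono)
    fix p assume p: "p \<in> primes_upto x"
    note p' = primes_uptoD[OF p]
    have "N div p \<ge> 1" using pN[OF p] p' by (simp add: div_greater_zero_iff Suc_le_eq)
    hence "real (N div p) \<ge> 1" by linarith
    moreover have "real (N div p) \<ge> real N / real p - 1"
    proof -
      have "real N = real (N div p) * real p + real (N mod p)"
        by (metis div_mult_mod_eq of_nat_add of_nat_mult)
      moreover have "real (N mod p) \<le> real p" using p' by simp
      ultimately have "real N \<le> (real (N div p) + 1) * real p" by (simp add: algebra_simps)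
      thus ?thesis using p' by (simp add: field_simps)
    qed
    moreover have "a / 2 \<le> b" if "1 \<le> b" "a - 1 \<le> b" for a b :: real
      using that by linarith
    ultimately have "real (N div p) \<ge> real N / real p / 2" by blast
    hence "real N / real p / 2 * ln (real p) \<le> real (N div p) * ln (real p)"
      using p' by (intro mult_right_mono) auto
    thus "real N / 2 * (ln (real p) / real p) \<le> real (N div p) * ln (real p)" by simp
  qed
  also have "\<dots> = (\<Sum>p\<in>primes_upto x. \<Sum>m | m \<in> {1..N} \<and> p dvd m. ln (real p))"
  proof (intro sum.cong refl)
    fix p assume p: "p \<in> primes_upto x"
    have "{m. m \<in> {1..N} \<and> p dvd m} = (*) p ` {1..N div p}"
      using primes_uptoD[OF p]
      by (auto simp: less_eq_div_iff_mult_less_eq mult.commute elim!: dvdE)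
    moreover have "card ((*) p ` {1..N div p}) = N div p"
      using primes_uptoD[OF p] by (subst card_image) (auto simp: inj_on_def)
    ultimately show "real (N div p) * ln (real p) = (\<Sum>m | m \<in> {1..N} \<and> p dvd m. ln (real p))"
      by simp
  qed
  also have "\<dots> = (\<Sum>m\<in>{1..N}. \<Sum>p | p \<in> primes_upto x \<and> p dvd m. ln (real p))"
    by (rule sum.swap_restrict) auto
  also have "\<dots> \<le> (\<Sum>m\<in>{1..N}. ln (real N))"
  proof (intro sum_mono)
    fix m assume m: "m \<in> {1..N}"
    hence "ln (real m) \<le> ln (real N)" by simp
    thus "(\<Sum>p | p \<in> primes_upto x \<and> p dvd m. ln (real p)) \<le> ln (real N)"
      using sum_ln_prime_divisors_le[of m x] m by (auto intro: order_trans)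
  qed
  also have "\<dots> \<le> real N * ln x" using N by simp
  finally show ?thesis using N by (simp add: field_simps)
qed

section \<open>Mertens' second theorem and the covariance kernel, through the zeta function\<close>

definition prime_cos_sum :: "real \<Rightarrow> real \<Rightarrow> real" where
  "prime_cos_sum T t = (\<Sum>p\<in>primes_upto T. cos (t * ln (real p)) / real p)"

lemma ge_exp_1D:
  assumes "T \<ge> exp (1::real)"
  shows "T > 1" "T > 0" "ln T \<ge> 1" "ln T > 0"
proof -
  show "T > 1" using assms exp_ge_add_one_self[of 1] by linarith
  thus "T > 0" by simp
  thus "ln T \<ge> 1" using assms by (simp add: ln_ge_iff)
  thus "ln T > 0" by simp
qed

lemma nat_powr_minus_one_minus:
  assumes "p > (0::nat)"
  shows "real p powr (- 1 - c) = exp (- c * ln (real p)) / real p"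
  using assms by (simp add: powr_diff powr_minus powr_def[of _ c] exp_minus field_simps)

text \<open>Moving the exponent from 1 to 1 + 1 / ln T multiplies 1 / p by exp (- u) with u = ln p /
  ln T, and 1 - exp (- u) is at most u.\<close>

lemma sum_prime_powr_diff_le:
  assumes "T \<ge> exp 1"
  shows "(\<Sum>p\<in>primes_upto T. 1 / real p - real p powr (- 1 - 1 / ln T)) \<le> 2"
proof -
  have T: "T > 0" "ln T \<ge> 1" "T \<ge> 1"
    using ge_exp_1D[OF assms] by auto
  have "(\<Sum>p\<in>primes_upto T. 1 / real p - real p powr (- 1 - 1 / ln T))
     \<le> (\<Sum>p\<in>primes_upto T. (1 / ln T) * (ln (real p) / real p))"
  proof (intro sum_mono)
    fix p assume p: "p \<in> primes_upto T"
    note p' = primes_uptoD[OF p]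
    have "1 + (- (1 / ln T) * ln (real p)) \<le> exp (- (1 / ln T) * ln (real p))"
      by (rule exp_ge_add_one_self)
    hence "(1 + (- (1 / ln T) * ln (real p))) / real p \<le> exp (- (1 / ln T) * ln (real p)) / real p"
      using p' by (intro divide_right_mono) auto
    also have "exp (- (1 / ln T) * ln (real p)) / real p = real p powr (- 1 - 1 / ln T)"
      using p' by (subst nat_powr_minus_one_minus) auto
    finally show "1 / real p - real p powr (- 1 - 1 / ln T) \<le> (1 / ln T) * (ln (real p) / real p)"
      by (simp add: add_divide_distrib diff_divide_distrib algebra_simps)
  qed
  also have "\<dots> = (1 / ln T) * (\<Sum>p\<in>primes_upto T. ln (real p) / real p)"
    by (simp add: sum_distrib_left)
  also have "\<dots> \<le> (1 / ln T) * (2 * ln T)"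
    using T by (intro mult_left_mono sum_ln_prime_over_prime_le) auto
  also have "\<dots> = 2"
  proof -
    have "ln T \<noteq> 0" using T by linarith
    thus ?thesis by simp
  qed
  finally show ?thesis .
qed

text \<open>The primes above T are sorted by u = ln p / ln T into the blocks j < u \<le> j + 1. On
  such a block the weight is at most exp (- j), and 1 / p is at most ln p / (j ln T p), so that
  \<open>sum_ln_prime_over_prime_le\<close> bounds the block by 4 exp (- j).\<close>

lemma sum_prime_powr_tail_le:
  assumes "T \<ge> exp 1"
  shows "(\<Sum>p\<in>primes_upto N - primes_upto T. real p powr (- 1 - 1 / ln T)) \<le> 4"
proof -
  define L where "L = ln T"
  have T: "T > 0" "L \<ge> 1"
    using ge_exp_1D[OF assms] by (auto simp: L_def)
  define J where "J = nat \<lceil>ln N / L\<rceil>"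
  define c where "c = (\<lambda>j::nat. exp (- real j) / (real j * L))"
  have c: "c j \<ge> 0" for j using T by (simp add: c_def)
  have 1: "real p powr (- 1 - 1 / ln T)
      \<le> (\<Sum>j | j \<in> {1..J} \<and> p \<in> primes_upto (exp ((real j + 1) * L)). c j * (ln (real p) / real p))"
    if p: "p \<in> primes_upto N - primes_upto T" for p
  proof -
    have p': "prime p" "real p \<le> N" "real p > T" "real p > 0" "ln (real p) > 0" "p \<in> primes_upto N"
    proof -
      show pN: "p \<in> primes_upto N" using p by simp
      show "prime p" "real p \<le> N" "real p > 0" "ln (real p) > 0" by (rule primes_uptoD[OF pN])+
      have "p \<notin> primes_upto T" using p by simp
      thus "real p > T" using \<open>prime p\<close> by (simp add: primes_upto_def)
    qed
    define u where "u = ln (real p) / L"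
    have "L < ln (real p)" using p' T(1) unfolding L_def by (subst ln_less_cancel_iff) auto
    hence u: "u > 1" using T(2) by (simp add: u_def)
    define j where "j = nat (\<lceil>u\<rceil> - 1)"
    have j: "j \<ge> 1" "real j < u" "u \<le> real j + 1"
      using u unfolding j_def by linarith+
    have "u \<le> ln N / L" using p' T by (auto simp: u_def intro!: divide_right_mono)
    hence jJ: "j \<in> {1..J}" using j unfolding J_def by (auto simp: le_nat_iff) linarith
    have "ln (real p) \<le> (real j + 1) * L" using j T by (simp add: u_def divide_le_eq)
    hence "real p \<le> exp ((real j + 1) * L)" using p' by (metis exp_le_cancel_iff exp_ln)
    hence pj: "p \<in> primes_upto (exp ((real j + 1) * L))" using p' by (simp add: primes_upto_def)
    have "real p powr (- 1 - 1 / ln T) = exp (- u) * (1 / real p)"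
      using p' by (subst nat_powr_minus_one_minus) (auto simp: u_def L_def)
    also have "\<dots> \<le> exp (- real j) * (ln (real p) / (real j * L) * (1 / real p))"
    proof (intro mult_mono)
      show "1 / real p \<le> ln (real p) / (real j * L) * (1 / real p)"
      proof -
        have "real j * L \<le> ln (real p)" using j T by (simp add: u_def less_divide_eq)
        hence "1 \<le> ln (real p) / (real j * L)" using j T by (simp add: le_divide_eq)
        hence "1 * (1 / real p) \<le> ln (real p) / (real j * L) * (1 / real p)"
          by (intro mult_right_mono) auto
        thus ?thesis by simp
      qed
    qed (use j in auto)
    also have "\<dots> = c j * (ln (real p) / real p)" by (simp add: c_def)
    also have "\<dots> \<le> (\<Sum>j | j \<in> {1..J} \<and> p \<in> primes_upto (exp ((real j + 1) * L)). c j * (ln (real p) / real p))"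
      using jJ pj p' c by (intro member_le_sum) auto
    finally show ?thesis .
  qed
  have "(\<Sum>p\<in>primes_upto N - primes_upto T. real p powr (- 1 - 1 / ln T))
      \<le> (\<Sum>p\<in>primes_upto N - primes_upto T.
           \<Sum>j | j \<in> {1..J} \<and> p \<in> primes_upto (exp ((real j + 1) * L)). c j * (ln (real p) / real p))"
    by (intro sum_mono 1)
  also have "\<dots> = (\<Sum>j\<in>{1..J}. \<Sum>p | p \<in> primes_upto N - primes_upto T \<and> p \<in> primes_upto (exp ((real j + 1) * L)).
           c j * (ln (real p) / real p))"
    by (rule sum.swap_restrict) auto
  also have "\<dots> \<le> (\<Sum>j\<in>{1..J}. 4 * exp (-1) ^ j)"
  proof (intro sum_mono)
    fix j assume j: "j \<in> {1..J}"
    have "(\<Sum>p | p \<in> primes_upto N - primes_upto T \<and> p \<in> primes_upto (exp ((real j + 1) * L)).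
           c j * (ln (real p) / real p)) \<le> (\<Sum>p\<in>primes_upto (exp ((real j + 1) * L)). c j * (ln (real p) / real p))"
      using c by (intro sum_mono2) (auto dest!: primes_uptoD(5) intro!: mult_nonneg_nonneg)
    also have "\<dots> = c j * (\<Sum>p\<in>primes_upto (exp ((real j + 1) * L)). ln (real p) / real p)"
      by (simp add: sum_distrib_left)
    also have "\<dots> \<le> c j * (2 * ln (exp ((real j + 1) * L)))"
      using T by (intro mult_left_mono c sum_ln_prime_over_prime_le) auto
    also have "\<dots> = exp (- real j) * (2 * (real j + 1) / real j)" using T j by (simp add: c_def)
    also have "\<dots> \<le> exp (- real j) * 4" using j by (intro mult_left_mono) (auto simp: field_simps)
    also have "exp (- real j) = exp (-1) ^ j" by (simp add: exp_of_nat_mult[symmetric])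
    finally show "(\<Sum>p | p \<in> primes_upto N - primes_upto T \<and> p \<in> primes_upto (exp ((real j + 1) * L)).
           c j * (ln (real p) / real p)) \<le> 4 * exp (-1) ^ j" by simp
  qed
  also have "\<dots> = 4 * (\<Sum>j\<in>{1..J}. exp (-1) ^ j)" by (simp add: sum_distrib_left)
  also have "\<dots> \<le> 4 * 1"
  proof (intro mult_left_mono)
    have e: "exp (-1 :: real) \<le> 1/2" using exp_ge_add_one_self[of 1] by (simp add: exp_minus field_simps)
    have "(\<Sum>j\<in>{1..J}. exp (-1) ^ j) \<le> (\<Sum>j\<in>{1..J}. (1/2 :: real) ^ j)"
      using e by (intro sum_mono power_mono) auto
    also have "\<dots> = 1 - (1/2) ^ J" by (induction J) auto
    also have "\<dots> \<le> 1" by simp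
    finally show "(\<Sum>j\<in>{1..J}. exp (-1) ^ j) \<le> (1 :: real)" .
  qed auto
  finally show ?thesis by simp
qed

lemma sum_prime_inverse_squares_le: "(\<Sum>p\<in>primes_upto x. 1 / (real p)\<^sup>2) \<le> 2"
proof -
  have "primes_upto x \<subseteq> {1..<Suc (nat \<lfloor>x\<rfloor>)}"
    by (auto simp: primes_upto_def le_nat_floor less_Suc_eq_le dest: prime_ge_1_nat)
  hence "(\<Sum>p\<in>primes_upto x. 1 / (real p)\<^sup>2) \<le> (\<Sum>p\<in>{1..<Suc (nat \<lfloor>x\<rfloor>)}. 1 / (real p)\<^sup>2)"
    by (intro sum_mono2) auto
  also have "\<dots> \<le> 2" using sum_inverse_squares_le[of 1 "Suc (nat \<lfloor>x\<rfloor>)"] by simp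
  finally show ?thesis .
qed

lemma norm_prime_powr:
  assumes "prime p" "Re s > 1"
  shows "norm ((of_nat p :: complex) powr (- s)) \<le> 1 / 2"
    and "(norm ((of_nat p :: complex) powr (- s)))\<^sup>2 \<le> 1 / (real p)\<^sup>2"
proof -
  have p: "real p \<ge> 2" using prime_ge_2_nat[OF assms(1)] by simp
  have "norm ((of_nat p :: complex) powr (- s)) = real p powr (- Re s)"
    using p by (subst norm_nat_powr_neg) auto
  also have "\<dots> \<le> real p powr (- 1)" using p assms by (intro powr_mono) auto
  finally have *: "norm ((of_nat p :: complex) powr (- s)) \<le> 1 / real p"
    using p by (simp add: powr_minus divide_inverse)
  also have "\<dots> \<le> 1 / 2" using p by (simp add: field_simps)
  finally show "norm ((of_nat p :: complex) powr (- s)) \<le> 1 / 2" .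
  from power_mono[OF *, of 2] show "(norm ((of_nat p :: complex) powr (- s)))\<^sup>2 \<le> 1 / (real p)\<^sup>2"
    by (simp add: power_divide)
qed

text \<open>Here |1 - z|^2 = 1 - 2 Re z + |z|^2 and ln (1 + y) is at most y. This one-sided form
  suffices for bounding the covariance from above.\<close>

lemma Re_le_minus_ln_norm:
  assumes "norm z < (1 :: real)"
  shows "Re z \<le> - ln (norm (1 - z)) + (norm z)\<^sup>2 / 2"
proof -
  have n: "norm (1 - z) > 0" using assms by auto
  have "2 * ln (norm (1 - z)) = ln ((norm (1 - z))\<^sup>2)"
    using n by (simp add: ln_realpow)
  also have "(norm (1 - z))\<^sup>2 = 1 + (- 2 * Re z + (norm z)\<^sup>2)"
    unfolding cmod_power2 by (simp add: power2_eq_square algebra_simps)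
  also have "ln (1 + (- 2 * Re z + (norm z)\<^sup>2)) \<le> - 2 * Re z + (norm z)\<^sup>2"
  proof (rule ln_add_one_self_le_self2)
    have "0 < (norm (1 - z))\<^sup>2" using n by simp
    also have "(norm (1 - z))\<^sup>2 = 1 + (- 2 * Re z + (norm z)\<^sup>2)"
      unfolding cmod_power2 by (simp add: power2_eq_square algebra_simps)
    finally show "- 1 < - 2 * Re z + (norm z)\<^sup>2" by simp
  qed
  finally show ?thesis by simp
qed

text \<open>The finite Euler factors times zeta give the sieved series, which tends to 1; eventually
  its norm lies between 1/2 and 2, so its logarithm is at most 1 in size. Nonvanishing of zeta comes
  out of the same limit.\<close>

lemma ln_euler_product:
  assumes s: "Re s > 1"
  shows "\<forall>\<^sub>F N in sequentially.
           \<bar>(\<Sum>p\<in>primes_upto (real N). ln (norm (1 - of_nat p powr (- s)))) + ln (norm (dseries s {0<..}))\<bar> \<le> 1"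
    and "norm (dseries s {0<..}) > 0"
proof -
  let ?D = "\<lambda>N. dseries s (coprime_to_all (primes_upto (real N)))"
  have "(\<lambda>N. norm (?D N)) \<longlonglongrightarrow> norm (1 :: complex)"
    by (intro tendsto_norm dseries_coprime_tendsto_1 s)
  hence lim: "(\<lambda>N. norm (?D N)) \<longlonglongrightarrow> 1" by simp
  hence "\<forall>\<^sub>F N in sequentially. norm (?D N) > 1 / 2" by (rule order_tendstoD) auto
  hence ev: "\<forall>\<^sub>F N in sequentially. norm (?D N) > 1 / 2 \<and> norm (?D N) < 2"
    using order_tendstoD(2)[OF lim, of 2] by (auto simp: eventually_conj_iff)
  have D: "?D N = (\<Prod>p\<in>primes_upto (real N). 1 - of_nat p powr (- s)) * dseries s {0<..}" for N
    by (intro dseries_coprime_prod s) (auto dest: primes_uptoD)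
  from eventually_happens[OF ev] obtain N where "norm (?D N) > 1 / 2" by auto
  hence "dseries s {0<..} \<noteq> 0" unfolding D by auto
  thus pos: "norm (dseries s {0<..}) > 0" by simp
  from ev show "\<forall>\<^sub>F N in sequentially.
           \<bar>(\<Sum>p\<in>primes_upto (real N). ln (norm (1 - of_nat p powr (- s)))) + ln (norm (dseries s {0<..}))\<bar> \<le> 1"
  proof eventually_elim
    case (elim N)
    have nz: "norm (1 - (of_nat p :: complex) powr (- s)) > 0" if "p \<in> primes_upto (real N)" for p
      using norm_prime_powr(1)[OF primes_uptoD(1)[OF that] s] by auto
    have "ln (norm (?D N)) = ln (\<Prod>p\<in>primes_upto (real N). norm (1 - (of_nat p :: complex) powr (- s)))
           + ln (norm (dseries s {0<..}))"
      unfolding D norm_mult prod_norm using pos nz by (intro ln_mult_pos prod_pos) auto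
    also have "ln (\<Prod>p\<in>primes_upto (real N). norm (1 - (of_nat p :: complex) powr (- s)))
        = (\<Sum>p\<in>primes_upto (real N). ln (norm (1 - (of_nat p :: complex) powr (- s))))"
      using nz by (intro ln_prod) auto
    finally have "\<dots> + ln (norm (dseries s {0<..})) = ln (norm (?D N))" by simp
    moreover have "\<bar>ln (norm (?D N))\<bar> \<le> 1"
    proof -
      have "ln (norm (?D N)) \<le> ln 2" "ln (1 / 2) \<le> ln (norm (?D N))" using elim by (subst ln_le_cancel_iff; fastforce)+
      moreover have "ln (1 / 2 :: real) = - ln 2" by (simp add: ln_div)
      moreover have "ln (2 :: real) \<le> 1" using ln_2_less_1 by simp
      ultimately show ?thesis by linarith
    qed
    ultimately show ?case by simp
  qed
qed

lemma Re_prime_powr: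
  assumes "p > 0"
  shows "Re ((of_nat p :: complex) powr (- Complex a t)) = real p powr (- a) * cos (t * ln (real p))"
proof -
  have "(of_nat p :: complex) powr (- Complex a t) = exp (- Complex a t * of_real (ln (real p)))"
    using assms by (simp add: powr_def Ln_of_nat)
  thus ?thesis using assms by (simp add: Re_exp powr_def algebra_simps)
qed

lemma abs_prime_cos_sum_diff:
  assumes "T \<ge> exp 1" "N \<ge> T"
  shows "\<bar>prime_cos_sum T t - (\<Sum>p\<in>primes_upto N. Re ((of_nat p :: complex) powr (- Complex (1 + 1 / ln T) t)))\<bar> \<le> 6"
proof -
  define f where "f = (\<lambda>p. Re ((of_nat p :: complex) powr (- Complex (1 + 1 / ln T) t)))"
  define g where "g = (\<lambda>p::nat. real p powr (- 1 - 1 / ln T))"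
  have f: "f p = g p * cos (t * ln (real p))" if "p \<in> primes_upto N" for p
    using primes_uptoD[OF that] by (simp add: f_def g_def Re_prime_powr)
  have sub: "primes_upto T \<subseteq> primes_upto N" using assms by (intro primes_upto_mono)
  have "ln T > 0" "T > 1"
    using ge_exp_1D[OF assms(1)] by auto
  hence g: "g p \<le> 1 / real p" if "p \<in> primes_upto N" for p
  proof -
    have "g p \<le> real p powr (- 1)"
      unfolding g_def using primes_uptoD[OF that] \<open>ln T > 0\<close> by (intro powr_mono) auto
    thus ?thesis using primes_uptoD[OF that] by (simp add: powr_minus divide_inverse)
  qed
  have "\<bar>prime_cos_sum T t - sum f (primes_upto T)\<bar> \<le> (\<Sum>p\<in>primes_upto T. \<bar>1 / real p - g p\<bar> * 1)"
    unfolding prime_cos_sum_def sum_subtractf[symmetric]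
  proof (intro order_trans[OF sum_abs] sum_mono)
    fix p assume p: "p \<in> primes_upto T"
    have "cos (t * ln (real p)) / real p - f p = (1 / real p - g p) * cos (t * ln (real p))"
      using p sub by (subst f) (auto simp: algebra_simps)
    thus "\<bar>cos (t * ln (real p)) / real p - f p\<bar> \<le> \<bar>1 / real p - g p\<bar> * 1"
      by (simp only: abs_mult) (intro mult_left_mono, auto)
  qed
  also have "\<dots> = (\<Sum>p\<in>primes_upto T. 1 / real p - g p)"
    using g sub by (intro sum.cong) (auto simp: subset_iff)
  also have "\<dots> \<le> 2" unfolding g_def by (rule sum_prime_powr_diff_le) fact
  finally have 1: "\<bar>prime_cos_sum T t - sum f (primes_upto T)\<bar> \<le> 2" .
  have "sum f (primes_upto N) - sum f (primes_upto T) = sum f (primes_upto N - primes_upto T)"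
    using sub by (subst sum_diff) auto
  also have "\<bar>\<dots>\<bar> \<le> (\<Sum>p\<in>primes_upto N - primes_upto T. g p)"
  proof (intro order_trans[OF sum_abs] sum_mono)
    fix p assume p: "p \<in> primes_upto N - primes_upto T"
    have "\<bar>f p\<bar> = g p * \<bar>cos (t * ln (real p))\<bar>" using p by (subst f) (auto simp: abs_mult g_def)
    also have "\<dots> \<le> g p * 1" by (intro mult_left_mono) (auto simp: g_def)
    finally show "\<bar>f p\<bar> \<le> g p" by simp
  qed
  also have "\<dots> \<le> 4" unfolding g_def by (rule sum_prime_powr_tail_le) fact
  finally have 2: "\<bar>sum f (primes_upto N) - sum f (primes_upto T)\<bar> \<le> 4" .
  show ?thesis using 1 2 unfolding f_def by linarith
qed

text \<open>The 8 collects 6 from replacing the sharp cut-off at T by the shift 1 / ln T, 1 from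
  \<open>ln_euler_product\<close>, and 1 as half the sum of the inverse squares.\<close>

lemma prime_cos_sum_le_ln_zeta:
  assumes T: "T \<ge> exp 1"
  shows "prime_cos_sum T t \<le> ln (norm (dseries (Complex (1 + 1 / ln T) t) {0<..})) + 8"
proof -
  let ?s = "Complex (1 + 1 / ln T) t"
  have "T > 1" by (rule ge_exp_1D[OF T])
  hence s: "Re ?s > 1" by simp
  have "\<forall>\<^sub>F N in sequentially. real N \<ge> T" by (rule eventually_ge_at_top[THEN eventually_compose_filterlim]) (rule filterlim_real_sequentially)
  from eventually_happens[OF eventually_conj[OF this ln_euler_product(1)[OF s]]]
  obtain N where N: "real N \<ge> T"
    "\<bar>(\<Sum>p\<in>primes_upto (real N). ln (norm (1 - of_nat p powr (- ?s)))) + ln (norm (dseries ?s {0<..}))\<bar> \<le> 1"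
    by auto
  have "prime_cos_sum T t \<le> (\<Sum>p\<in>primes_upto (real N). Re ((of_nat p :: complex) powr (- ?s))) + 6"
    using abs_prime_cos_sum_diff[OF T N(1), of t] by linarith
  also have "(\<Sum>p\<in>primes_upto (real N). Re ((of_nat p :: complex) powr (- ?s)))
     \<le> (\<Sum>p\<in>primes_upto (real N). - ln (norm (1 - of_nat p powr (- ?s))) + 1 / (real p)\<^sup>2 / 2)"
  proof (intro sum_mono)
    fix p assume p: "p \<in> primes_upto (real N)"
    note b = norm_prime_powr[OF primes_uptoD(1)[OF p] s]
    show "Re ((of_nat p :: complex) powr (- ?s)) \<le> - ln (norm (1 - of_nat p powr (- ?s))) + 1 / (real p)\<^sup>2 / 2"
    proof -
      have "norm ((of_nat p :: complex) powr (- ?s)) < 1" using b(1) by linarith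
      from Re_le_minus_ln_norm[OF this] divide_right_mono[OF b(2), of 2] show ?thesis by simp
    qed
  qed
  also have "\<dots> = - (\<Sum>p\<in>primes_upto (real N). ln (norm (1 - of_nat p powr (- ?s)))) + (\<Sum>p\<in>primes_upto (real N). 1 / (real p)\<^sup>2) / 2"
    by (simp only: sum.distrib sum_negf sum_divide_distrib)
  also have "\<dots> \<le> ln (norm (dseries ?s {0<..})) + 1 + 2 / 2"
    using N(2) sum_prime_inverse_squares_le[of "real N"] by (intro add_mono) (auto simp: abs_le_iff)
  finally show ?thesis by simp
qed

text \<open>At t = 0 the Euler factors are real, so - ln (1 - x) \<le> x + 2 x^2 gives the reverse
  inequality. The 11 is 6 for the cut-off, 1 for the Euler product and 4 for the squares.\<close>

lemma prime_cos_sum_0_ge_ln_zeta: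
  assumes T: "T \<ge> exp 1"
  shows "prime_cos_sum T 0 \<ge> ln (norm (dseries (complex_of_real (1 + 1 / ln T)) {0<..})) - 11"
proof -
  let ?s = "Complex (1 + 1 / ln T) 0"
  have "T > 1" by (rule ge_exp_1D[OF T])
  hence s: "Re ?s > 1" by simp
  have "\<forall>\<^sub>F N in sequentially. real N \<ge> T" by (rule eventually_ge_at_top[THEN eventually_compose_filterlim]) (rule filterlim_real_sequentially)
  from eventually_happens[OF eventually_conj[OF this ln_euler_product(1)[OF s]]]
  obtain N where N: "real N \<ge> T"
    "\<bar>(\<Sum>p\<in>primes_upto (real N). ln (norm (1 - of_nat p powr (- ?s)))) + ln (norm (dseries ?s {0<..}))\<bar> \<le> 1"
    by auto
  have "ln (norm (dseries ?s {0<..})) \<le> - (\<Sum>p\<in>primes_upto (real N). ln (norm (1 - of_nat p powr (- ?s)))) + 1"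
    using N(2) by linarith
  also have "- (\<Sum>p\<in>primes_upto (real N). ln (norm (1 - of_nat p powr (- ?s))))
     \<le> (\<Sum>p\<in>primes_upto (real N). Re ((of_nat p :: complex) powr (- ?s)) + 2 * (1 / (real p)\<^sup>2))"
    unfolding sum_negf[symmetric]
  proof (intro sum_mono)
    fix p assume p: "p \<in> primes_upto (real N)"
    note b = norm_prime_powr[OF primes_uptoD(1)[OF p] s]
    define x where "x = real p powr (- (1 + 1 / ln T))"
    have e: "?s = of_real (1 + 1 / ln T)" by (simp add: complex_eq_iff)
    have x: "(of_nat p :: complex) powr (- ?s) = of_real x"
      using powr_of_real[of "real p" "- (1 + 1 / ln T)"] unfolding e x_def by simp
    have x0: "x \<ge> 0" by (simp add: x_def)
    have x1: "x \<le> 1 / 2" "x\<^sup>2 \<le> 1 / (real p)\<^sup>2" using b x0 unfolding x by auto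
    have "- ln (1 - x) \<le> x + 2 * x\<^sup>2"
      using ln_one_minus_pos_lower_bound[OF x0 x1(1)] by simp
    moreover have "norm (1 - complex_of_real x) = 1 - x"
    proof -
      have "norm (complex_of_real (1 - x)) = \<bar>1 - x\<bar>" by (rule norm_of_real)
      thus ?thesis using x1 by simp
    qed
    ultimately show "- ln (norm (1 - of_nat p powr (- ?s))) \<le> Re ((of_nat p :: complex) powr (- ?s)) + 2 * (1 / (real p)\<^sup>2)"
      unfolding x using x1 by simp
  qed
  also have "\<dots> = (\<Sum>p\<in>primes_upto (real N). Re ((of_nat p :: complex) powr (- ?s))) + 2 * (\<Sum>p\<in>primes_upto (real N). 1 / (real p)\<^sup>2)"
    by (simp add: sum.distrib sum_distrib_left)
  also have "\<dots> \<le> (prime_cos_sum T 0 + 6) + 2 * 2"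
    using abs_prime_cos_sum_diff[OF T N(1), of 0] sum_prime_inverse_squares_le[of "real N"]
    by (intro add_mono mult_left_mono) (auto simp: abs_le_iff)
  also have "?s = complex_of_real (1 + 1 / ln T)" by (simp add: complex_eq_iff)
  finally show ?thesis by simp
qed

lemma prime_cos_sum_nonneg_0: "prime_cos_sum T 0 \<ge> 0"
  by (auto simp: prime_cos_sum_def intro!: sum_nonneg)

lemma mertens_second:
  assumes T: "T \<ge> exp 1"
  shows "\<bar>prime_cos_sum T 0 - ln (ln T)\<bar> \<le> 20"
proof -
  note T' = ge_exp_1D[OF T]
  define Z where "Z = norm (dseries (complex_of_real (1 + 1 / ln T)) {0<..})"
  have Zle: "Z \<le> 5 * ln T" and Zge: "Z \<ge> ln T - 4"
    using zeta_bounds_real[of "1 / ln T"] T' unfolding Z_def by auto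
  have Z0: "Z > 0" using ln_euler_product(2)[of "complex_of_real (1 + 1 / ln T)"] T' by (simp add: Z_def)
  have e: "Complex (1 + 1 / ln T) 0 = complex_of_real (1 + 1 / ln T)" by (simp add: complex_eq_iff)
  have "prime_cos_sum T 0 \<le> ln Z + 8"
    using prime_cos_sum_le_ln_zeta[OF T, of 0] unfolding Z_def e .
  also have "ln Z \<le> ln (5 * ln T)" using Zle Z0 T' by (subst ln_le_cancel_iff) auto
  also have "\<dots> = ln 5 + ln (ln T)" using T' by (subst ln_mult) auto
  also have "ln (5 :: real) \<le> 4" using ln_le_minus_one[of 5] by simp
  finally have 1: "prime_cos_sum T 0 \<le> ln (ln T) + 20" by simp
  have 2: "prime_cos_sum T 0 \<ge> ln (ln T) - 20"
  \<comment> \<open>From 8 on, ln T - 4 is at least ln T / 2. Below 8, ln (ln T) is less than 20 and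
    the claim follows from nonnegativity of the sum.\<close>
  proof (cases "ln T \<ge> 8")
    case True
    have "ln (ln T / 2) \<le> ln Z" using True Zge Z0 by (subst ln_le_cancel_iff) auto
    moreover have "ln (ln T / 2) = ln (ln T) - ln 2" using T' by (simp add: ln_div)
    moreover have "ln (2 :: real) \<le> 1" using ln_le_minus_one[of 2] by simp
    ultimately show ?thesis using prime_cos_sum_0_ge_ln_zeta[OF T] unfolding Z_def by linarith
  next
    case False
    hence "ln (ln T) \<le> ln 8" using T' by (subst ln_le_cancel_iff) auto
    also have "ln (8 :: real) \<le> 7" using ln_le_minus_one[of 8] by simp
    finally show ?thesis using prime_cos_sum_nonneg_0[of T] by linarith
  qed
  from 1 2 show ?thesis by (simp add: abs_le_iff)
qed

lemma prime_cos_sum_le_small: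
  assumes T: "T \<ge> exp 1" and t: "t \<noteq> 0" "\<bar>t\<bar> \<le> 1"
  shows "prime_cos_sum T t \<le> 20 - ln \<bar>t\<bar>"
proof -
  note T' = ge_exp_1D[OF T]
  have "prime_cos_sum T t \<le> ln (norm (dseries (Complex (1 + 1 / ln T) t) {0<..})) + 8"
    by (rule prime_cos_sum_le_ln_zeta[OF T])
  also have "ln (norm (dseries (Complex (1 + 1 / ln T) t) {0<..})) \<le> ln (7 / \<bar>t\<bar>)"
    using zeta_bound_small[of "1 / ln T" t] ln_euler_product(2)[of "Complex (1 + 1 / ln T) t"] T' t
    by (subst ln_le_cancel_iff) auto
  also have "\<dots> = ln 7 - ln \<bar>t\<bar>" using t by (simp add: ln_div)
  also have "ln (7 :: real) \<le> 6" using ln_le_minus_one[of 7] by simp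
  finally show ?thesis by simp
qed

lemma prime_cos_sum_le_large:
  assumes T: "T \<ge> exp 1" and t: "\<bar>t\<bar> \<ge> 1"
  shows "prime_cos_sum T t \<le> 20 + ln (ln (\<bar>t\<bar> + 2))"
proof -
  note T' = ge_exp_1D[OF T]
  have l: "ln (\<bar>t\<bar> + 2) > 0" using t by simp
  have "prime_cos_sum T t \<le> ln (norm (dseries (Complex (1 + 1 / ln T) t) {0<..})) + 8"
    by (rule prime_cos_sum_le_ln_zeta[OF T])
  also have "ln (norm (dseries (Complex (1 + 1 / ln T) t) {0<..})) \<le> ln (10 * ln (\<bar>t\<bar> + 2))"
    using zeta_bound_large[of "1 / ln T" t] ln_euler_product(2)[of "Complex (1 + 1 / ln T) t"] T' t l
    by (subst ln_le_cancel_iff) auto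
  also have "\<dots> = ln 10 + ln (ln (\<bar>t\<bar> + 2))" using l by (subst ln_mult) auto
  also have "ln (10 :: real) \<le> 9" using ln_le_minus_one[of 10] by simp
  finally show ?thesis by simp
qed

lemma sum_ln_sq_prime_le:
  assumes T: "T \<ge> 1"
  shows "(\<Sum>p\<in>primes_upto T. (ln (real p))\<^sup>2 / real p) \<le> 2 * (ln T)\<^sup>2"
proof -
  have "(\<Sum>p\<in>primes_upto T. (ln (real p))\<^sup>2 / real p) \<le> (\<Sum>p\<in>primes_upto T. ln T * (ln (real p) / real p))"
  proof (intro sum_mono)
    fix p assume p: "p \<in> primes_upto T"
    note p' = primes_uptoD[OF p]
    have "ln (real p) * (ln (real p) / real p) \<le> ln T * (ln (real p) / real p)"
      using p' by (intro mult_right_mono) auto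
    thus "(ln (real p))\<^sup>2 / real p \<le> ln T * (ln (real p) / real p)"
      by (simp add: power2_eq_square)
  qed
  also have "\<dots> = ln T * (\<Sum>p\<in>primes_upto T. ln (real p) / real p)" by (simp add: sum_distrib_left)
  also have "\<dots> \<le> ln T * (2 * ln T)" using T by (intro mult_left_mono sum_ln_prime_over_prime_le) auto
  finally show ?thesis by (simp add: power2_eq_square)
qed

text \<open>1 - cos y \<le> y^2 / 2 reduces the loss to t^2 / 2 times
  \<open>sum_ln_sq_prime_le\<close>: points closer than 1 / ln T are indistinguishable to the primes
  up to T.\<close>

lemma prime_cos_sum_ge:
  assumes T: "T \<ge> 1" and t: "\<bar>t\<bar> * ln T \<le> 1"
  shows "prime_cos_sum T t \<ge> prime_cos_sum T 0 - 1"
proof -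
  have cos_ge: "cos x \<ge> 1 - x\<^sup>2 / 2" for x :: real
  proof -
    have "cos x = 1 - 2 * (sin (x / 2))\<^sup>2" using cos_double_sin[of "x / 2"] by simp
    moreover have "\<bar>sin (x / 2)\<bar> \<le> \<bar>x / 2\<bar>" by (rule abs_sin_x_le_abs_x)
    hence "(sin (x / 2))\<^sup>2 \<le> (x / 2)\<^sup>2" by (simp only: abs_le_square_iff)
    ultimately show ?thesis by (simp add: power_divide)
  qed
  have "prime_cos_sum T 0 - prime_cos_sum T t = (\<Sum>p\<in>primes_upto T. (1 - cos (t * ln (real p))) / real p)"
    by (simp add: prime_cos_sum_def sum_subtractf diff_divide_distrib)
  also have "\<dots> \<le> (\<Sum>p\<in>primes_upto T. t\<^sup>2 / 2 * ((ln (real p))\<^sup>2 / real p))"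
  proof (intro sum_mono)
    fix p assume p: "p \<in> primes_upto T"
    have "(1 - cos (t * ln (real p))) / real p \<le> ((t * ln (real p))\<^sup>2 / 2) / real p"
      using cos_ge[of "t * ln (real p)"] by (intro divide_right_mono) auto
    thus "(1 - cos (t * ln (real p))) / real p \<le> t\<^sup>2 / 2 * ((ln (real p))\<^sup>2 / real p)"
      by (simp add: power_mult_distrib)
  qed
  also have "\<dots> = t\<^sup>2 / 2 * (\<Sum>p\<in>primes_upto T. (ln (real p))\<^sup>2 / real p)" by (simp add: sum_distrib_left)
  also have "\<dots> \<le> t\<^sup>2 / 2 * (2 * (ln T)\<^sup>2)"
    using T by (intro mult_left_mono sum_ln_sq_prime_le) auto
  also have "\<dots> = (\<bar>t\<bar> * ln T)\<^sup>2" by (simp add: power_mult_distrib)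
  also have "\<dots> \<le> 1\<^sup>2" using t T by (intro power_mono) auto
  finally show ?thesis by simp
qed

subsection \<open>Mean square over an interval\<close>

text \<open>The normalised Lebesgue measure of the interval is taken as a law on the whole line, so
  that functions of h stay Borel on \<open>UNIV\<close>; the restriction of h to the interval enters
  as the almost-everywhere fact \<open>AE_unif\<close>.\<close>

definition unif :: "real \<Rightarrow> real measure" where
  "unif H = density lborel (\<lambda>x. ennreal (indicator {-H..H} x / (2 * H)))"

lemma sets_unif [simp, measurable_cong]: "sets (unif H) = sets borel"
  and space_unif [simp]: "space (unif H) = UNIV"
  by (simp_all add: unif_def)

lemma emeasure_unif:
  assumes "H > 0" "A \<in> sets borel"
  shows "emeasure (unif H) A = emeasure lborel (A \<inter> {-H..H}) / ennreal (2 * H)"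
proof -
  have "emeasure (unif H) A = (\<integral>\<^sup>+x. ennreal (1 / (2 * H)) * indicator (A \<inter> {-H..H}) x \<partial>lborel)"
    using assms unfolding unif_def
    by (subst emeasure_density) (auto intro!: nn_integral_cong split: split_indicator)
  also have "\<dots> = ennreal (1 / (2 * H)) * emeasure lborel (A \<inter> {-H..H})"
    using assms by (subst nn_integral_cmult_indicator) auto
  also have "ennreal (1 / (2 * H)) = 1 / ennreal (2 * H)"
    using assms by (simp add: divide_ennreal flip: ennreal_1)
  finally show ?thesis
    by (metis ennreal_times_divide mult.commute mult.right_neutral)
qed

lemma prob_space_unif: "H > 0 \<Longrightarrow> prob_space (unif H)"
  by (rule prob_spaceI) (simp add: emeasure_unif divide_ennreal)

lemma AE_unif: "H > 0 \<Longrightarrow> AE h in unif H. \<bar>h\<bar> \<le> H"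
  unfolding unif_def by (subst AE_density) (auto split: split_indicator)

lemma emeasure_unif_interval_le:
  assumes "H > 0" "r \<ge> 0"
  shows "emeasure (unif H) {h'. \<bar>h - h'\<bar> \<le> r} \<le> ennreal (r / H)"
proof -
  have "emeasure (unif H) {h'. \<bar>h - h'\<bar> \<le> r} = emeasure lborel ({h'. \<bar>h - h'\<bar> \<le> r} \<inter> {-H..H}) / ennreal (2 * H)"
    using assms by (intro emeasure_unif) auto
  also have "\<dots> \<le> emeasure lborel {h - r..h + r} / ennreal (2 * H)"
    by (intro divide_right_mono_ennreal emeasure_mono) auto
  also have "\<dots> = ennreal (r / H)" using assms by (simp add: divide_ennreal)
  finally show ?thesis .
qed

lemma integral_unif:
  assumes "H > 0" and f: "\<And>x. isCont F' x" and "\<And>x. (F has_real_derivative F' x) (at x)"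
    and "F' \<in> borel_measurable borel"
  shows "(LINT h|unif H. F' h) = (F H - F (- H)) / (2 * H)"
proof -
  have "(LINT h|unif H. F' h) = (LINT h|lborel. (indicator {-H..H} h / (2 * H)) *\<^sub>R F' h)"
    unfolding unif_def using assms by (intro integral_density) auto
  also have "\<dots> = (LINT h|lborel. (F' h * indicator {-H..H} h) / (2 * H))"
    by (intro Bochner_Integration.integral_cong) auto
  also have "\<dots> = (LINT h|lborel. F' h * indicator {-H..H} h) / (2 * H)"
    by simp
  also have "(LINT h|lborel. F' h * indicator {-H..H} h) = F H - F (- H)"
    using assms by (intro integral_FTC_Icc_real) (auto intro: has_field_derivative_at_within)
  finally show ?thesis .
qed


lemma integral_unif_cos:
  assumes "H > 0"
  shows "(LINT h|unif H. cos (u * h)) = (if u = 0 then 1 else sin (u * H) / (u * H))"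
proof -
  interpret prob_space "unif H" by (rule prob_space_unif[OF assms])
  show ?thesis
  proof (cases "u = 0")
    case True
    thus ?thesis using prob_space by simp
  next
    case False
    have "(LINT h|unif H. cos (u * h)) = (sin (u * H) / u - sin (u * (- H)) / u) / (2 * H)"
      using assms False by (intro integral_unif) (auto intro!: derivative_eq_intros continuous_intros)
    thus ?thesis using False by (simp add: field_simps)
  qed
qed

lemma integral_unif_sin:
  assumes "H > 0"
  shows "(LINT h|unif H. sin (u * h)) = 0"
proof (cases "u = 0")
  case False
  have "(LINT h|unif H. sin (u * h)) = (- cos (u * H) / u - - cos (u * (- H)) / u) / (2 * H)"
    using assms False by (intro integral_unif) (auto intro!: derivative_eq_intros continuous_intros)
  thus ?thesis by simp
qed simp

lemma integrable_unif_bounded: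
  assumes "H > 0" "f \<in> borel_measurable borel" "\<And>x. \<bar>f x\<bar> \<le> (B::real)"
  shows "integrable (unif H) f"
proof -
  interpret prob_space "unif H" by (rule prob_space_unif[OF assms(1)])
  show ?thesis using assms by (intro integrable_const_bound[of _ B]) auto
qed

text \<open>The addition formula separates h from h', and the sine integrals vanish by symmetry of
  the interval.\<close>

lemma double_integral_unif_cos:
  assumes "H > 0"
  shows "(LINT h|unif H. LINT h'|unif H. cos (u * (h - h'))) = (LINT h|unif H. cos (u * h))\<^sup>2"
proof -
  have "(LINT h'|unif H. cos (u * (h - h'))) = cos (u * h) * (LINT h|unif H. cos (u * h))" for h
  proof -
    have "(LINT h'|unif H. cos (u * (h - h'))) = (LINT h'|unif H. cos (u * h) * cos (u * h') + sin (u * h) * sin (u * h'))"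
      by (intro Bochner_Integration.integral_cong) (auto simp: right_diff_distrib cos_diff)
    also have "\<dots> = (LINT h'|unif H. cos (u * h) * cos (u * h')) + (LINT h'|unif H. sin (u * h) * sin (u * h'))"
      by (intro Bochner_Integration.integral_add integrable_mult_right integrable_unif_bounded[of _ _ 1] assms) auto
    also have "\<dots> = cos (u * h) * (LINT h|unif H. cos (u * h))"
      by (simp add: integral_unif_sin[OF assms])
    finally show ?thesis .
  qed
  thus ?thesis by (simp add: power2_eq_square)
qed

text \<open>The cut at 1 / sqrt H balances two bounds: below it the squared average is at most 1,
  above it at most 1 / (u H)^2, hence at most 1 / H.\<close>

lemma sq_integral_unif_cos_le:
  assumes "H \<ge> 1"
  shows "(LINT h|unif H. cos (u * h))\<^sup>2 \<le> (if \<bar>u\<bar> \<le> 1 / sqrt H then 1 else 0) + 1 / H"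
proof (cases "u = 0")
  case True
  thus ?thesis using assms integral_unif_cos[of H u] by simp
next
  case False
  have eq: "(LINT h|unif H. cos (u * h))\<^sup>2 = (sin (u * H))\<^sup>2 / (u * H)\<^sup>2"
    using False assms by (simp add: integral_unif_cos power_divide)
  show ?thesis
  proof (cases "\<bar>u\<bar> \<le> 1 / sqrt H")
    case True
    have "(sin (u * H))\<^sup>2 \<le> (u * H)\<^sup>2"
      using abs_sin_x_le_abs_x[of "u * H"] by (simp only: abs_le_square_iff)
    hence "(sin (u * H))\<^sup>2 / (u * H)\<^sup>2 \<le> 1" using False assms by (simp add: divide_le_eq)
    thus ?thesis unfolding eq using True assms by simp (smt (verit) divide_nonneg_nonneg)
  next
    case u: False
    have "(sin (u * H))\<^sup>2 / (u * H)\<^sup>2 \<le> 1 / (u * H)\<^sup>2"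
      by (intro divide_right_mono) (auto simp: abs_square_le_1)
    also have "\<dots> \<le> 1 / H"
    proof -
      have "(1 / sqrt H)\<^sup>2 \<le> \<bar>u\<bar>\<^sup>2" using u assms by (intro power_mono) auto
      hence "1 / H \<le> u\<^sup>2" using assms by (simp add: power_divide)
      hence "1 / H * H\<^sup>2 \<le> u\<^sup>2 * H\<^sup>2" by (intro mult_right_mono) auto
      hence "H \<le> (u * H)\<^sup>2" using assms by (simp add: power_mult_distrib power2_eq_square)
      thus ?thesis using assms False by (intro divide_left_mono mult_pos_pos) auto
    qed
    finally show ?thesis unfolding eq using u by simp
  qed
qed

text \<open>All q lie between p exp (- \<eta>) and p exp \<eta>, an interval of length at most 3
  \<eta> p, so there are at most 3 \<eta> p + 1 of them, and each reciprocal is at most 3 / p as exp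
  \<eta> \<le> 3. The term 3 / p is unavoidable in kind: q = p itself may occur.\<close>

lemma sum_inverse_near_le:
  assumes Q: "finite Q" "\<And>q. q \<in> Q \<Longrightarrow> q > 0 \<and> \<bar>ln (real q) - ln (real p)\<bar> \<le> \<eta>"
    and p: "p > 0" and \<eta>: "0 \<le> \<eta>" "\<eta> \<le> 1"
  shows "(\<Sum>q\<in>Q. 1 / real q) \<le> 12 * \<eta> + 3 / real p"
proof -
  define a where "a = real p * exp (- \<eta>)"
  define b where "b = real p * exp \<eta>"
  have a0: "a > 0" using p by (simp add: a_def)
  have ab: "a \<le> real q \<and> real q \<le> b" if "q \<in> Q" for q
  proof -
    have q: "q > 0" "ln (real q) \<ge> ln (real p) + - \<eta>" "ln (real q) \<le> ln (real p) + \<eta>"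
      using Q(2)[OF that] by auto
    have "exp (ln (real p) + - \<eta>) \<le> exp (ln (real q))" using q by (simp only: exp_le_cancel_iff)
    moreover have "exp (ln (real q)) \<le> exp (ln (real p) + \<eta>)" using q by (simp only: exp_le_cancel_iff)
    ultimately show ?thesis using p q by (simp add: exp_add exp_diff exp_minus a_def b_def divide_inverse)
  qed
  have "Q \<subseteq> {nat \<lceil>a\<rceil>..nat \<lfloor>b\<rfloor>}" using ab by (fastforce simp: le_nat_floor nat_le_iff ceiling_le_iff)
  hence "card Q \<le> card {nat \<lceil>a\<rceil>..nat \<lfloor>b\<rfloor>}" by (intro card_mono) auto
  hence "real (card Q) \<le> real (Suc (nat \<lfloor>b\<rfloor>) - nat \<lceil>a\<rceil>)" by simp
  also have "\<dots> \<le> b - a + 1"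
  proof (cases "nat \<lceil>a\<rceil> \<le> Suc (nat \<lfloor>b\<rfloor>)")
    case True
    have "real (nat \<lfloor>b\<rfloor>) \<le> b" using p by (simp add: b_def)
    moreover have "real (nat \<lceil>a\<rceil>) \<ge> a" by linarith
    ultimately show ?thesis using True by (simp add: of_nat_diff)
  next
    case False
    have "exp (- \<eta>) \<le> exp \<eta>" using \<eta> by simp
    hence "a \<le> b" unfolding a_def b_def by (intro mult_left_mono) auto
    hence "b - a + 1 \<ge> 0" by simp
    moreover have "Suc (nat \<lfloor>b\<rfloor>) - nat \<lceil>a\<rceil> = 0" using False by linarith
    ultimately show ?thesis by simp
  qed
  finally have card: "real (card Q) \<le> b - a + 1" .
  have e1: "exp \<eta> \<le> 1 + 2 * \<eta>" using exp_bound_half[of \<eta>] \<eta> exp_bound[of \<eta>] by (simp add: power2_eq_square) (smt (verit) mult_left_le)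
  have e2: "exp (- \<eta>) \<ge> 1 - \<eta>" using exp_ge_add_one_self[of "- \<eta>"] by simp
  have "b - a = real p * (exp \<eta> - exp (- \<eta>))" by (simp add: a_def b_def algebra_simps)
  also have "\<dots> \<le> real p * (3 * \<eta>)" using e1 e2 by (intro mult_left_mono) auto
  finally have ba: "b - a \<le> 3 * \<eta> * real p" by (simp add: mult.commute)
  have "exp \<eta> \<le> exp 1" using \<eta> by simp
  hence "exp \<eta> \<le> 3" using exp_le by linarith
  hence "3 * exp (-\<eta>) \<ge> 1" by (simp add: exp_minus field_simps)
  hence ia: "1 / a \<le> 3 / real p" using p by (simp add: a_def field_simps)
  have "(\<Sum>q\<in>Q. 1 / real q) \<le> (\<Sum>q\<in>Q. 3 / real p)"
  proof (intro sum_mono)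
    fix q assume q: "q \<in> Q"
    have "1 / real q \<le> 1 / a" using ab[OF q] a0 by (intro divide_left_mono mult_pos_pos) auto
    also note ia
    finally show "1 / real q \<le> 3 / real p" .
  qed
  also have "\<dots> = real (card Q) * (3 / real p)" by simp
  also have "\<dots> \<le> (3 * \<eta> * real p + 1) * (3 / real p)" using card ba by (intro mult_right_mono) auto
  also have "\<dots> = 9 * \<eta> + 3 / real p" using p by (simp add: field_simps)
  finally show ?thesis using \<eta> by simp
qed

text \<open>Expanding the square gives averages at the frequencies ln p - ln q and ln p + ln q.
  Pairs of primes with |ln p - ln q| at most 1 / sqrt H are counted by
  \<open>sum_inverse_near_le\<close>, which yields the last two terms; the generic bound 1 / H on
  all pairs yields the first.\<close>

lemma mean_square_prime_sum_le:
  assumes H: "H \<ge> 1" and P0: "P0 \<ge> 1" and P: "P \<subseteq> primes_upto T - primes_upto P0"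
  defines "S1 \<equiv> (\<Sum>p\<in>P. 1 / real p)"
  shows "(LINT h|unif H. LINT h'|unif H. (\<Sum>p\<in>P. cos ((h - h') * ln (real p)) / real p)\<^sup>2)
           \<le> S1\<^sup>2 / H + 12 * S1 / sqrt H + 6 / P0"
proof -
  have H0: "H > 0" using H by simp
  have fin: "finite P" using P finite_subset by blast
  have pP: "prime p" "real p > P0" "p > 0" if "p \<in> P" for p
    using that P by (auto simp: primes_upto_def dest: prime_gt_0_nat)
  define l where "l = (\<lambda>p::nat. ln (real p))"
  define c where "c = (\<lambda>u. LINT h|unif H. cos (u * h))"
  define m where "m = (\<lambda>u::real. (if \<bar>u\<bar> \<le> 1 / sqrt H then 1 else 0) + 1 / H)"
  have eq: "(\<Sum>p\<in>P. cos (t * l p) / real p)\<^sup>2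
     = (\<Sum>p\<in>P. \<Sum>q\<in>P. 1 / (2 * real p * real q) * cos ((l p - l q) * t) + 1 / (2 * real p * real q) * cos ((l p + l q) * t))" for t
    unfolding power2_eq_square sum_product
    by (intro sum.cong refl) (simp add: algebra_simps cos_add cos_diff)
  have int: "integrable (unif H) (\<lambda>h'. a * cos (u * (h - h')))"
            "integrable (unif H) (\<lambda>h. a * (LINT h'|unif H. cos (u * (h - h'))))" for a u h
  proof -
    show "integrable (unif H) (\<lambda>h'. a * cos (u * (h - h')))"
      by (intro integrable_mult_right integrable_unif_bounded[of _ _ 1] H0) auto
    have "(LINT h'|unif H. cos (u * (h - h'))) = cos (u * h) * c u" for h
    proof -
      have "(LINT h'|unif H. cos (u * (h - h'))) = (LINT h'|unif H. cos (u * h) * cos (u * h') + sin (u * h) * sin (u * h'))"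
        by (intro Bochner_Integration.integral_cong) (auto simp: right_diff_distrib cos_diff)
      also have "\<dots> = (LINT h'|unif H. cos (u * h) * cos (u * h')) + (LINT h'|unif H. sin (u * h) * sin (u * h'))"
        by (intro Bochner_Integration.integral_add integrable_mult_right integrable_unif_bounded[of _ _ 1] H0) auto
      finally show ?thesis by (simp add: integral_unif_sin[OF H0] c_def)
    qed
    moreover have "integrable (unif H) (\<lambda>h. a * (cos (u * h) * c u))"
      by (intro integrable_mult_right integrable_mult_left integrable_unif_bounded[of _ _ 1] H0) auto
    ultimately show "integrable (unif H) (\<lambda>h. a * (LINT h'|unif H. cos (u * (h - h'))))" by simp
  qed
  have "(LINT h|unif H. LINT h'|unif H. (\<Sum>p\<in>P. cos ((h - h') * l p) / real p)\<^sup>2)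
     = (\<Sum>p\<in>P. \<Sum>q\<in>P. 1 / (2 * real p * real q) * (c (l p - l q))\<^sup>2 + 1 / (2 * real p * real q) * (c (l p + l q))\<^sup>2)"
  proof -
    note int1 = int[where a = 1, unfolded mult_1]
    define w where "w = (\<lambda>p q::nat. 1 / (2 * real p * real q))"
    show ?thesis
      unfolding eq c_def double_integral_unif_cos[OF H0, symmetric] w_def[THEN fun_cong, THEN fun_cong, symmetric]
      by (simp add: int1)
  qed
  also have "\<dots> \<le> (\<Sum>p\<in>P. \<Sum>q\<in>P. 1 / (real p * real q) * m (l p - l q))"
  proof (intro sum_mono)
    fix p q assume pq: "p \<in> P" "q \<in> P"
    have c: "(c u)\<^sup>2 \<le> m u" for u unfolding c_def m_def by (rule sq_integral_unif_cos_le[OF H])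
    have lpos: "l p \<ge> 0" "l q \<ge> 0" using pP(3)[OF pq(1)] pP(3)[OF pq(2)] by (auto simp: l_def)
    \<comment> \<open>The logarithms are nonnegative and \<open>m\<close> decreases in |u|, so the
      sum frequency costs no more than the difference frequency.\<close>
    have "m (l p + l q) \<le> m (l p - l q)" using lpos by (auto simp: m_def)
    hence "(c (l p + l q))\<^sup>2 \<le> m (l p - l q)" using c[of "l p + l q"] by linarith
    hence "1 / (2 * real p * real q) * (c (l p - l q))\<^sup>2 + 1 / (2 * real p * real q) * (c (l p + l q))\<^sup>2
       \<le> 1 / (2 * real p * real q) * m (l p - l q) + 1 / (2 * real p * real q) * m (l p - l q)"
      using c by (intro add_mono mult_left_mono) auto
    also have "\<dots> = 1 / (real p * real q) * m (l p - l q)" by (simp add: field_simps)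
    finally show "1 / (2 * real p * real q) * (c (l p - l q))\<^sup>2 + 1 / (2 * real p * real q) * (c (l p + l q))\<^sup>2
      \<le> 1 / (real p * real q) * m (l p - l q)" .
  qed
  also have "\<dots> \<le> (\<Sum>p\<in>P. 1 / real p * (12 * (1 / sqrt H) + 3 / real p) + 1 / real p * (S1 / H))"
  proof (intro sum_mono)
    fix p assume p: "p \<in> P"
    let ?Q = "{q\<in>P. \<bar>l p - l q\<bar> \<le> 1 / sqrt H}"
    have "(\<Sum>q\<in>P. 1 / (real p * real q) * m (l p - l q))
       = (\<Sum>q\<in>P. 1 / real p * (if \<bar>l p - l q\<bar> \<le> 1 / sqrt H then 1 / real q else 0) + 1 / real p * (1 / H * (1 / real q)))"
      by (intro sum.cong refl) (auto simp: m_def algebra_simps add_divide_distrib)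
    also have "\<dots> = 1 / real p * (\<Sum>q\<in>?Q. 1 / real q) + 1 / real p * (S1 / H)"
      unfolding sum.distrib sum_distrib_left[symmetric] S1_def
      using fin by (simp add: sum.inter_filter)
    also have "(\<Sum>q\<in>?Q. 1 / real q) \<le> 12 * (1 / sqrt H) + 3 / real p"
      using fin pP H p by (intro sum_inverse_near_le) (auto simp: l_def abs_minus_commute)
    finally show "(\<Sum>q\<in>P. 1 / (real p * real q) * m (l p - l q))
      \<le> 1 / real p * (12 * (1 / sqrt H) + 3 / real p) + 1 / real p * (S1 / H)"
      by (simp add: mult_left_mono divide_right_mono)
  qed
  also have "\<dots> = S1\<^sup>2 / H + 12 * S1 / sqrt H + 3 * (\<Sum>p\<in>P. 1 / (real p)\<^sup>2)"
    unfolding S1_def by (simp add: sum.distrib sum_distrib_left sum_distrib_right sum_divide_distrib power2_eq_square algebra_simps)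
  also have "(\<Sum>p\<in>P. 1 / (real p)\<^sup>2) \<le> 2 / P0"
  proof -
    define N where "N = nat \<lceil>P0\<rceil>"
    have N: "N \<ge> 1" "real N \<ge> P0" using P0 unfolding N_def by linarith+
    have "P \<subseteq> {N..<Suc (Max P)}"
    proof
      fix p assume p: "p \<in> P"
      have "p \<le> Max P" using fin p by simp
      moreover have "N \<le> p" using pP(2)[OF p] unfolding N_def by linarith
      ultimately show "p \<in> {N..<Suc (Max P)}" by simp
    qed
    hence "(\<Sum>p\<in>P. 1 / (real p)\<^sup>2) \<le> (\<Sum>p=N..<Suc (Max P). 1 / (real p)\<^sup>2)"
      by (intro sum_mono2) auto
    also have "\<dots> \<le> 2 / real N" by (rule sum_inverse_squares_le[OF N(1)])
    also have "\<dots> \<le> 2 / P0" using N P0 by (intro divide_left_mono) auto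
    finally show ?thesis .
  qed
  finally show ?thesis by (simp add: l_def)
qed

subsection \<open>Gaussian linear forms\<close>

lemma char_normal_density:
  assumes "\<sigma> > 0"
  shows "char (density lborel (normal_density 0 \<sigma>)) t = exp (- (\<sigma>\<^sup>2 * t\<^sup>2 / 2))"
proof -
  interpret N: prob_space std_normal_distribution
    by (rule prob_space_normal_density) simp
  have "distributed std_normal_distribution lborel (\<lambda>x. x) std_normal_density"
    by (auto simp: distributed_def intro!: distr_id2)
  hence "distributed std_normal_distribution lborel (\<lambda>x. 0 + \<sigma> * x) (normal_density (0 + \<sigma> * 0) (\<bar>\<sigma>\<bar> * 1))"
    using assms by (intro N.normal_density_affine) auto
  hence "density lborel (normal_density 0 \<sigma>) = distr std_normal_distribution lborel (\<lambda>x. \<sigma> * x)"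
    using assms by (simp add: distributed_def)
  hence "char (density lborel (normal_density 0 \<sigma>)) t = char std_normal_distribution (t * \<sigma>)"
    by (simp add: char_def integral_distr mult.assoc)
  thus ?thesis by (simp add: char_std_normal_distribution power_mult_distrib mult.commute)
qed

lemma char_half_normal: "char half_normal_measure t = exp (- (t\<^sup>2 / 4))"
  unfolding half_normal_measure_def by (subst char_normal_density) (auto simp: power_divide)

lemma prob_space_half_normal: "prob_space half_normal_measure"
  unfolding half_normal_measure_def by (rule prob_space_normal_density) simp

lemma sets_half_normal [measurable_cong, simp]: "sets half_normal_measure = sets borel"
  by (simp add: half_normal_measure_def)

lemma space_half_normal [simp]: "space half_normal_measure = UNIV"
  by (simp add: half_normal_measure_def)

lemma char_half_normal_pair:
  "char (distr (half_normal_measure \<Otimes>\<^sub>M half_normal_measure) borel (\<lambda>p. fst p * a + snd p * b)) t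
     = exp (- (t\<^sup>2 * (a\<^sup>2 + b\<^sup>2) / 4))"
proof -
  let ?N = half_normal_measure
  interpret N: prob_space ?N by (rule prob_space_half_normal)
  interpret P: pair_prob_space ?N ?N ..
  have fst: "distr (?N \<Otimes>\<^sub>M ?N) borel fst = ?N"
  proof -
    have "distr (?N \<Otimes>\<^sub>M ?N) ?N fst = ?N"
      by (rule N.distr_pair_fst)
    thus ?thesis by (simp cong: distr_cong)
  qed
  have snd: "distr (?N \<Otimes>\<^sub>M ?N) borel snd = ?N"
  proof (rule measure_eqI)
    fix A assume "A \<in> sets (distr (?N \<Otimes>\<^sub>M ?N) borel snd)"
    hence A: "A \<in> sets borel" by simp
    have "snd -` A \<inter> space (?N \<Otimes>\<^sub>M ?N) = space ?N \<times> A"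
      using sets.sets_into_space[OF A] by (auto simp: space_pair_measure half_normal_measure_def)
    thus "emeasure (distr (?N \<Otimes>\<^sub>M ?N) borel snd) A = emeasure ?N A"
      using A N.emeasure_pair_measure_Times[of "space ?N" ?N A]
N.emeasure_space_1 by (simp add: emeasure_distr)
  qed simp
  have ind: "P.indep_var borel fst borel snd"
    unfolding P.indep_var_distribution_eq fst snd
    by (auto intro!: measure_eqI simp: emeasure_distr cong: distr_cong)
  have "P.indep_var borel ((\<lambda>x. x * a) \<circ> fst) borel ((\<lambda>x. x * b) \<circ> snd)"
    by (rule P.indep_var_compose[OF ind]) auto
  hence "char (distr (?N \<Otimes>\<^sub>M ?N) borel (\<lambda>p. fst p * a + snd p * b)) t
     = char (distr (?N \<Otimes>\<^sub>M ?N) borel (\<lambda>p. fst p * a)) t * char (distr (?N \<Otimes>\<^sub>M ?N) borel (\<lambda>p. snd p * b)) t"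
    using P.char_distr_add[of "(\<lambda>x. x * a) \<circ> fst" "(\<lambda>x. x * b) \<circ> snd" t] by (simp add: o_def)
  also have "char (distr (?N \<Otimes>\<^sub>M ?N) borel (\<lambda>p. fst p * a)) t = char (distr (?N \<Otimes>\<^sub>M ?N) borel fst) (t * a)"
    by (simp add: char_def integral_distr algebra_simps)
  also have "char (distr (?N \<Otimes>\<^sub>M ?N) borel (\<lambda>p. snd p * b)) t = char (distr (?N \<Otimes>\<^sub>M ?N) borel snd) (t * b)"
    by (simp add: char_def integral_distr algebra_simps)
  finally show ?thesis
    by (simp add: fst snd char_half_normal power_mult_distrib algebra_simps add_divide_distrib
        flip: exp_add of_real_mult)
qed

text \<open>Re (w z) = x Re z - y Im z has variance |z|^2 / 2: the law is rotation invariant, so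
  only the norm of the coefficient enters.\<close>

lemma char_Re_std_complex_gaussian:
  "char (distr std_complex_gaussian borel (\<lambda>w. Re (w * z))) t = exp (- (t\<^sup>2 * (norm z)\<^sup>2 / 4))"
proof -
  have m: "(\<lambda>(x, y). Complex x y) \<in> borel \<Otimes>\<^sub>M borel \<rightarrow>\<^sub>M borel"
  proof -
    have "(\<lambda>p. of_real (fst p) + \<i> * of_real (snd p)) \<in> borel \<Otimes>\<^sub>M borel \<rightarrow>\<^sub>M borel" by measurable
    thus ?thesis by (simp add: Complex_eq case_prod_beta')
  qed
  have "distr std_complex_gaussian borel (\<lambda>w. Re (w * z))
    = distr (half_normal_measure \<Otimes>\<^sub>M half_normal_measure) borel (\<lambda>p. fst p * Re z + snd p * (- Im z))"
    unfolding std_complex_gaussian_def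
    using m by (subst distr_distr) (auto simp: o_def case_prod_beta' cong: measurable_cong_sets)
  show ?thesis unfolding \<open>distr std_complex_gaussian borel _ = _\<close> char_half_normal_pair
    by (simp add: cmod_power2)
qed

text \<open>Two bounded weights give the same law of \<open>X\<close> as soon as they give the same
  characteristic function. Applied first with trigonometric weights and then with indicators,
  this reduces two-dimensional uniqueness to one-dimensional uniqueness.\<close>
lemma (in prob_space) weighted_law_eq:
  fixes X g :: "'a \<Rightarrow> real"
  assumes X [measurable]: "X \<in> borel_measurable M" and g [measurable]: "g \<in> borel_measurable M"
    and bnd: "\<And>\<omega>. 0 \<le> g \<omega> \<and> g \<omega> \<le> K" and c: "c > 0" "expectation g = c"
    and ch: "\<And>s. (CLINT \<omega>|M. g \<omega> * iexp (s * X \<omega>)) = c * (CLINT \<omega>|M. iexp (s * X \<omega>))"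
    and B: "B \<in> sets borel"
  shows "expectation (\<lambda>\<omega>. g \<omega> * indicator B (X \<omega>)) = c * prob {\<omega>\<in>space M. X \<omega> \<in> B}"
proof -
  define Q where "Q = density M (\<lambda>\<omega>. ennreal (g \<omega> / c))"
  have sQ [measurable_cong, simp]: "sets Q = sets M" and spQ: "space Q = space M" by (simp_all add: Q_def)
  have ig: "integrable M g" using bnd by (intro integrable_const_bound[of _ K]) auto
  have Qi: "(\<integral>\<omega>. f \<omega> \<partial>Q) = (\<integral>\<omega>. (g \<omega> / c) *\<^sub>R f \<omega> \<partial>M)" if "f \<in> borel_measurable M" for f :: "'a \<Rightarrow> complex"
    unfolding Q_def using that c bnd by (intro integral_density) auto
  have Qir: "(\<integral>\<omega>. f \<omega> \<partial>Q) = (\<integral>\<omega>. (g \<omega> / c) *\<^sub>R f \<omega> \<partial>M)" if "f \<in> borel_measurable M" for f :: "'a \<Rightarrow> real"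
    unfolding Q_def using that c bnd by (intro integral_density) auto
  have "emeasure Q (space Q) = (\<integral>\<^sup>+\<omega>. ennreal (g \<omega> / c) \<partial>M)"
    unfolding spQ by (simp add: Q_def emeasure_density cong: nn_integral_cong)
  also have "\<dots> = ennreal (\<integral>\<omega>. g \<omega> / c \<partial>M)"
    using bnd c ig by (intro nn_integral_eq_integral) auto
  also have "\<dots> = 1" using c by simp
  finally interpret Q: prob_space Q by (rule prob_spaceI)
  have XQ [measurable]: "X \<in> borel_measurable Q" by simp
  have "distr Q borel X = distr M borel X"
  proof (rule Levy_uniqueness)
    show "real_distribution (distr Q borel X)" "real_distribution (distr M borel X)"
      by (auto intro!: Q.real_distribution_distr real_distribution_distr)
    show "char (distr Q borel X) = char (distr M borel X)"
    proof
      fix s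
      have "char (distr Q borel X) s = (CLINT \<omega>|Q. iexp (s * X \<omega>))"
        by (simp add: char_def integral_distr)
      also have "\<dots> = (CLINT \<omega>|M. (g \<omega> / c) *\<^sub>R iexp (s * X \<omega>))"
        by (rule Qi) simp
      also have "\<dots> = (CLINT \<omega>|M. (1 / of_real c) * (g \<omega> * iexp (s * X \<omega>)))"
        by (intro Bochner_Integration.integral_cong) (auto simp: scaleR_conv_of_real)
      also have "\<dots> = (1 / of_real c) * (CLINT \<omega>|M. g \<omega> * iexp (s * X \<omega>))"
        by (rule integral_mult_right_zero)
      also have "\<dots> = char (distr M borel X) s"
        unfolding ch using c by (simp add: char_def integral_distr)
      finally show "char (distr Q borel X) s = char (distr M borel X) s" .
    qed
  qed
  hence "measure (distr Q borel X) B = measure (distr M borel X) B" by simp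
  hence "measure Q (X -` B \<inter> space M) = prob (X -` B \<inter> space M)"
    using B by (simp add: measure_distr spQ)
  moreover have "measure Q (X -` B \<inter> space M) = (\<integral>\<omega>. indicator B (X \<omega>) \<partial>Q)"
  proof -
    have "(\<integral>\<omega>. indicator B (X \<omega>) \<partial>Q) = (\<integral>\<omega>. indicator (X -` B \<inter> space M) \<omega> \<partial>Q)"
      by (intro Bochner_Integration.integral_cong) (auto simp: spQ split: split_indicator)
    also have "\<dots> = measure Q (X -` B \<inter> space M)"
      using B by (subst Bochner_Integration.integral_indicator) (auto simp: spQ)
    finally show ?thesis by simp
  qed
  moreover have "(\<integral>\<omega>. indicator B (X \<omega>) \<partial>Q) = (\<integral>\<omega>. (1 / c) * (g \<omega> * indicator B (X \<omega>)) \<partial>M)"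
    using B by (subst Qir) (auto intro!: Bochner_Integration.integral_cong)
  moreover have "X -` B \<inter> space M = {\<omega>\<in>space M. X \<omega> \<in> B}" by auto
  ultimately show ?thesis using c by (simp add: field_simps)
qed

locale gaussian_family = prob_space M for M :: "'a measure" +
  fixes G :: "'i \<Rightarrow> 'a \<Rightarrow> complex" and I :: "'i set"
  assumes indep: "indep_vars (\<lambda>_. borel) G I"
    and law: "\<And>i. i \<in> I \<Longrightarrow> distr M borel (G i) = std_complex_gaussian"
begin

text \<open>The covariance of \<open>lin F a\<close> and \<open>lin F b\<close> is \<open>inn F a b / 2\<close>: the real and imaginary parts of
  each \<open>G i\<close> have variance \<open>1/2\<close>.\<close>
definition lin :: "'i set \<Rightarrow> ('i \<Rightarrow> complex) \<Rightarrow> 'a \<Rightarrow> real" where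
  "lin F a \<omega> = (\<Sum>i\<in>F. Re (G i \<omega> * a i))"

definition nsq :: "'i set \<Rightarrow> ('i \<Rightarrow> complex) \<Rightarrow> real" where
  "nsq F a = (\<Sum>i\<in>F. (norm (a i))\<^sup>2)"

definition inn :: "'i set \<Rightarrow> ('i \<Rightarrow> complex) \<Rightarrow> ('i \<Rightarrow> complex) \<Rightarrow> real" where
  "inn F a b = (\<Sum>i\<in>F. Re (a i * cnj (b i)))"

lemma G_measurable: "i \<in> I \<Longrightarrow> G i \<in> borel_measurable M"
  using indep by (auto simp: indep_vars_def)

lemma lin_measurable: "F \<subseteq> I \<Longrightarrow> lin F a \<in> borel_measurable M"
  unfolding lin_def[abs_def] using G_measurable by (intro borel_measurable_sum) (auto intro!: measurable_compose[OF _ borel_measurable_Re] borel_measurable_times)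

lemma nsq_nonneg: "nsq F a \<ge> 0" by (simp add: nsq_def sum_nonneg)

lemma lin_comb: "lin F (\<lambda>i. of_real c * a i + of_real d * b i) \<omega> = c * lin F a \<omega> + d * lin F b \<omega>"
proof -
  have "Re (G i \<omega> * (of_real c * a i + of_real d * b i)) = c * Re (G i \<omega> * a i) + d * Re (G i \<omega> * b i)" for i
    by (simp add: algebra_simps)
  thus ?thesis by (simp only: lin_def sum.distrib sum_distrib_left)
qed

lemma nsq_comb: "nsq F (\<lambda>i. of_real c * a i + of_real d * b i) = c\<^sup>2 * nsq F a + d\<^sup>2 * nsq F b + 2 * c * d * inn F a b"
proof -
  have "(norm (of_real c * a i + of_real d * b i))\<^sup>2
    = c\<^sup>2 * (norm (a i))\<^sup>2 + d\<^sup>2 * (norm (b i))\<^sup>2 + 2 * c * d * Re (a i * cnj (b i))" for i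
    unfolding cmod_power2 by (simp add: power2_eq_square algebra_simps)
  thus ?thesis by (simp only: nsq_def inn_def sum.distrib sum_distrib_left)
qed

lemma char_lin:
  assumes F: "F \<subseteq> I"
  shows "char (distr M borel (lin F a)) t = exp (- (t\<^sup>2 * nsq F a / 4))"
proof -
  have ind: "indep_vars (\<lambda>_. borel) (\<lambda>i \<omega>. Re (G i \<omega> * a i)) F"
    using indep_vars_compose2[OF indep_vars_subset[OF indep F], of "\<lambda>i w. Re (w * a i)" "\<lambda>_. borel"]
    by simp
  have "char (distr M borel (\<lambda>\<omega>. Re (G i \<omega> * a i))) t = exp (- (t\<^sup>2 * (norm (a i))\<^sup>2 / 4))" if "i \<in> F" for i
  proof -
    have [measurable]: "G i \<in> borel_measurable M" using G_measurable that F by auto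
    have "distr M borel (\<lambda>\<omega>. Re (G i \<omega> * a i)) = distr (distr M borel (G i)) borel (\<lambda>w. Re (w * a i))"
      by (subst distr_distr) (auto simp: o_def)
    also have "distr M borel (G i) = std_complex_gaussian" using law that F by auto
    finally show ?thesis by (simp only: char_Re_std_complex_gaussian)
  qed
  hence "char (distr M borel (lin F a)) t = (\<Prod>i\<in>F. exp (- (t\<^sup>2 * (norm (a i))\<^sup>2 / 4)))"
    unfolding lin_def[abs_def] using char_distr_sum[OF ind, of t] by simp
  also have "\<dots> = complex_of_real (exp (\<Sum>i\<in>F. - (t\<^sup>2 * (norm (a i))\<^sup>2 / 4)))"
    by (cases "finite F") (auto simp: exp_sum)
  also have "(\<Sum>i\<in>F. - (t\<^sup>2 * (norm (a i))\<^sup>2 / 4)) = - (t\<^sup>2 * nsq F a / 4)"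
    by (simp add: nsq_def sum_negf sum_distrib_left sum_divide_distrib)
  finally show ?thesis .
qed

lemma lin_normal:
  assumes F: "F \<subseteq> I" and pos: "nsq F a > 0"
  shows "distributed M lborel (lin F a) (normal_density 0 (sqrt (nsq F a / 2)))"
proof -
  have [measurable]: "lin F a \<in> borel_measurable M" by (rule lin_measurable[OF F])
  let ?D = "density lborel (normal_density 0 (sqrt (nsq F a / 2)))"
  have "distr M borel (lin F a) = ?D"
  proof (rule Levy_uniqueness)
    show "real_distribution (distr M borel (lin F a))" by (rule real_distribution_distr) simp
    interpret D: prob_space ?D using pos by (intro prob_space_normal_density) simp
    show "real_distribution ?D" by standard auto
    show "char (distr M borel (lin F a)) = char ?D"
      using pos by (intro ext) (simp add: char_lin[OF F] char_normal_density mult.commute)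
  qed
  moreover have "distr M lborel (lin F a) = distr M borel (lin F a)" by (rule distr_cong) auto
  ultimately show ?thesis by (auto simp: distributed_def)
qed

text \<open>A combination of two linear forms is again one, so the joint characteristic function is
  a value at 1 of the one-dimensional \<open>char_lin\<close>.\<close>

lemma CLINT_lin:
  assumes F: "F \<subseteq> I"
  shows "(CLINT \<omega>|M. iexp (s * lin F a \<omega> + t * lin F b \<omega>))
           = exp (- ((s\<^sup>2 * nsq F a + t\<^sup>2 * nsq F b + 2 * s * t * inn F a b) / 4))"
proof -
  have [measurable]: "lin F a \<in> borel_measurable M" for a by (rule lin_measurable[OF F])
  have "(CLINT \<omega>|M. iexp (s * lin F a \<omega> + t * lin F b \<omega>))
     = char (distr M borel (lin F (\<lambda>i. of_real s * a i + of_real t * b i))) 1"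
    unfolding char_def by (subst integral_distr) (simp_all add: lin_comb)
  thus ?thesis by (simp add: char_lin[OF F] nsq_comb)
qed

text \<open>Orthogonality makes the joint characteristic function factor.
  \<open>weighted_law_eq\<close> is applied with the trigonometric weights in V to get the joint
  integrals of cos (t V) and sin (t V) with the event U in A, and then with the indicator of that
  event as the weight and V as the variable.\<close>

lemma prob_lin_indep:
  assumes F: "F \<subseteq> I" and orth: "inn F a b = 0" and AB: "A \<in> sets borel" "B \<in> sets borel"
  shows "prob {\<omega>\<in>space M. lin F a \<omega> \<in> A \<and> lin F b \<omega> \<in> B}
       = prob {\<omega>\<in>space M. lin F a \<omega> \<in> A} * prob {\<omega>\<in>space M. lin F b \<omega> \<in> B}"
proof -
  define U where "U = lin F a"
  define V where "V = lin F b"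
  have [measurable]: "U \<in> borel_measurable M" "V \<in> borel_measurable M"
    unfolding U_def V_def by (rule lin_measurable[OF F])+
  note [measurable] = AB
  define u where "u = (\<lambda>s. exp (- (s\<^sup>2 * nsq F a / 4)))"
  define v where "v = (\<lambda>t. exp (- (t\<^sup>2 * nsq F b / 4)))"
  have UV: "(CLINT \<omega>|M. iexp (s * U \<omega> + t * V \<omega>)) = of_real (u s * v t)" for s t
    unfolding U_def V_def u_def v_def CLINT_lin[OF F] orth
    by (simp add: add_divide_distrib flip: exp_add)
  have v_minus: "v (- t) = v t" and vpos: "v t > 0" and v0: "v 0 = 1" and u0: "u 0 = 1" for t
    by (auto simp: v_def u_def)
  have int: "integrable M (\<lambda>\<omega>. iexp (s * U \<omega> + t * V \<omega>))" for s t
    by (rule integrable_iexp) auto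
  have cosrep: "complex_of_real (cos (t * V \<omega>)) * iexp (s * U \<omega>)
      = (iexp (s * U \<omega> + t * V \<omega>) + iexp (s * U \<omega> + (- t) * V \<omega>)) / 2" for s t \<omega>
    unfolding cos_of_real[symmetric] cos_exp_eq
    by (simp add: field_simps flip: exp_add)
  have sinrep: "complex_of_real (sin (t * V \<omega>)) * iexp (s * U \<omega>)
      = (iexp (s * U \<omega> + t * V \<omega>) - iexp (s * U \<omega> + (- t) * V \<omega>)) / (2 * \<i>)" for s t \<omega>
    unfolding sin_of_real[symmetric] sin_exp_eq
    by (simp add: field_simps flip: exp_add)
  have cosint: "(CLINT \<omega>|M. complex_of_real (cos (t * V \<omega>)) * iexp (s * U \<omega>)) = of_real (u s * v t)" for s t
    unfolding cosrep using int[of s t] int[of s "- t"] UV[of s t] UV[of s "- t"] v_minus[of t]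
    by (simp add: field_simps)
  have sinint: "(CLINT \<omega>|M. complex_of_real (sin (t * V \<omega>)) * iexp (s * U \<omega>)) = 0" for s t
    unfolding sinrep using int[of s t] int[of s "- t"] UV[of s t] UV[of s "- t"] v_minus[of t]
    by simp
  have icos: "integrable M (\<lambda>\<omega>. complex_of_real (cos (t * V \<omega>)) * iexp (s * U \<omega>))"
   and isin: "integrable M (\<lambda>\<omega>. complex_of_real (sin (t * V \<omega>)) * iexp (s * U \<omega>))"
   and iU: "integrable M (\<lambda>\<omega>. iexp (s * U \<omega>))" for s t
    by (intro integrable_const_bound[of _ 1] AE_I2; (simp add: norm_mult)?; measurable)+
  have Uint: "(CLINT \<omega>|M. iexp (s * U \<omega>)) = of_real (u s)" for s
    using UV[of s 0] v0 by simp
  have Vint: "(CLINT \<omega>|M. iexp (t * V \<omega>)) = of_real (v t)" for t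
    using UV[of 0 t] u0 by simp
  have ecos: "expectation (\<lambda>\<omega>. cos (t * V \<omega>)) = v t" for t
  proof -
    have "complex_of_real (expectation (\<lambda>\<omega>. cos (t * V \<omega>))) = of_real (v t)"
      using cosint[of t 0] u0 by simp
    thus ?thesis by (simp only: of_real_eq_iff)
  qed
  have esin: "expectation (\<lambda>\<omega>. sin (t * V \<omega>)) = 0" for t
  proof -
    have "complex_of_real (expectation (\<lambda>\<omega>. sin (t * V \<omega>))) = of_real 0"
      using sinint[of t 0] by simp
    thus ?thesis by (simp only: of_real_eq_iff)
  qed
  have ic: "integrable M (\<lambda>\<omega>. cos (t * V \<omega>))" "integrable M (\<lambda>\<omega>. sin (t * V \<omega>))" for t
    by (intro integrable_const_bound[of _ 1] AE_I2; simp)+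
  \<comment> \<open>The weight has to be nonnegative with positive mean, hence the shift of the
    cosine by 1; the indicator term that it adds is subtracted again in
    \<open>cosA'\<close>.\<close>
  have cosA: "expectation (\<lambda>\<omega>. (1 + cos (t * V \<omega>)) * indicator A (U \<omega>)) = (1 + v t) * prob {\<omega>\<in>space M. U \<omega> \<in> A}" for t
  proof (rule weighted_law_eq[where K = 2])
    show "0 \<le> 1 + cos (t * V \<omega>) \<and> 1 + cos (t * V \<omega>) \<le> 2" for \<omega>
      using cos_ge_minus_one[of "t * V \<omega>"] cos_le_one[of "t * V \<omega>"] by linarith
    show "1 + v t > 0" using vpos[of t] by simp
    show "expectation (\<lambda>\<omega>. 1 + cos (t * V \<omega>)) = 1 + v t"
      using ic by (simp add: ecos prob_space)
    show "(CLINT \<omega>|M. complex_of_real (1 + cos (t * V \<omega>)) * iexp (s * U \<omega>)) = complex_of_real (1 + v t) * (CLINT \<omega>|M. iexp (s * U \<omega>))" for s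
      using icos[of t s] iU[of s] cosint[of t s] Uint[of s] by (simp add: distrib_right distrib_left mult.commute)
  qed (use AB in auto)
  have sinA: "expectation (\<lambda>\<omega>. (1 + sin (t * V \<omega>)) * indicator A (U \<omega>)) = 1 * prob {\<omega>\<in>space M. U \<omega> \<in> A}" for t
  proof (rule weighted_law_eq[where K = 2])
    show "0 \<le> 1 + sin (t * V \<omega>) \<and> 1 + sin (t * V \<omega>) \<le> 2" for \<omega>
      using sin_ge_minus_one[of "t * V \<omega>"] sin_le_one[of "t * V \<omega>"] by linarith
    show "expectation (\<lambda>\<omega>. 1 + sin (t * V \<omega>)) = 1"
      using ic by (simp add: esin prob_space)
    show "(CLINT \<omega>|M. complex_of_real (1 + sin (t * V \<omega>)) * iexp (s * U \<omega>)) = complex_of_real 1 * (CLINT \<omega>|M. iexp (s * U \<omega>))" for s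
      using isin[of t s] iU[of s] sinint[of t s] by (simp add: distrib_right)
  qed (use AB in auto)
  define q where "q = prob {\<omega>\<in>space M. U \<omega> \<in> A}"
  have indA: "expectation (\<lambda>\<omega>. indicator A (U \<omega>)) = q"
  proof -
    have "expectation (\<lambda>\<omega>. indicat_real A (U \<omega>)) = expectation (\<lambda>\<omega>. indicat_real {\<omega>\<in>space M. U \<omega> \<in> A} \<omega>)"
      by (intro Bochner_Integration.integral_cong) (auto split: split_indicator)
    thus ?thesis by (simp add: q_def)
  qed
  have iA: "integrable M (\<lambda>\<omega>. indicator A (U \<omega>) :: real)"
    "integrable M (\<lambda>\<omega>. cos (t * V \<omega>) * indicator A (U \<omega>))"
    "integrable M (\<lambda>\<omega>. sin (t * V \<omega>) * indicator A (U \<omega>))" for t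
    by (intro integrable_const_bound[of _ 1] AE_I2; (simp add: abs_mult split: split_indicator)?; measurable)+
  have cosA': "expectation (\<lambda>\<omega>. cos (t * V \<omega>) * indicator A (U \<omega>)) = v t * q" for t
    using cosA[of t] iA indA by (simp add: distrib_right q_def)
  have sinA': "expectation (\<lambda>\<omega>. sin (t * V \<omega>) * indicator A (U \<omega>)) = 0" for t
    using sinA[of t] iA indA by (simp add: distrib_right q_def)
  show ?thesis
  \<comment> \<open>With \<open>q = 0\<close> the indicator weight has mean zero and cannot be
    normalised to a density, but then both sides vanish.\<close>
  proof (cases "q = 0")
    case True
    have "prob {\<omega>\<in>space M. U \<omega> \<in> A \<and> V \<omega> \<in> B} \<le> q"
      unfolding q_def by (intro finite_measure_mono) auto
    hence "prob {\<omega>\<in>space M. U \<omega> \<in> A \<and> V \<omega> \<in> B} = 0"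
      using True by (simp only: measure_le_0_iff)
    thus ?thesis using True unfolding q_def U_def V_def by simp
  next
    case False
    hence q: "q > 0" by (simp add: q_def zero_less_measure_iff)
    \<comment> \<open>The second use of uniqueness, with the roles of U and V exchanged.\<close>
    have "expectation (\<lambda>\<omega>. indicator A (U \<omega>) * indicator B (V \<omega>)) = q * prob {\<omega>\<in>space M. V \<omega> \<in> B}"
    proof (rule weighted_law_eq[where K = 1])
      fix t
      have "complex_of_real (indicator A (U \<omega>)) * iexp (t * V \<omega>)
         = complex_of_real (cos (t * V \<omega>) * indicator A (U \<omega>)) + \<i> * complex_of_real (sin (t * V \<omega>) * indicator A (U \<omega>))" for \<omega>
        by (simp add: exp_Euler algebra_simps cos_of_real sin_of_real flip: of_real_mult)
      hence "(CLINT \<omega>|M. complex_of_real (indicator A (U \<omega>)) * iexp (t * V \<omega>))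
         = (CLINT \<omega>|M. complex_of_real (cos (t * V \<omega>) * indicator A (U \<omega>)))
           + \<i> * (CLINT \<omega>|M. complex_of_real (sin (t * V \<omega>) * indicator A (U \<omega>)))"
        using iA(2,3)[of t] by (simp del: of_real_mult)
      also have "\<dots> = complex_of_real q * of_real (v t)"
        by (simp only: integral_complex_of_real cosA' sinA') simp
      finally show "(CLINT \<omega>|M. complex_of_real (indicator A (U \<omega>)) * iexp (t * V \<omega>))
          = complex_of_real q * (CLINT \<omega>|M. iexp (t * V \<omega>))" by (simp only: Vint)
    qed (use AB q indA in \<open>auto split: split_indicator\<close>)
    moreover have "expectation (\<lambda>\<omega>. indicator A (U \<omega>) * indicator B (V \<omega>))
       = prob {\<omega>\<in>space M. U \<omega> \<in> A \<and> V \<omega> \<in> B}"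
    proof -
      have "expectation (\<lambda>\<omega>. indicat_real A (U \<omega>) * indicat_real B (V \<omega>))
        = expectation (\<lambda>\<omega>. indicat_real {\<omega>\<in>space M. U \<omega> \<in> A \<and> V \<omega> \<in> B} \<omega>)"
        by (intro Bochner_Integration.integral_cong) (auto split: split_indicator)
      thus ?thesis by simp
    qed
    ultimately show ?thesis by (simp add: q_def U_def V_def)
  qed
qed

lemma indep_lin:
  assumes F: "F \<subseteq> I" and orth: "inn F a b = 0"
  shows "indep_var borel (lin F a) borel (lin F b)"
  unfolding indep_var_distribution_eq
proof (intro conjI)
  show m [measurable]: "random_variable borel (lin F a)" "random_variable borel (lin F b)"
    by (rule lin_measurable[OF F])+
  interpret A: prob_space "distr M borel (lin F a)" by (rule prob_space_distr) simp
  interpret B: prob_space "distr M borel (lin F b)" by (rule prob_space_distr) simp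
  show "distr M borel (lin F a) \<Otimes>\<^sub>M distr M borel (lin F b) = distr M (borel \<Otimes>\<^sub>M borel) (\<lambda>x. (lin F a x, lin F b x))"
  proof (rule pair_measure_eqI)
    fix A B assume "A \<in> sets (distr M borel (lin F a))" "B \<in> sets (distr M borel (lin F b))"
    hence AB [measurable]: "A \<in> sets borel" "B \<in> sets borel" by auto
    have "lin F a -` A \<inter> space M = {\<omega>\<in>space M. lin F a \<omega> \<in> A}"
      "lin F b -` B \<inter> space M = {\<omega>\<in>space M. lin F b \<omega> \<in> B}"
      "(\<lambda>x. (lin F a x, lin F b x)) -` (A \<times> B) \<inter> space M = {\<omega>\<in>space M. lin F a \<omega> \<in> A \<and> lin F b \<omega> \<in> B}"
      by auto
    thus "emeasure (distr M borel (lin F a)) A * emeasure (distr M borel (lin F b)) B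
      = emeasure (distr M (borel \<Otimes>\<^sub>M borel) (\<lambda>x. (lin F a x, lin F b x))) (A \<times> B)"
      using prob_lin_indep[OF F orth AB]
      by (simp add: emeasure_distr emeasure_eq_measure ennreal_mult')
  qed (auto intro: A.sigma_finite_measure_axioms B.sigma_finite_measure_axioms)
qed

end

section \<open>Tail and window estimates for normal laws\<close>

lemma nn_integral_normal_density_eq_1:
  "\<sigma> > 0 \<Longrightarrow> (\<integral>\<^sup>+u. ennreal (normal_density \<mu> \<sigma> u) \<partial>lborel) = 1"
  using prob_space.emeasure_space_1[OF prob_space_normal_density[of \<sigma> \<mu>]]
  by (simp add: emeasure_density)

text \<open>For u \<ge> z \<ge> 0 one has u^2 \<ge> z^2 + (u - z)^2, so the density is dominated by
  the exponential factor times the normal density centred at z, of total mass 1.\<close>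

lemma nn_integral_normal_tail_le:
  assumes z: "z \<ge> (0::real)" and s: "\<sigma> > 0"
  shows "(\<integral>\<^sup>+u. ennreal (normal_density 0 \<sigma> u) * indicator {z..} u \<partial>lborel) \<le> ennreal (exp (- z\<^sup>2 / (2 * \<sigma>\<^sup>2)))"
proof -
  have "(\<integral>\<^sup>+u. ennreal (normal_density 0 \<sigma> u) * indicator {z..} u \<partial>lborel)
     \<le> (\<integral>\<^sup>+u. ennreal (exp (- z\<^sup>2 / (2 * \<sigma>\<^sup>2))) * ennreal (normal_density z \<sigma> u) \<partial>lborel)"
  proof (intro nn_integral_mono)
    fix u :: real
    show "ennreal (normal_density 0 \<sigma> u) * indicator {z..} u \<le> ennreal (exp (- z\<^sup>2 / (2 * \<sigma>\<^sup>2))) * ennreal (normal_density z \<sigma> u)"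
    proof (cases "u \<ge> z")
      case True
      have "u\<^sup>2 \<ge> z\<^sup>2 + (u - z)\<^sup>2"
      proof -
        have "0 \<le> 2 * z * (u - z)" using z True by simp
        thus ?thesis by (simp add: power2_eq_square algebra_simps)
      qed
      hence "exp (- u\<^sup>2 / (2 * \<sigma>\<^sup>2)) \<le> exp (- z\<^sup>2 / (2 * \<sigma>\<^sup>2) + - (u - z)\<^sup>2 / (2 * \<sigma>\<^sup>2))"
        using s by (simp only: exp_le_cancel_iff add_divide_distrib[symmetric]) (intro divide_right_mono, auto)
      hence "normal_density 0 \<sigma> u \<le> exp (- z\<^sup>2 / (2 * \<sigma>\<^sup>2)) * normal_density z \<sigma> u"
        using s unfolding normal_density_def exp_add by (simp add: divide_right_mono)
      thus ?thesis using True by (simp add: ennreal_mult[symmetric])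
    qed simp
  qed
  also have "\<dots> = ennreal (exp (- z\<^sup>2 / (2 * \<sigma>\<^sup>2)))"
    using nn_integral_normal_density_eq_1[OF s, of z] by (simp add: nn_integral_cmult)
  finally show ?thesis .
qed

text \<open>Inserting u / z \<ge> 1 turns the integrand into an exact derivative. The extra factor 1
  / z over the exponential bound produces the power of n that decides the constant in the upper
  bound.\<close>

lemma nn_integral_normal_mills_le:
  assumes z: "z > (0::real)" and s: "\<sigma> > 0"
  shows "(\<integral>\<^sup>+u. ennreal (normal_density 0 \<sigma> u) * indicator {z..} u \<partial>lborel) \<le> ennreal (\<sigma>\<^sup>2 / z * normal_density 0 \<sigma> z)"
proof -
  define F where "F = (\<lambda>u. - (\<sigma>\<^sup>2 / z * normal_density 0 \<sigma> u))"
  have "(\<integral>\<^sup>+u. ennreal (normal_density 0 \<sigma> u) * indicator {z..} u \<partial>lborel)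
     \<le> (\<integral>\<^sup>+u. ennreal (u / z * normal_density 0 \<sigma> u) * indicator {z..} u \<partial>lborel)"
  proof (intro nn_integral_mono)
    fix u :: real
    have "1 * normal_density 0 \<sigma> u \<le> u / z * normal_density 0 \<sigma> u" if "u \<ge> z"
      using that z by (intro mult_right_mono) (auto simp: le_divide_eq)
    thus "ennreal (normal_density 0 \<sigma> u) * indicator {z..} u \<le> ennreal (u / z * normal_density 0 \<sigma> u) * indicator {z..} u"
      by (auto split: split_indicator intro!: ennreal_leI)
  qed
  also have "\<dots> = ennreal (0 - F z)"
  proof (rule nn_integral_FTC_atLeast)
    fix u assume "u \<ge> z"
    have d: "(normal_density 0 \<sigma> has_real_derivative (- u / \<sigma>\<^sup>2 * normal_density 0 \<sigma> u)) (at u)"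
      unfolding normal_density_def[abs_def] using s
      by (auto intro!: derivative_eq_intros simp: power2_eq_square field_simps)
    have "(F has_real_derivative (- (\<sigma>\<^sup>2 / z * (- u / \<sigma>\<^sup>2 * normal_density 0 \<sigma> u)))) (at u)"
      unfolding F_def by (intro DERIV_minus DERIV_cmult d)
    thus "(F has_real_derivative (u / z * normal_density 0 \<sigma> u)) (at u)"
      using s z by (simp add: field_simps)
    show "0 \<le> u / z * normal_density 0 \<sigma> u" using \<open>u \<ge> z\<close> z by simp
  next
    have "((\<lambda>u. - (\<sigma>\<^sup>2 / z * (1 / sqrt (2 * pi * \<sigma>\<^sup>2) * exp (- (u - 0)\<^sup>2 / (2 * \<sigma>\<^sup>2))))) \<longlongrightarrow> - (\<sigma>\<^sup>2 / z * (1 / sqrt (2 * pi * \<sigma>\<^sup>2) * 0))) at_top"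
    proof (intro tendsto_intros filterlim_compose[OF exp_at_bot])
      have "filterlim (\<lambda>u::real. (u * u) * (1 / (2 * \<sigma>\<^sup>2))) at_top at_top"
        using s by (intro filterlim_at_top_mult_tendsto_pos[OF tendsto_const] filterlim_at_top_mult_at_top filterlim_ident) auto
      hence "filterlim (\<lambda>u::real. - ((u * u) * (1 / (2 * \<sigma>\<^sup>2)))) at_bot at_top"
        by (simp add: filterlim_uminus_at_top)
      thus "filterlim (\<lambda>u. - (u - 0)\<^sup>2 / (2 * \<sigma>\<^sup>2)) at_bot at_top"
        by (simp add: power2_eq_square)
    qed
    thus "(F \<longlongrightarrow> 0) at_top" by (simp add: F_def[abs_def] normal_density_def)
  qed simp
  finally show ?thesis by (simp add: F_def)
qed

lemma normal_density_antimono: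
  assumes "0 \<le> x" "x \<le> y" "\<sigma> > 0"
  shows "normal_density 0 \<sigma> y \<le> normal_density 0 \<sigma> x"
proof -
  have "x\<^sup>2 \<le> y\<^sup>2" using assms by (intro power_mono) auto
  hence "exp (- (y - 0)\<^sup>2 / (2 * \<sigma>\<^sup>2)) \<le> exp (- (x - 0)\<^sup>2 / (2 * \<sigma>\<^sup>2))"
    using assms by (simp only: exp_le_cancel_iff) (intro divide_right_mono, auto)
  thus ?thesis unfolding normal_density_def by (intro mult_left_mono) auto
qed

context gaussian_family
begin

lemma lin_eq_0_if_nsq_0:
  assumes "nsq F a = 0"
  shows "lin F a \<omega> = 0"
proof (cases "finite F")
  case True
  hence "\<forall>i\<in>F. (norm (a i))\<^sup>2 = 0"
    using assms unfolding nsq_def by (subst (asm) sum_nonneg_eq_0_iff) auto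
  thus ?thesis by (simp add: lin_def)
qed (simp add: lin_def)

lemma emeasure_lin:
  assumes F: "F \<subseteq> I" and pos: "nsq F a > 0" and A: "A \<in> sets borel"
  shows "emeasure M {\<omega>\<in>space M. lin F a \<omega> \<in> A}
       = (\<integral>\<^sup>+u. ennreal (normal_density 0 (sqrt (nsq F a / 2)) u) * indicator A u \<partial>lborel)"
proof -
  have "{\<omega>\<in>space M. lin F a \<omega> \<in> A} = lin F a -` A \<inter> space M" by auto
  thus ?thesis using distributed_emeasure[OF lin_normal[OF F pos]] A by simp
qed

lemma prob_lin_chernoff:
  assumes F: "F \<subseteq> I" and w: "nsq F a \<le> w" "w > 0" and z: "z \<ge> 0"
  shows "prob {\<omega>\<in>space M. lin F a \<omega> \<ge> z} \<le> exp (- z\<^sup>2 / w)"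
proof (cases "nsq F a = 0")
  case True
  show ?thesis
  proof (cases "z = 0")
    case True thus ?thesis by simp
  next
    case False
    hence e: "{\<omega>\<in>space M. lin F a \<omega> \<ge> z} = {}" using z lin_eq_0_if_nsq_0[OF True] by auto
    show ?thesis unfolding e by simp
  qed
next
  case False
  hence pos: "nsq F a > 0" using nsq_nonneg[of F a] by simp
  have "ennreal (prob {\<omega>\<in>space M. lin F a \<omega> \<ge> z}) = emeasure M {\<omega>\<in>space M. lin F a \<omega> \<in> {z..}}"
    by (simp add: emeasure_eq_measure)
  also have "\<dots> \<le> ennreal (exp (- z\<^sup>2 / (2 * (sqrt (nsq F a / 2))\<^sup>2)))"
    using pos z nn_integral_normal_tail_le[of z "sqrt (nsq F a / 2)"] by (subst emeasure_lin[OF F pos]) simp_all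
  also have "\<dots> = ennreal (exp (- z\<^sup>2 / nsq F a))" using pos by simp
  also have "\<dots> \<le> ennreal (exp (- z\<^sup>2 / w))"
  proof (intro ennreal_leI)
    have "z\<^sup>2 / w \<le> z\<^sup>2 / nsq F a" using w pos by (intro divide_left_mono) auto
    thus "exp (- z\<^sup>2 / nsq F a) \<le> exp (- z\<^sup>2 / w)" by simp
  qed
  finally show ?thesis by (simp add: ennreal_le_iff)
qed

lemma prob_lin_mills:
  assumes F: "F \<subseteq> I" and v: "nsq F a = 2 * v" "v > 0" and z: "z > 0"
  shows "prob {\<omega>\<in>space M. lin F a \<omega> \<ge> z} \<le> v / z * (exp (- z\<^sup>2 / (2 * v)) / sqrt (2 * pi * v))"
proof -
  have pos: "nsq F a > 0" using v by simp
  have "ennreal (prob {\<omega>\<in>space M. lin F a \<omega> \<ge> z}) = emeasure M {\<omega>\<in>space M. lin F a \<omega> \<in> {z..}}"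
    by (simp add: emeasure_eq_measure)
  also have "\<dots> \<le> ennreal ((sqrt v)\<^sup>2 / z * normal_density 0 (sqrt v) z)"
    using z v nn_integral_normal_mills_le[of z "sqrt v"] by (subst emeasure_lin[OF F pos]) simp_all
  also have "(sqrt v)\<^sup>2 / z * normal_density 0 (sqrt v) z = v / z * (exp (- z\<^sup>2 / (2 * v)) / sqrt (2 * pi * v))"
    using v by (simp add: normal_density_def)
  finally show ?thesis using z v by (subst (asm) ennreal_le_iff) auto
qed

text \<open>The density on the window is smallest at its right end. When x / v stays bounded,
  evaluating at x + 1 in place of x loses only a bounded factor.\<close>

lemma prob_lin_window_ge:
  assumes F: "F \<subseteq> I" and v: "nsq F a = 2 * v" "v > 0" and x: "x \<ge> 0"
  shows "prob {\<omega>\<in>space M. lin F a \<omega> \<in> {x..x + 1}} \<ge> exp (- (x + 1)\<^sup>2 / (2 * v)) / sqrt (2 * pi * v)"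
proof -
  have pos: "nsq F a > 0" using v by simp
  have "ennreal (normal_density 0 (sqrt v) (x + 1)) = (\<integral>\<^sup>+u. ennreal (normal_density 0 (sqrt v) (x + 1)) * indicator {x..x+1} u \<partial>lborel)"
    by (subst nn_integral_cmult_indicator) auto
  also have "\<dots> \<le> (\<integral>\<^sup>+u. ennreal (normal_density 0 (sqrt v) u) * indicator {x..x+1} u \<partial>lborel)"
    using x v by (intro nn_integral_mono) (auto split: split_indicator intro!: ennreal_leI normal_density_antimono)
  also have "\<dots> = emeasure M {\<omega>\<in>space M. lin F a \<omega> \<in> {x..x+1}}"
    using v by (subst emeasure_lin[OF F pos]) auto
  also have "\<dots> = ennreal (prob {\<omega>\<in>space M. lin F a \<omega> \<in> {x..x+1}})" by (simp add: emeasure_eq_measure)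
  finally have "normal_density 0 (sqrt v) (x + 1) \<le> prob {\<omega>\<in>space M. lin F a \<omega> \<in> {x..x+1}}"
    by (subst (asm) ennreal_le_iff) auto
  thus ?thesis using v by (simp add: normal_density_def)
qed

lemma lin_diff: "lin F (\<lambda>i. b i - of_real \<beta> * a i) \<omega> = lin F b \<omega> - \<beta> * lin F a \<omega>"
  using lin_comb[of F 1 b "- \<beta>" a \<omega>] by simp

lemma nsq_diff: "nsq F (\<lambda>i. b i - of_real \<beta> * a i) = nsq F b + \<beta>\<^sup>2 * nsq F a - 2 * \<beta> * inn F a b"
proof -
  have "inn F b a = inn F a b"
    unfolding inn_def by (intro sum.cong refl) (simp add: algebra_simps)
  thus ?thesis using nsq_comb[of F 1 b "- \<beta>" a] by simp
qed

lemma inn_diff: "inn F a (\<lambda>i. b i - of_real \<beta> * a i) = inn F a b - \<beta> * nsq F a"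
proof -
  have "Re (a i * cnj (b i - of_real \<beta> * a i)) = Re (a i * cnj (b i)) - \<beta> * (norm (a i))\<^sup>2" for i
    unfolding cmod_power2 by (simp add: power2_eq_square algebra_simps)
  thus ?thesis by (simp only: inn_def nsq_def sum_subtractf sum_distrib_left)
qed

text \<open>Only the component of \<open>d\<close> orthogonal to \<open>a\<close> is random once \<open>lin F a\<close> is confined to a
  window; the parallel component is absorbed by \<open>c\<close>.\<close>
lemma prob_lin_window_and_tail_le:
  assumes F: "F \<subseteq> I" and v: "nsq F a = 2 * v" "v > 0"
    and k: "inn F a d = 2 * \<kappa>" and c: "\<And>u. u \<in> {x..x+1} \<Longrightarrow> \<kappa> / v * u \<le> c"
    and w: "nsq F d \<le> w" "w > 0" and y: "y - c \<ge> 0"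
  shows "prob {\<omega>\<in>space M. lin F a \<omega> \<in> {x..x+1} \<and> lin F d \<omega> \<ge> y}
         \<le> prob {\<omega>\<in>space M. lin F a \<omega> \<in> {x..x+1}} * exp (- (y - c)\<^sup>2 / w)"
proof -
  define b where "b = (\<lambda>i. d i - of_real (\<kappa> / v) * a i)"
  have [measurable]: "lin F a \<in> borel_measurable M" for a by (rule lin_measurable[OF F])
  have orth: "inn F a b = 0" unfolding b_def inn_diff k v(1) using v by simp
  have "nsq F b = nsq F d - 2 * \<kappa>\<^sup>2 / v"
    unfolding b_def nsq_diff k v(1) using v by (simp add: power2_eq_square field_simps)
  hence "nsq F b \<le> w" using w v by (smt (verit) divide_nonneg_pos zero_le_power2)
  have "prob {\<omega>\<in>space M. lin F a \<omega> \<in> {x..x+1} \<and> lin F d \<omega> \<ge> y}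
     \<le> prob {\<omega>\<in>space M. lin F a \<omega> \<in> {x..x+1} \<and> lin F b \<omega> \<in> {y - c..}}"
  proof (intro finite_measure_mono)
    show "{\<omega>\<in>space M. lin F a \<omega> \<in> {x..x+1} \<and> lin F d \<omega> \<ge> y} \<subseteq> {\<omega>\<in>space M. lin F a \<omega> \<in> {x..x+1} \<and> lin F b \<omega> \<in> {y - c..}}"
    proof
      fix \<omega> assume \<omega>: "\<omega> \<in> {\<omega>\<in>space M. lin F a \<omega> \<in> {x..x+1} \<and> lin F d \<omega> \<ge> y}"
      have "lin F b \<omega> = lin F d \<omega> - \<kappa> / v * lin F a \<omega>" unfolding b_def lin_diff ..
      with \<omega> show "\<omega> \<in> {\<omega>\<in>space M. lin F a \<omega> \<in> {x..x+1} \<and> lin F b \<omega> \<in> {y - c..}}"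
        using c[of "lin F a \<omega>"] by simp
    qed
  qed measurable
  also have "\<dots> = prob {\<omega>\<in>space M. lin F a \<omega> \<in> {x..x+1}} * prob {\<omega>\<in>space M. lin F b \<omega> \<in> {y - c..}}"
    by (rule prob_lin_indep[OF F orth]) auto
  also have "prob {\<omega>\<in>space M. lin F b \<omega> \<in> {y - c..}} \<le> exp (- (y - c)\<^sup>2 / w)"
    using prob_lin_chernoff[OF F \<open>nsq F b \<le> w\<close> w(2) y] by simp
  finally show ?thesis by (simp add: mult_left_mono)
qed

text \<open>The left side is the conditional density of the second of two correlated normals given
  that the first equals u. For nonnegative values a negative correlation does not help both to be
  large, hence \<open>max 0 \<rho>\<close> in the exponent.\<close>

lemma gaussian_density_ratio_le:
  fixes u u' \<rho> v X :: real
  assumes v: "v > 0" and r: "\<bar>\<rho>\<bar> < 1" and u: "0 \<le> u" "u \<le> X" "0 \<le> u'" "u' \<le> X"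
  shows "normal_density 0 (sqrt (v * (1 - \<rho>\<^sup>2))) (u' - \<rho> * u)
       \<le> exp (max 0 \<rho> * X\<^sup>2 / v) / sqrt (1 - \<rho>\<^sup>2) * normal_density 0 (sqrt v) u'"
proof -
  have r2: "1 - \<rho>\<^sup>2 > 0" using r by (simp add: abs_square_less_1)
  have key: "- (u' - \<rho> * u)\<^sup>2 / (2 * (v * (1 - \<rho>\<^sup>2))) \<le> max 0 \<rho> * X\<^sup>2 / v + - u'\<^sup>2 / (2 * v)"
  proof -
    have eq: "- (u' - \<rho> * u)\<^sup>2 = - u'\<^sup>2 * (1 - \<rho>\<^sup>2) + (2 * \<rho> * u * u' - \<rho>\<^sup>2 * (u\<^sup>2 + u'\<^sup>2))"
      by (simp add: power2_eq_square algebra_simps)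
    have "2 * \<rho> * u * u' - \<rho>\<^sup>2 * (u\<^sup>2 + u'\<^sup>2) \<le> 2 * max 0 \<rho> * X\<^sup>2 * (1 - \<rho>\<^sup>2)"
    proof (cases "\<rho> \<ge> 0")
      case True
      have "0 \<le> (u - u')\<^sup>2" by simp
      hence "2 * (u * u') \<le> u\<^sup>2 + u'\<^sup>2" by (simp add: power2_eq_square algebra_simps)
      hence "\<rho>\<^sup>2 * (2 * (u * u')) \<le> \<rho>\<^sup>2 * (u\<^sup>2 + u'\<^sup>2)" by (intro mult_left_mono) auto
      hence "2 * \<rho> * u * u' - \<rho>\<^sup>2 * (u\<^sup>2 + u'\<^sup>2) \<le> 2 * \<rho> * (1 - \<rho>) * (u * u')"
        by (simp add: power2_eq_square algebra_simps)
      also have "\<dots> \<le> 2 * \<rho> * (1 - \<rho>) * X\<^sup>2"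
        using True r u unfolding power2_eq_square by (intro mult_left_mono mult_mono) auto
      \<comment> \<open>The factor 1 + \<rho> \<ge> 1 is inserted only to complete 1 - \<rho>^2,
        which cancels against the conditional variance.\<close>
      also have "\<dots> \<le> 2 * \<rho> * (1 - \<rho>) * X\<^sup>2 * (1 + \<rho>)"
        using True r mult_left_mono[of 1 "1 + \<rho>" "2 * \<rho> * (1 - \<rho>) * X\<^sup>2"] by simp
      finally show ?thesis using True by (simp add: power2_eq_square algebra_simps)
    next
      case False
      hence "\<rho> * (u * u') \<le> 0" using u by (simp add: mult_nonpos_nonneg)
      moreover have "0 \<le> \<rho>\<^sup>2 * (u\<^sup>2 + u'\<^sup>2)" by simp
      moreover have "2 * \<rho> * u * u' = 2 * (\<rho> * (u * u'))" by simp
      ultimately have "2 * \<rho> * u * u' - \<rho>\<^sup>2 * (u\<^sup>2 + u'\<^sup>2) \<le> 0" by linarith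
      thus ?thesis using False by simp
    qed
    hence "- (u' - \<rho> * u)\<^sup>2 \<le> - u'\<^sup>2 * (1 - \<rho>\<^sup>2) + 2 * max 0 \<rho> * X\<^sup>2 * (1 - \<rho>\<^sup>2)"
      unfolding eq by simp
    hence "- (u' - \<rho> * u)\<^sup>2 / (2 * (v * (1 - \<rho>\<^sup>2))) \<le> (- u'\<^sup>2 * (1 - \<rho>\<^sup>2) + 2 * max 0 \<rho> * X\<^sup>2 * (1 - \<rho>\<^sup>2)) / (2 * (v * (1 - \<rho>\<^sup>2)))"
      using r2 v by (intro divide_right_mono) auto
    also have "\<dots> = max 0 \<rho> * X\<^sup>2 / v + - u'\<^sup>2 / (2 * v)"
      using r2 v by (simp add: field_simps del: right_diff_distrib' left_diff_distrib')
    finally show ?thesis .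
  qed
  have "normal_density 0 (sqrt (v * (1 - \<rho>\<^sup>2))) (u' - \<rho> * u)
     = 1 / sqrt (2 * pi * v) / sqrt (1 - \<rho>\<^sup>2) * exp (- (u' - \<rho> * u)\<^sup>2 / (2 * (v * (1 - \<rho>\<^sup>2))))"
  proof -
    have "(sqrt (v * (1 - \<rho>\<^sup>2)))\<^sup>2 = v * (1 - \<rho>\<^sup>2)" using r2 v by simp
    moreover have "sqrt (2 * pi * (v * (1 - \<rho>\<^sup>2))) = sqrt (2 * pi * v) * sqrt (1 - \<rho>\<^sup>2)"
      by (simp add: real_sqrt_mult)
    ultimately show ?thesis unfolding normal_density_def by simp
  qed
  also have "\<dots> \<le> 1 / sqrt (2 * pi * v) / sqrt (1 - \<rho>\<^sup>2) * exp (max 0 \<rho> * X\<^sup>2 / v + - u'\<^sup>2 / (2 * v))"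
    using key r2 v by (intro mult_left_mono) auto
  also have "\<dots> = exp (max 0 \<rho> * X\<^sup>2 / v) / sqrt (1 - \<rho>\<^sup>2) * normal_density 0 (sqrt v) u'"
    using v unfolding exp_add by (simp add: normal_density_def)
  finally show ?thesis .
qed

text \<open>The form \<open>lin F b\<close> is \<rho> \<open>lin F a\<close> plus an independent
  form \<open>lin F d\<close>. Shifting the second variable by \<rho> u turns the joint density into
  the conditional one, which \<open>gaussian_density_ratio_le\<close> compares with the product
  density.\<close>

lemma prob_lin_window_window_le:
  assumes F: "F \<subseteq> I" and v: "nsq F a = 2 * v" "nsq F b = 2 * v" "v > 0"
    and r: "inn F a b = 2 * v * \<rho>" "\<bar>\<rho>\<bar> < 1" and x: "x \<ge> 0"
  shows "prob {\<omega>\<in>space M. lin F a \<omega> \<in> {x..x+1} \<and> lin F b \<omega> \<in> {x..x+1}}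
       \<le> exp (max 0 \<rho> * (x + 1)\<^sup>2 / v) / sqrt (1 - \<rho>\<^sup>2)
          * prob {\<omega>\<in>space M. lin F a \<omega> \<in> {x..x+1}} * prob {\<omega>\<in>space M. lin F b \<omega> \<in> {x..x+1}}"
proof -
  define K where "K = exp (max 0 \<rho> * (x + 1)\<^sup>2 / v) / sqrt (1 - \<rho>\<^sup>2)"
  have r2: "1 - \<rho>\<^sup>2 > 0" using r by (simp add: abs_square_less_1)
  have K0: "K \<ge> 0" using r2 by (simp add: K_def)
  define d where "d = (\<lambda>i. b i - of_real \<rho> * a i)"
  have orth: "inn F a d = 0" unfolding d_def inn_diff r v by simp
  have nd: "nsq F d / 2 = v * (1 - \<rho>\<^sup>2)"
    unfolding d_def nsq_diff r v by (simp add: power2_eq_square field_simps)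
  hence pd: "nsq F d > 0" using v r2 by (smt (verit) half_gt_zero_iff mult_pos_pos)
  have pa: "nsq F a > 0" and pb: "nsq F b > 0" using v by auto
  have ld: "lin F b \<omega> = lin F d \<omega> + \<rho> * lin F a \<omega>" for \<omega> unfolding d_def lin_diff by simp
  let ?\<phi> = "normal_density 0 (sqrt v)" and ?\<psi> = "normal_density 0 (sqrt (v * (1 - \<rho>\<^sup>2)))"
  let ?J = "{x..x+1} :: real set"
  have D: "distributed M (lborel \<Otimes>\<^sub>M lborel) (\<lambda>\<omega>. (lin F a \<omega>, lin F d \<omega>)) (\<lambda>(p, q). ennreal (?\<phi> p) * ennreal (?\<psi> q))"
  proof (rule distributed_joint_indep)
    show "distributed M lborel (lin F a) ?\<phi>" using lin_normal[OF F pa] v by simp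
    show "distributed M lborel (lin F d) ?\<psi>" using lin_normal[OF F pd] nd by simp
    have "indep_var borel (lin F a) borel (lin F d)" by (rule indep_lin[OF F orth])
    thus "indep_var lborel (lin F a) lborel (lin F d)"
      by (simp add: indep_var_eq measurable_lborel1)
  qed (auto intro: lborel.sigma_finite_measure_axioms)
  let ?S = "{p. fst p \<in> ?J \<and> snd p + \<rho> * fst p \<in> ?J} :: (real \<times> real) set"
  have S [measurable]: "?S \<in> sets (lborel \<Otimes>\<^sub>M lborel)"
  proof -
    have "{p \<in> space (borel \<Otimes>\<^sub>M borel :: (real \<times> real) measure). x \<le> fst p \<and> fst p \<le> x + 1 \<and> x \<le> snd p + \<rho> * fst p \<and> snd p + \<rho> * fst p \<le> x + 1}
        \<in> sets (borel \<Otimes>\<^sub>M borel)"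
      by measurable
    also have "{p \<in> space (borel \<Otimes>\<^sub>M borel :: (real \<times> real) measure). x \<le> fst p \<and> fst p \<le> x + 1 \<and> x \<le> snd p + \<rho> * fst p \<and> snd p + \<rho> * fst p \<le> x + 1} = ?S"
      by (auto simp: space_pair_measure)
    finally show ?thesis by simp
  qed
  have "emeasure M {\<omega>\<in>space M. lin F a \<omega> \<in> ?J \<and> lin F b \<omega> \<in> ?J}
     = emeasure M ((\<lambda>\<omega>. (lin F a \<omega>, lin F d \<omega>)) -` ?S \<inter> space M)"
    by (intro arg_cong2[where f = emeasure]) (auto simp: ld)
  also have "\<dots> = (\<integral>\<^sup>+p. (case p of (p, q) \<Rightarrow> ennreal (?\<phi> p) * ennreal (?\<psi> q)) * indicator ?S p \<partial>(lborel \<Otimes>\<^sub>M lborel))"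
    by (rule distributed_emeasure[OF D S])
  also have "\<dots> = (\<integral>\<^sup>+u. \<integral>\<^sup>+q. ennreal (?\<phi> u) * ennreal (?\<psi> q) * indicator ?S (u, q) \<partial>lborel \<partial>lborel)"
    by (subst lborel.nn_integral_fst[symmetric]) auto
  also have "\<dots> = (\<integral>\<^sup>+u. \<integral>\<^sup>+u'. ennreal (?\<phi> u) * ennreal (?\<psi> (u' - \<rho> * u)) * (indicator ?J u * indicator ?J u') \<partial>lborel \<partial>lborel)"
  proof (rule nn_integral_cong)
    fix u :: real
    have "(\<integral>\<^sup>+q. ennreal (?\<phi> u) * ennreal (?\<psi> q) * indicator ?S (u, q) \<partial>lborel)
       = (\<integral>\<^sup>+q. ennreal (?\<phi> u) * ennreal (?\<psi> (- \<rho> * u + 1 * q)) * indicator ?S (u, - \<rho> * u + 1 * q) \<partial>lborel)"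
      by (subst nn_integral_real_affine[where c = 1 and t = "- \<rho> * u"]) auto
    also have "\<dots> = (\<integral>\<^sup>+u'. ennreal (?\<phi> u) * ennreal (?\<psi> (u' - \<rho> * u)) * (indicator ?J u * indicator ?J u') \<partial>lborel)"
      by (intro nn_integral_cong) (auto split: split_indicator)
    finally show "(\<integral>\<^sup>+q. ennreal (?\<phi> u) * ennreal (?\<psi> q) * indicator ?S (u, q) \<partial>lborel) = \<dots>" .
  qed
  also have "\<dots> \<le> (\<integral>\<^sup>+u. \<integral>\<^sup>+u'. (ennreal K * (ennreal (?\<phi> u) * indicator ?J u)) * (ennreal (?\<phi> u') * indicator ?J u') \<partial>lborel \<partial>lborel)"
  proof (intro nn_integral_mono)
    fix u u' :: real
    show "ennreal (?\<phi> u) * ennreal (?\<psi> (u' - \<rho> * u)) * (indicator ?J u * indicator ?J u')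
      \<le> (ennreal K * (ennreal (?\<phi> u) * indicator ?J u)) * (ennreal (?\<phi> u') * indicator ?J u')"
    proof (cases "u \<in> ?J \<and> u' \<in> ?J")
      case True
      have "?\<psi> (u' - \<rho> * u) \<le> K * ?\<phi> u'"
        unfolding K_def using True x by (intro gaussian_density_ratio_le v r) auto
      hence "?\<phi> u * ?\<psi> (u' - \<rho> * u) \<le> ?\<phi> u * (K * ?\<phi> u')"
        by (intro mult_left_mono) auto
      hence "ennreal (?\<phi> u * ?\<psi> (u' - \<rho> * u)) \<le> ennreal (K * ?\<phi> u * ?\<phi> u')"
        by (intro ennreal_leI) (simp add: algebra_simps)
      thus ?thesis using True K0 by (simp add: ennreal_mult)
    qed (auto split: split_indicator)
  qed
  also have "\<dots> = ennreal K * emeasure M {\<omega>\<in>space M. lin F a \<omega> \<in> ?J} * emeasure M {\<omega>\<in>space M. lin F b \<omega> \<in> ?J}"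
    using emeasure_lin[OF F pa, of ?J] emeasure_lin[OF F pb, of ?J] v
    by (simp add: nn_integral_cmult nn_integral_multc)
  finally have "ennreal (prob {\<omega>\<in>space M. lin F a \<omega> \<in> ?J \<and> lin F b \<omega> \<in> ?J})
     \<le> ennreal (K * prob {\<omega>\<in>space M. lin F a \<omega> \<in> ?J} * prob {\<omega>\<in>space M. lin F b \<omega> \<in> ?J})"
    using K0 by (simp add: emeasure_eq_measure ennreal_mult)
  with K0 show ?thesis unfolding K_def[symmetric] by (subst (asm) ennreal_le_iff) auto
qed

text \<open>Independence splits the expectation. With s^2 = \<open>nsq F b\<close> the second moment
  is s^2 / 2, and |y| \<le> (s + y^2 / s) / 2 bounds the first absolute moment by s.\<close>

lemma nn_integral_abs_lin_on_event_le:
  assumes F: "F \<subseteq> I" and orth: "inn F a b = 0" and A: "A \<in> sets borel" and pb: "nsq F b > 0"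
  shows "(\<integral>\<^sup>+\<omega>. ennreal (indicator A (lin F a \<omega>) * \<bar>lin F b \<omega>\<bar>) \<partial>M)
           \<le> ennreal (prob {\<omega>\<in>space M. lin F a \<omega> \<in> A} * sqrt (nsq F b))"
proof -
  have [measurable]: "lin F a \<in> borel_measurable M" for a by (rule lin_measurable[OF F])
  note [measurable] = A
  have D: "distributed M lborel (lin F b) (normal_density 0 (sqrt (nsq F b / 2)))"
    by (rule lin_normal[OF F pb])
  have ex0: "expectation (lin F b) = 0" using normal_distributed_expectation[OF _ D] pb by simp
  have ex2: "expectation (\<lambda>\<omega>. (lin F b \<omega>)\<^sup>2) = nsq F b / 2"
    using normal_distributed_variance[OF _ D] pb ex0 by simp
  have i2: "integrable M (\<lambda>\<omega>. (lin F b \<omega>)\<^sup>2)"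
    using ex2 pb not_integrable_integral_eq by fastforce
  have i1: "integrable M (\<lambda>\<omega>. \<bar>lin F b \<omega>\<bar>)"
  proof (rule Bochner_Integration.integrable_bound[of _ "\<lambda>\<omega>. 1 + (lin F b \<omega>)\<^sup>2"])
    show "AE \<omega> in M. norm \<bar>lin F b \<omega>\<bar> \<le> norm (1 + (lin F b \<omega>)\<^sup>2)"
    proof (rule AE_I2)
      fix \<omega>
      have "0 \<le> (\<bar>lin F b \<omega>\<bar> - 1 / 2)\<^sup>2" by simp
      hence "\<bar>lin F b \<omega>\<bar> \<le> 1 + (lin F b \<omega>)\<^sup>2" by (simp add: power2_eq_square algebra_simps)
      thus "norm \<bar>lin F b \<omega>\<bar> \<le> norm (1 + (lin F b \<omega>)\<^sup>2)" by simp
    qed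
  qed (use i2 in auto)
  have e1: "expectation (\<lambda>\<omega>. \<bar>lin F b \<omega>\<bar>) \<le> sqrt (nsq F b)"
  proof -
    define s where "s = sqrt (nsq F b)"
    have s: "s > 0" "s\<^sup>2 = nsq F b" using pb by (auto simp: s_def)
    have "expectation (\<lambda>\<omega>. \<bar>lin F b \<omega>\<bar>) \<le> expectation (\<lambda>\<omega>. (s + (lin F b \<omega>)\<^sup>2 / s) / 2)"
    proof (intro integral_mono i1)
      show "\<bar>lin F b \<omega>\<bar> \<le> (s + (lin F b \<omega>)\<^sup>2 / s) / 2" for \<omega>
      proof -
        have "0 \<le> (s - \<bar>lin F b \<omega>\<bar>)\<^sup>2" by simp
        hence "2 * s * \<bar>lin F b \<omega>\<bar> \<le> s\<^sup>2 + (lin F b \<omega>)\<^sup>2" by (simp add: power2_eq_square algebra_simps)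
        thus ?thesis using s by (simp add: field_simps power2_eq_square)
      qed
    qed (use i2 in auto)
    also have "\<dots> = (s + (nsq F b / 2) / s) / 2" using i2 ex2 by (simp add: prob_space)
    also have "(nsq F b / 2) / s = s / 2" using s by (simp add: s(2)[symmetric] power2_eq_square)
    also have "(s + s / 2) / 2 \<le> s" using s(1) by (simp add: field_simps)
    finally have "expectation (\<lambda>\<omega>. \<bar>lin F b \<omega>\<bar>) \<le> s" .
    thus ?thesis unfolding s_def .
  qed
  have iA: "integrable M (\<lambda>\<omega>. indicat_real A (lin F a \<omega>))"
    by (intro integrable_const_bound[of _ 1] AE_I2) (auto split: split_indicator)
  have ind: "indep_var borel (\<lambda>\<omega>. indicat_real A (lin F a \<omega>)) borel (\<lambda>\<omega>. \<bar>lin F b \<omega>\<bar>)"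
    using indep_var_compose[OF indep_lin[OF F orth], of "indicat_real A" borel "\<lambda>x. \<bar>x\<bar>" borel]
    by (simp add: o_def)
  have "(\<integral>\<^sup>+\<omega>. ennreal (indicat_real A (lin F a \<omega>) * \<bar>lin F b \<omega>\<bar>) \<partial>M)
      = ennreal (expectation (\<lambda>\<omega>. indicat_real A (lin F a \<omega>) * \<bar>lin F b \<omega>\<bar>))"
    by (intro nn_integral_eq_integral indep_var_integrable[OF ind iA i1] AE_I2) auto
  also have "expectation (\<lambda>\<omega>. indicat_real A (lin F a \<omega>) * \<bar>lin F b \<omega>\<bar>)
      = expectation (\<lambda>\<omega>. indicat_real A (lin F a \<omega>)) * expectation (\<lambda>\<omega>. \<bar>lin F b \<omega>\<bar>)"
    by (rule indep_var_lebesgue_integral[OF ind iA i1])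
  also have "expectation (\<lambda>\<omega>. indicat_real A (lin F a \<omega>)) = prob {\<omega>\<in>space M. lin F a \<omega> \<in> A}"
  proof -
    have "expectation (\<lambda>\<omega>. indicat_real A (lin F a \<omega>)) = expectation (\<lambda>\<omega>. indicat_real {\<omega>\<in>space M. lin F a \<omega> \<in> A} \<omega>)"
      by (intro Bochner_Integration.integral_cong) (auto split: split_indicator)
    thus ?thesis by simp
  qed
  finally have eq: "(\<integral>\<^sup>+\<omega>. ennreal (indicat_real A (lin F a \<omega>) * \<bar>lin F b \<omega>\<bar>) \<partial>M)
    = ennreal (prob {\<omega>\<in>space M. lin F a \<omega> \<in> A} * expectation (\<lambda>\<omega>. \<bar>lin F b \<omega>\<bar>))" .
  show ?thesis unfolding eq by (intro ennreal_leI mult_left_mono e1) simp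
qed

end

subsection \<open>The second moment method\<close>

text \<open>Let X be the \<open>N\<close>-measure of the set of hits. Without hits X = 0, so (X -
  q)^2 is at least q^2, and Markov's inequality applies. The square is centred at q rather than at
  the mean because \<open>first\<close> bounds the mean only from below.\<close>

lemma prob_no_hit_le:
  fixes M :: "'a measure" and N :: "'b measure"
  assumes "prob_space M" "prob_space N"
    and C [measurable]: "C \<in> sets (M \<Otimes>\<^sub>M N)" and q: "q > 0"
    and first: "\<And>h. h \<in> space N \<Longrightarrow> measure M {\<omega>\<in>space M. (\<omega>, h) \<in> C} \<ge> q * (1 - e1)"
    and second: "(\<integral>\<^sup>+h. \<integral>\<^sup>+h'. emeasure M {\<omega>\<in>space M. (\<omega>, h) \<in> C \<and> (\<omega>, h') \<in> C} \<partial>N \<partial>N) \<le> ennreal (q\<^sup>2 * (1 + e2))"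
    and e: "1 + e2 \<ge> 0"
    and A: "A \<subseteq> {\<omega>\<in>space M. AE h in N. (\<omega>, h) \<notin> C}"
  shows "measure M A \<le> e2 + 2 * e1"
proof -
  interpret M: prob_space M by fact
  interpret N: prob_space N by fact
  interpret MN: pair_prob_space M N ..
  interpret NM: pair_prob_space N M ..
  define X where "X = (\<lambda>\<omega>. measure N {h\<in>space N. (\<omega>, h) \<in> C})"
  have sec [measurable]: "{h\<in>space N. (\<omega>, h) \<in> C} \<in> sets N" if "\<omega> \<in> space M" for \<omega>
    using sets_Pair1[OF C, of \<omega>] sets.sets_into_space[OF sets_Pair1[OF C, of \<omega>]]
    by (auto simp: vimage_def Int_def conj_commute elim!: back_subst[of "\<lambda>A. A \<in> sets N"])
  have Xn: "ennreal (X \<omega>) = (\<integral>\<^sup>+h. indicator C (\<omega>, h) \<partial>N)" if "\<omega> \<in> space M" for \<omega>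
  proof -
    have "(\<integral>\<^sup>+h. indicator C (\<omega>, h) \<partial>N) = (\<integral>\<^sup>+h. indicator {h\<in>space N. (\<omega>, h) \<in> C} h \<partial>N)"
      by (intro nn_integral_cong) (auto split: split_indicator)
    thus ?thesis using sec[OF that] by (simp add: X_def N.emeasure_eq_measure)
  qed
  have Xm [measurable]: "X \<in> borel_measurable M"
  proof -
    have "(\<lambda>\<omega>. enn2real (\<integral>\<^sup>+h. indicator C (\<omega>, h) \<partial>N)) \<in> borel_measurable M" by measurable
    also have "?this \<longleftrightarrow> ?thesis"
      by (intro measurable_cong) (auto simp: Xn[symmetric] X_def)
    finally show ?thesis .
  qed
  have X01: "0 \<le> X \<omega>" "X \<omega> \<le> 1" for \<omega> by (auto simp: X_def)
  have iX: "integrable M X" "integrable M (\<lambda>\<omega>. (X \<omega>)\<^sup>2)"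
    using X01 by (auto intro!: M.integrable_const_bound[of _ 1] AE_I2 simp: power_le_one)
  have E1: "M.expectation X \<ge> q * (1 - e1)"
  proof -
    have "ennreal (q * (1 - e1)) = (\<integral>\<^sup>+h. ennreal (q * (1 - e1)) \<partial>N)"
      by (simp add: N.emeasure_space_1)
    also have "\<dots> \<le> (\<integral>\<^sup>+h. \<integral>\<^sup>+\<omega>. indicator C (\<omega>, h) \<partial>M \<partial>N)"
    proof (rule nn_integral_mono)
      fix h assume h: "h \<in> space N"
      have "ennreal (q * (1 - e1)) \<le> emeasure M {\<omega>\<in>space M. (\<omega>, h) \<in> C}"
        using first[OF h] by (simp add: M.emeasure_eq_measure ennreal_leI)
      also have "\<dots> = (\<integral>\<^sup>+\<omega>. indicator {\<omega>\<in>space M. (\<omega>, h) \<in> C} \<omega> \<partial>M)"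
        using h by (subst nn_integral_indicator) auto
      also have "\<dots> = (\<integral>\<^sup>+\<omega>. indicator C (\<omega>, h) \<partial>M)"
        by (intro nn_integral_cong) (auto split: split_indicator)
      finally show "ennreal (q * (1 - e1)) \<le> (\<integral>\<^sup>+\<omega>. indicator C (\<omega>, h) \<partial>M)" .
    qed
    also have "\<dots> = (\<integral>\<^sup>+\<omega>. \<integral>\<^sup>+h. indicator C (\<omega>, h) \<partial>N \<partial>M)"
      by (intro MN.Fubini') measurable
    also have "\<dots> = (\<integral>\<^sup>+\<omega>. ennreal (X \<omega>) \<partial>M)" by (intro nn_integral_cong) (simp add: Xn)
    also have "\<dots> = ennreal (M.expectation X)" using X01 iX by (intro nn_integral_eq_integral) auto
    finally show ?thesis
      using X01 by (simp add: ennreal_le_iff integral_nonneg)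
  qed
  have E2: "M.expectation (\<lambda>\<omega>. (X \<omega>)\<^sup>2) \<le> q\<^sup>2 * (1 + e2)"
  proof -
    have "ennreal (M.expectation (\<lambda>\<omega>. (X \<omega>)\<^sup>2)) = (\<integral>\<^sup>+\<omega>. ennreal ((X \<omega>)\<^sup>2) \<partial>M)"
      using iX by (intro nn_integral_eq_integral[symmetric]) auto
    also have "\<dots> = (\<integral>\<^sup>+\<omega>. \<integral>\<^sup>+h. \<integral>\<^sup>+h'. indicator C (\<omega>, h) * indicator C (\<omega>, h') \<partial>N \<partial>N \<partial>M)"
    proof (rule nn_integral_cong)
      fix \<omega> assume \<omega>: "\<omega> \<in> space M"
      have "ennreal ((X \<omega>)\<^sup>2) = ennreal (X \<omega>) * ennreal (X \<omega>)"
        using X01 by (simp add: power2_eq_square ennreal_mult)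
      also have "\<dots> = (\<integral>\<^sup>+h. indicator C (\<omega>, h) * ennreal (X \<omega>) \<partial>N)"
        unfolding Xn[OF \<omega>] using \<omega> by (subst nn_integral_multc) auto
      also have "\<dots> = (\<integral>\<^sup>+h. \<integral>\<^sup>+h'. indicator C (\<omega>, h) * indicator C (\<omega>, h') \<partial>N \<partial>N)"
        unfolding Xn[OF \<omega>] using \<omega> by (intro nn_integral_cong nn_integral_cmult[symmetric]) auto
      finally show "ennreal ((X \<omega>)\<^sup>2) = (\<integral>\<^sup>+h. \<integral>\<^sup>+h'. indicator C (\<omega>, h) * indicator C (\<omega>, h') \<partial>N \<partial>N)" .
    qed
    also have "\<dots> = (\<integral>\<^sup>+h. \<integral>\<^sup>+\<omega>. \<integral>\<^sup>+h'. indicator C (\<omega>, h) * indicator C (\<omega>, h') \<partial>N \<partial>M \<partial>N)"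
      by (intro NM.Fubini') measurable
    also have "\<dots> = (\<integral>\<^sup>+h. \<integral>\<^sup>+h'. \<integral>\<^sup>+\<omega>. indicator C (\<omega>, h) * indicator C (\<omega>, h') \<partial>M \<partial>N \<partial>N)"
      by (intro nn_integral_cong NM.Fubini') measurable
    also have "\<dots> = (\<integral>\<^sup>+h. \<integral>\<^sup>+h'. emeasure M {\<omega>\<in>space M. (\<omega>, h) \<in> C \<and> (\<omega>, h') \<in> C} \<partial>N \<partial>N)"
    proof (intro nn_integral_cong)
      fix h h' assume hh [measurable]: "h \<in> space N" "h' \<in> space N"
      have "(\<integral>\<^sup>+\<omega>. indicator C (\<omega>, h) * indicator C (\<omega>, h') \<partial>M)
         = (\<integral>\<^sup>+\<omega>. indicator {\<omega>\<in>space M. (\<omega>, h) \<in> C \<and> (\<omega>, h') \<in> C} \<omega> \<partial>M)"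
        by (intro nn_integral_cong) (auto split: split_indicator)
      also have "\<dots> = emeasure M {\<omega>\<in>space M. (\<omega>, h) \<in> C \<and> (\<omega>, h') \<in> C}"
        by (rule nn_integral_indicator) measurable
      finally show "(\<integral>\<^sup>+\<omega>. indicator C (\<omega>, h) * indicator C (\<omega>, h') \<partial>M) = emeasure M {\<omega>\<in>space M. (\<omega>, h) \<in> C \<and> (\<omega>, h') \<in> C}" .
    qed
    also note second
    finally show ?thesis using q e by (subst (asm) ennreal_le_iff) auto
  qed
  have var: "M.expectation (\<lambda>\<omega>. (X \<omega> - q)\<^sup>2) \<le> q\<^sup>2 * (e2 + 2 * e1)"
  proof -
    have "M.expectation (\<lambda>\<omega>. (X \<omega> - q)\<^sup>2) = M.expectation (\<lambda>\<omega>. (X \<omega>)\<^sup>2 - 2 * q * X \<omega> + q\<^sup>2)"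
      by (intro Bochner_Integration.integral_cong) (auto simp: power2_eq_square algebra_simps)
    also have "\<dots> = M.expectation (\<lambda>\<omega>. (X \<omega>)\<^sup>2) - 2 * q * M.expectation X + q\<^sup>2"
      using iX by (simp add: M.prob_space)
    also have "\<dots> \<le> q\<^sup>2 * (1 + e2) - 2 * q * (q * (1 - e1)) + q\<^sup>2"
      using E1 E2 q by (intro add_mono diff_mono mult_left_mono) auto
    also have "\<dots> = q\<^sup>2 * (e2 + 2 * e1)" by (simp add: power2_eq_square algebra_simps)
    finally show ?thesis .
  qed
  have "{\<omega>\<in>space M. AE h in N. (\<omega>, h) \<notin> C} \<subseteq> {\<omega>\<in>space M. (X \<omega> - q)\<^sup>2 \<ge> q\<^sup>2}"
  proof safe
    fix \<omega> assume \<omega>: "\<omega> \<in> space M" "AE h in N. (\<omega>, h) \<notin> C"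
    have "X \<omega> = 0" unfolding X_def using \<omega> sec[OF \<omega>(1)]
      by (subst N.prob_eq_0) auto
    thus "q\<^sup>2 \<le> (X \<omega> - q)\<^sup>2" by simp
  qed
  hence sub: "A \<subseteq> {\<omega>\<in>space M. (X \<omega> - q)\<^sup>2 \<ge> q\<^sup>2}" using A by blast
  have "measure M A \<le> M.prob {\<omega>\<in>space M. (X \<omega> - q)\<^sup>2 \<ge> q\<^sup>2}"
    by (intro M.finite_measure_mono sub) measurable
  also have "\<dots> \<le> M.expectation (\<lambda>\<omega>. (X \<omega> - q)\<^sup>2) / q\<^sup>2"
  proof (rule integral_Markov_inequality_measure[where A = "{}"])
    show "integrable M (\<lambda>\<omega>. (X \<omega> - q)\<^sup>2)"
    proof -
      have "integrable M (\<lambda>\<omega>. (X \<omega>)\<^sup>2 - 2 * q * X \<omega> + q\<^sup>2)" using iX by simp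
      thus ?thesis by (rule Bochner_Integration.integrable_cong[THEN iffD1, rotated -1]) (auto simp: power2_eq_square algebra_simps)
    qed
  qed (use q in auto)
  also have "\<dots> \<le> q\<^sup>2 * (e2 + 2 * e1) / q\<^sup>2" by (intro divide_right_mono var) auto
  also have "\<dots> = e2 + 2 * e1" using q by simp
  finally show ?thesis .
qed

subsection \<open>Crossings\<close>

lemma ennreal_integral_FTC_le:
  fixes f f' :: "real \<Rightarrow> real"
  assumes "c \<le> z" and d: "\<And>x. (f has_real_derivative f' x) (at x)" and ct: "\<And>x. isCont f' x"
  shows "ennreal \<bar>f z - f c\<bar> \<le> (\<integral>\<^sup>+x. ennreal \<bar>f' x\<bar> * indicator {c..z} x \<partial>lborel)"
proof -
  have i: "integrable lborel (\<lambda>x. f' x * indicator {c..z} x)"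
    and e: "(LINT x|lborel. f' x * indicator {c..z} x) = f z - f c"
    using has_bochner_integral_FTC_Icc_real[of c z f f'] assms
    by (auto simp: has_bochner_integral_iff intro: has_field_derivative_at_within)
  have "ennreal (norm (f z - f c)) \<le> (\<integral>\<^sup>+x. ennreal (norm (f' x * indicator {c..z} x)) \<partial>lborel)"
    unfolding e[symmetric] by (rule integral_norm_bound_ennreal[OF i])
  also have "\<dots> = (\<integral>\<^sup>+x. ennreal \<bar>f' x\<bar> * indicator {c..z} x \<partial>lborel)"
    by (intro nn_integral_cong) (auto split: split_indicator)
  finally show ?thesis by simp
qed

text \<open>The level set of a in the interval is compact and has a largest point c; a later value
  below a would force another crossing after c.\<close>

lemma last_crossing:
  fixes f :: "real \<Rightarrow> real"
  assumes "w < z" "f w < a" "f z \<ge> a + 1" and f: "continuous_on {w..z} f"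
  obtains c where "w \<le> c" "c < z" "f c = a" "\<And>u. u \<in> {c..z} \<Longrightarrow> f u \<ge> a"
proof -
  define S where "S = {w..z} \<inter> f -` {a}"
  have "closed S" unfolding S_def by (intro continuous_closed_preimage f) auto
  moreover have "bounded S" unfolding S_def by (rule bounded_subset[of "{w..z}"]) auto
  ultimately have "compact S" by (simp add: compact_eq_bounded_closed)
  moreover have "S \<noteq> {}" using IVT'[of f w a z] assms by (auto simp: S_def)
  ultimately obtain c where c: "c \<in> S" "\<And>t. t \<in> S \<Longrightarrow> t \<le> c" using compact_attains_sup by metis
  have "f u \<ge> a" if u: "u \<in> {c..z}" for u
  proof (rule ccontr)
    assume "\<not> f u \<ge> a"
    moreover have "continuous_on {u..z} f" using u c by (intro continuous_on_subset[OF f]) (auto simp: S_def)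
    ultimately obtain t where "u \<le> t" "t \<le> z" "f t = a" using IVT'[of f u a z] assms u by auto
    moreover have "u \<noteq> t" using \<open>\<not> f u \<ge> a\<close> \<open>f t = a\<close> by auto
    ultimately show False using c(2)[of t] u c(1) by (auto simp: S_def)
  qed
  moreover have "c \<noteq> z" using c(1) assms by (auto simp: S_def)
  ultimately show thesis using c(1) that[of c] by (auto simp: S_def)
qed

lemma crossing_integral_ge_1:
  fixes f f' :: "real \<Rightarrow> real"
  assumes wz: "w < z" "f w < a" "f z \<ge> a + 1" and d: "\<And>x. (f has_real_derivative f' x) (at x)" and ct: "\<And>x. isCont f' x"
    and sub: "{w..z} \<subseteq> B"
  shows "1 \<le> (\<integral>\<^sup>+x. ennreal (\<bar>f' x\<bar> * indicator {a..} (f x)) * indicator B x \<partial>lborel)"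
proof -
  have "continuous_on {w..z} f" using d by (meson DERIV_atLeastAtMost_imp_continuous_on)
  then obtain c where c: "w \<le> c" "c < z" "f c = a" "\<And>u. u \<in> {c..z} \<Longrightarrow> f u \<ge> a"
    using last_crossing[OF wz] by blast
  have "1 \<le> ennreal \<bar>f z - f c\<bar>" using c wz by (simp flip: ennreal_1)
  also have "\<dots> \<le> (\<integral>\<^sup>+x. ennreal \<bar>f' x\<bar> * indicator {c..z} x \<partial>lborel)"
    using c by (intro ennreal_integral_FTC_le d ct) auto
  also have "\<dots> \<le> (\<integral>\<^sup>+x. ennreal (\<bar>f' x\<bar> * indicator {a..} (f x)) * indicator B x \<partial>lborel)"
  proof -
    have "{c..z} \<subseteq> B" using c(1) sub by (auto simp: subset_iff)
    thus ?thesis using c(4) by (intro nn_integral_mono) (auto split: split_indicator)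
  qed
  finally show ?thesis .
qed

text \<open>A smooth function reaching \<open>a + 1\<close> either stays above \<open>a\<close> or climbs from \<open>a\<close> to \<open>a + 1\<close>.\<close>
lemma one_le_time_plus_variation_above:
  fixes f f' :: "real \<Rightarrow> real"
  assumes H: "H > 0" and z: "\<bar>z\<bar> \<le> H" "f z \<ge> a + 1"
    and d: "\<And>x. (f has_real_derivative f' x) (at x)" and ct: "\<And>x. isCont f' x"
  shows "1 \<le> (\<integral>\<^sup>+h. ennreal (indicator {a..} (f h) + 2 * H * (indicator {a..} (f h) * \<bar>f' h\<bar>)) \<partial>unif H)"
proof -
  interpret U: prob_space "unif H" by (rule prob_space_unif[OF H])
  have fc: "isCont f x" for x using d DERIV_isCont by blast
  have fm [measurable]: "f \<in> borel_measurable borel" "f' \<in> borel_measurable borel"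
    using fc ct by (auto intro!: borel_measurable_continuous_onI simp: continuous_on_eq_continuous_at)
  show ?thesis
  proof (cases "\<forall>h\<in>{-H..H}. f h \<ge> a")
    case True
    have "1 = (\<integral>\<^sup>+h. 1 \<partial>unif H)" using U.emeasure_space_1 by simp
    also have "\<dots> \<le> (\<integral>\<^sup>+h. ennreal (indicator {a..} (f h) + 2 * H * (indicator {a..} (f h) * \<bar>f' h\<bar>)) \<partial>unif H)"
    proof (rule nn_integral_mono_AE)
      show "AE h in unif H. 1 \<le> ennreal (indicator {a..} (f h) + 2 * H * (indicator {a..} (f h) * \<bar>f' h\<bar>))"
        using AE_unif[OF H]
      proof eventually_elim
        case (elim h)
        hence "h \<in> {-H..H}" by (simp add: abs_le_iff)
        hence "f h \<ge> a" using True by blast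
        hence "1 \<le> indicator {a..} (f h) + 2 * H * (indicator {a..} (f h) * \<bar>f' h\<bar>)" using H by simp
        thus ?case by (metis ennreal_1 ennreal_leI)
      qed
    qed
    finally show ?thesis .
  next
    case False
    then obtain w where w: "w \<in> {-H..H}" "f w < a" by auto
    have *: "1 \<le> (\<integral>\<^sup>+x. ennreal (\<bar>f' x\<bar> * indicator {a..} (f x)) * indicator {-H..H} x \<partial>lborel)"
    proof (cases "w < z")
      case True
      thus ?thesis using w z by (intro crossing_integral_ge_1[of w z] d ct) auto
    next
      case False
      hence wz: "z < w" using w z by (cases w z rule: linorder_cases) auto
      \<comment> \<open>The point below the level lies to the right of z, so the crossing argument
        is run on the reflected function f (- x).\<close>
      have "1 \<le> (\<integral>\<^sup>+x. ennreal (\<bar>- f' (- x)\<bar> * indicator {a..} (f (- x))) * indicator {-H..H} x \<partial>lborel)"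
      proof (rule crossing_integral_ge_1[of "- w" "- z" "\<lambda>x. f (- x)"])
        show "((\<lambda>x. f (- x)) has_real_derivative - f' (- x)) (at x)" for x
        proof -
          have "((\<lambda>x. - x) has_real_derivative - 1) (at x)" by (auto intro!: derivative_eq_intros)
          from DERIV_chain2[of f "f' (- x)" "\<lambda>x. - x" x "- 1" UNIV, OF d this] show ?thesis by simp
        qed
        show "isCont (\<lambda>x. - f' (- x)) x" for x
          by (intro continuous_intros isCont_o2[where g = f' and f = "\<lambda>x. - x"] ct)
      qed (use w z wz in auto)
      also have "\<dots> = (\<integral>\<^sup>+x. ennreal (\<bar>f' x\<bar> * indicator {a..} (f x)) * indicator {-H..H} x \<partial>lborel)"
        by (subst nn_integral_real_affine[where c = "-1" and t = 0])
           (auto intro!: nn_integral_cong split: split_indicator)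
      finally show ?thesis .
    qed
    also have "(\<integral>\<^sup>+x. ennreal (\<bar>f' x\<bar> * indicator {a..} (f x)) * indicator {-H..H} x \<partial>lborel)
        = (\<integral>\<^sup>+x. ennreal (indicator {-H..H} x / (2 * H)) * ennreal (2 * H * (indicator {a..} (f x) * \<bar>f' x\<bar>)) \<partial>lborel)"
      using H by (intro nn_integral_cong) (auto simp: mult.commute split: split_indicator simp flip: ennreal_mult)
    also have "\<dots> = (\<integral>\<^sup>+h. ennreal (2 * H * (indicator {a..} (f h) * \<bar>f' h\<bar>)) \<partial>unif H)"
      unfolding unif_def using H by (subst nn_integral_density) auto
    also have "\<dots> \<le> (\<integral>\<^sup>+h. ennreal (indicator {a..} (f h) + 2 * H * (indicator {a..} (f h) * \<bar>f' h\<bar>)) \<partial>unif H)"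
      using H by (intro nn_integral_mono ennreal_leI) auto
    finally show ?thesis .
  qed
qed

subsection \<open>The upper bound\<close>

text \<open>Coefficients of the field restricted to the primes in \<open>P\<close>. Extending them
  by 0 lets fields over different sets of primes be linear forms over one index set, so that their
  covariances are all given by \<open>inn\<close>.\<close>

definition cf :: "nat set \<Rightarrow> real \<Rightarrow> nat \<Rightarrow> complex" where
  "cf P h p = (if p \<in> P then cis (- h * ln (real p)) / of_real (sqrt (real p)) else 0)"

text \<open>The h-derivative of \<open>cf P h\<close>, coefficient by coefficient.\<close>

definition cfd :: "nat set \<Rightarrow> real \<Rightarrow> nat \<Rightarrow> complex" where
  "cfd P h p = - \<i> * of_real (ln (real p)) * cf P h p"

locale prime_gaussian = gaussian_family M G "{p::nat. prime p}" for M :: "'a measure" and G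
begin

lemma primes_upto_prime: "primes_upto x \<subseteq> {p. prime p}" by (auto simp: primes_upto_def)

lemma X_T_eq_lin: "X_T G T h \<omega> = lin (primes_upto T) (cf (primes_upto T) h) \<omega>"
  unfolding X_T_def lin_def primes_upto_def[symmetric]
  by (intro sum.cong refl) (simp add: cf_def)

lemma cf_Un: "P \<inter> Q = {} \<Longrightarrow> lin F (cf (P \<union> Q) h) \<omega> = lin F (cf P h) \<omega> + lin F (cf Q h) \<omega>"
  unfolding lin_def sum.distrib[symmetric] by (intro sum.cong refl) (auto simp: cf_def)

lemma inn_cf:
  assumes F: "finite F" "P \<inter> Q \<subseteq> F" "\<And>p. p \<in> P \<inter> Q \<Longrightarrow> p > 0"
  shows "inn F (cf P h) (cf Q h') = (\<Sum>p\<in>P \<inter> Q. cos ((h - h') * ln (real p)) / real p)"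
proof -
  have "inn F (cf P h) (cf Q h') = (\<Sum>p\<in>P \<inter> Q. Re (cf P h p * cnj (cf Q h' p)))"
    unfolding inn_def using F by (intro sum.mono_neutral_right) (auto simp: cf_def)
  also have "\<dots> = (\<Sum>p\<in>P \<inter> Q. cos ((h - h') * ln (real p)) / real p)"
  proof (intro sum.cong refl)
    fix p assume p: "p \<in> P \<inter> Q"
    have "Re (cf P h p * cnj (cf Q h' p)) = Re (cis (- h * ln (real p)) * cis (h' * ln (real p))) / (sqrt (real p) * sqrt (real p))"
      using p by (simp add: cf_def cis_cnj field_simps flip: of_real_mult)
    also have "cis (- h * ln (real p)) * cis (h' * ln (real p)) = cis (- ((h - h') * ln (real p)))"
      by (simp add: cis_mult algebra_simps)
    also have "Re \<dots> = cos ((h - h') * ln (real p))" by simp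
    finally show "Re (cf P h p * cnj (cf Q h' p)) = cos ((h - h') * ln (real p)) / real p"
      using F(3)[OF p] by simp
  qed
  finally show ?thesis .
qed

lemma nsq_eq_inn: "nsq F a = inn F a a"
  unfolding nsq_def inn_def by (intro sum.cong refl) (simp add: complex_norm_square[symmetric] cmod_power2 power2_eq_square)

lemma inn_minus_right: "inn F a (\<lambda>i. b i - of_real \<beta> * c i) = inn F a b - \<beta> * inn F a c"
proof -
  have "Re (a i * cnj (b i - of_real \<beta> * c i)) = Re (a i * cnj (b i)) - \<beta> * Re (a i * cnj (c i))" for i
    by (simp add: algebra_simps)
  thus ?thesis by (simp only: inn_def sum_subtractf sum_distrib_left)
qed

lemma Re_cf: "p \<in> P \<Longrightarrow> Re (w * cf P h p) = (Re w * cos (h * ln (real p)) + Im w * sin (h * ln (real p))) / sqrt (real p)"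
  by (simp add: cf_def field_simps)

lemma Re_cfd: "p \<in> P \<Longrightarrow> Re (w * cfd P h p) = ln (real p) * (Im w * cos (h * ln (real p)) - Re w * sin (h * ln (real p))) / sqrt (real p)"
  by (simp add: cfd_def cf_def field_simps) (simp add: diff_divide_distrib)

lemma lin_cf_measurable_pair:
  assumes F: "F \<subseteq> {p. prime p}"
  shows "(\<lambda>z. lin F (cf P (snd z)) (fst z)) \<in> borel_measurable (M \<Otimes>\<^sub>M borel)"
proof -
  have "(\<lambda>z. Re (G p (fst z) * cf P (snd z) p)) \<in> borel_measurable (M \<Otimes>\<^sub>M borel)" if p: "p \<in> F" for p
  proof (cases "p \<in> P")
    case True
    have [measurable]: "G p \<in> borel_measurable M" using G_measurable p F by auto
    have [measurable]: "Re \<in> borel_measurable borel" "Im \<in> borel_measurable borel"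
      by (auto intro: borel_measurable_continuous_onI continuous_intros)
    show ?thesis unfolding Re_cf[OF True] by measurable
  next
    case False
    thus ?thesis by (simp add: cf_def)
  qed
  thus ?thesis unfolding lin_def by (intro borel_measurable_sum)
qed

lemma lin_cfd_measurable_pair:
  assumes F: "F \<subseteq> {p. prime p}"
  shows "(\<lambda>z. lin F (cfd P (snd z)) (fst z)) \<in> borel_measurable (M \<Otimes>\<^sub>M borel)"
proof -
  have "(\<lambda>z. Re (G p (fst z) * cfd P (snd z) p)) \<in> borel_measurable (M \<Otimes>\<^sub>M borel)" if p: "p \<in> F" for p
  proof (cases "p \<in> P")
    case True
    have [measurable]: "G p \<in> borel_measurable M" using G_measurable p F by auto
    have [measurable]: "Re \<in> borel_measurable borel" "Im \<in> borel_measurable borel"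
      by (auto intro: borel_measurable_continuous_onI continuous_intros)
    show ?thesis unfolding Re_cfd[OF True] by measurable
  next
    case False
    thus ?thesis by (simp add: cfd_def cf_def)
  qed
  thus ?thesis unfolding lin_def by (intro borel_measurable_sum)
qed

lemma lin_cf_deriv:
  "((\<lambda>h. lin F (cf F h) \<omega>) has_real_derivative lin F (cfd F h) \<omega>) (at h)"
  unfolding lin_def
proof (intro DERIV_sum)
  fix p assume p: "p \<in> F"
  have "((\<lambda>h. (Re (G p \<omega>) * cos (h * ln (real p)) + Im (G p \<omega>) * sin (h * ln (real p))) / sqrt (real p))
      has_real_derivative (Re (G p \<omega>) * (- sin (h * ln (real p)) * ln (real p)) + Im (G p \<omega>) * (cos (h * ln (real p)) * ln (real p))) / sqrt (real p)) (at h)"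
    by (intro DERIV_cdivide DERIV_add DERIV_cmult) (auto intro!: derivative_eq_intros)
  thus "((\<lambda>h. Re (G p \<omega> * cf F h p)) has_real_derivative Re (G p \<omega> * cfd F h p)) (at h)"
    unfolding Re_cf[OF p] Re_cfd[OF p] by (simp add: algebra_simps)
qed

lemma lin_cfd_isCont: "isCont (\<lambda>h. lin F (cfd F h) \<omega>) h"
  unfolding lin_def
proof (intro continuous_sum)
  fix p assume p: "p \<in> F"
  have "isCont (\<lambda>h. ln (real p) * (Im (G p \<omega>) * cos (h * ln (real p)) - Re (G p \<omega>) * sin (h * ln (real p))) * (1 / sqrt (real p))) h"
    by (intro continuous_intros)
  thus "isCont (\<lambda>h. Re (G p \<omega> * cfd F h p)) h" unfolding Re_cfd[OF p] by simp
qed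

text \<open>The functional of \<open>one_le_time_plus_variation_above\<close> is at least 1 on the
  event, so its expectation bounds the probability. At a fixed h that expectation is computed from
  independence of field and derivative; 4 H ln T is 2 H times the bound 2 ln T for the size of the
  derivative.\<close>

lemma prob_exceeds_le:
  assumes T: "T \<ge> 2" and v: "prime_cos_sum T 0 = 2 * v" "v > 0" and a: "a > 0" and H: "H > 0"
  shows "prob {\<omega>\<in>space M. \<exists>h. \<bar>h\<bar> \<le> H \<and> X_T G T h \<omega> \<ge> a + 1}
      \<le> (1 + 4 * H * ln T) * (v / a * (exp (- a\<^sup>2 / (2 * v)) / sqrt (2 * pi * v)))"
proof -
  define F where "F = primes_upto T"
  have F: "F \<subseteq> {p. prime p}" "finite F" "\<And>p. p \<in> F \<Longrightarrow> p > 0"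
    unfolding F_def using primes_upto_prime by (auto dest: primes_uptoD)
  interpret U: prob_space "unif H" by (rule prob_space_unif[OF H])
  interpret MU: pair_prob_space M "unif H" ..
  define X where "X = (\<lambda>\<omega> h. lin F (cf F h) \<omega>)"
  define X' where "X' = (\<lambda>\<omega> h. lin F (cfd F h) \<omega>)"
  define g where "g = (\<lambda>\<omega> h. ennreal (indicator {a..} (X \<omega> h) + 2 * H * (indicator {a..} (X \<omega> h) * \<bar>X' \<omega> h\<bar>)))"
  have [measurable]: "(\<lambda>z. X (fst z) (snd z)) \<in> borel_measurable (M \<Otimes>\<^sub>M unif H)"
      "(\<lambda>z. X' (fst z) (snd z)) \<in> borel_measurable (M \<Otimes>\<^sub>M unif H)"
    using lin_cf_measurable_pair[OF F(1), of F] lin_cfd_measurable_pair[OF F(1), of F]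
    unfolding X_def X'_def by (simp_all add: measurable_cong_sets[OF sets_pair_measure_cong[OF refl sets_unif] refl])
  have gm [measurable]: "(\<lambda>z. g (fst z) (snd z)) \<in> borel_measurable (M \<Otimes>\<^sub>M unif H)"
    unfolding g_def by measurable
  have [measurable]: "lin F b \<in> borel_measurable M" for b by (rule lin_measurable[OF F(1)])
  define B where "B = v / a * (exp (- a\<^sup>2 / (2 * v)) / sqrt (2 * pi * v))"
  have B0: "B \<ge> 0" using v a by (simp add: B_def)
  have lT: "ln T > 0" using T by simp
  have nsq: "nsq F (cf F h) = 2 * v" for h
    unfolding nsq_eq_inn using F v(1) by (subst inn_cf) (auto simp: prime_cos_sum_def F_def)
  have nsqd: "nsq F (cfd F h) = (\<Sum>p\<in>F. (ln (real p))\<^sup>2 / real p)" for h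
    unfolding nsq_def using F
    by (intro sum.cong refl) (auto simp: cfd_def cf_def norm_mult norm_divide power_mult_distrib power_divide)
  have two: "2 \<in> F" using T by (simp add: F_def primes_upto_def)
  have nsqd_pos: "nsq F (cfd F h) > 0" for h
    unfolding nsqd using F two by (intro sum_pos2[of _ 2]) auto
  have nsqd_le: "sqrt (nsq F (cfd F h)) \<le> 2 * ln T" for h
  proof (rule real_le_lsqrt)
    have "nsq F (cfd F h) \<le> 2 * (ln T)\<^sup>2" unfolding nsqd unfolding F_def using T by (intro sum_ln_sq_prime_le) simp
    also have "\<dots> \<le> (2 * ln T)\<^sup>2" by (simp add: power_mult_distrib)
    finally show "nsq F (cfd F h) \<le> (2 * ln T)\<^sup>2" .
  qed (use lT in \<open>auto simp: nsq_nonneg\<close>)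
  \<comment> \<open>Each derivative coefficient is an imaginary multiple of the field coefficient.
    This expresses stationarity: the field is uncorrelated with its derivative at the same
    point.\<close>
  have orth: "inn F (cf F h) (cfd F h) = 0" for h
    unfolding inn_def
  proof (intro sum.neutral ballI)
    fix p assume p: "p \<in> F"
    have "cf F h p * cnj (cfd F h p) = \<i> * of_real (ln (real p)) * (cf F h p * cnj (cf F h p))"
      by (simp add: cfd_def)
    also have "\<dots> = \<i> * of_real (ln (real p) * (norm (cf F h p))\<^sup>2)"
      by (simp add: complex_norm_square[symmetric])
    finally show "Re (cf F h p * cnj (cfd F h p)) = 0" by simp
  qed
  have g_le: "(\<integral>\<^sup>+\<omega>. g \<omega> h \<partial>M) \<le> ennreal ((1 + 4 * H * ln T) * B)" for h
  proof -
    have pB: "prob {\<omega>\<in>space M. X \<omega> h \<in> {a..}} \<le> B"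
      using prob_lin_mills[OF F(1) nsq v(2) a, of h] by (simp add: X_def B_def)
    have "(\<integral>\<^sup>+\<omega>. g \<omega> h \<partial>M) = (\<integral>\<^sup>+\<omega>. indicator {\<omega>\<in>space M. X \<omega> h \<in> {a..}} \<omega> + ennreal (2 * H) * ennreal (indicator {a..} (X \<omega> h) * \<bar>X' \<omega> h\<bar>) \<partial>M)"
      unfolding g_def using H by (intro nn_integral_cong) (auto split: split_indicator simp: ennreal_plus simp flip: ennreal_mult)
    also have "\<dots> = emeasure M {\<omega>\<in>space M. X \<omega> h \<in> {a..}} + ennreal (2 * H) * (\<integral>\<^sup>+\<omega>. ennreal (indicator {a..} (X \<omega> h) * \<bar>X' \<omega> h\<bar>) \<partial>M)"
      unfolding X_def X'_def by (subst nn_integral_add) (auto simp: nn_integral_cmult)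
    also have "\<dots> \<le> ennreal (prob {\<omega>\<in>space M. X \<omega> h \<in> {a..}}) + ennreal (2 * H) * ennreal (prob {\<omega>\<in>space M. X \<omega> h \<in> {a..}} * sqrt (nsq F (cfd F h)))"
      unfolding X_def X'_def
      by (intro add_mono mult_left_mono nn_integral_abs_lin_on_event_le[OF F(1) orth _ nsqd_pos]) (auto simp: emeasure_eq_measure)
    also have "\<dots> = ennreal (prob {\<omega>\<in>space M. X \<omega> h \<in> {a..}} * (1 + 2 * H * sqrt (nsq F (cfd F h))))"
      using H nsq_nonneg[of F "cfd F h"] by (simp add: algebra_simps ennreal_plus[symmetric] ennreal_mult[symmetric] del: ennreal_plus)
    also have "\<dots> \<le> ennreal (B * (1 + 2 * H * (2 * ln T)))"
      using H nsqd_le[of h] nsq_nonneg[of F "cfd F h"] B0 pB by (intro ennreal_leI mult_mono add_mono mult_left_mono) auto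
    finally show ?thesis by (simp add: algebra_simps)
  qed
  have Zm [measurable]: "(\<lambda>\<omega>. \<integral>\<^sup>+h. g \<omega> h \<partial>unif H) \<in> borel_measurable M" by measurable
  have "{\<omega>\<in>space M. \<exists>h. \<bar>h\<bar> \<le> H \<and> X_T G T h \<omega> \<ge> a + 1} \<subseteq> {\<omega>\<in>space M. 1 \<le> (\<integral>\<^sup>+h. g \<omega> h \<partial>unif H)}"
  proof safe
    fix \<omega> h assume *: "\<omega> \<in> space M" "\<bar>h\<bar> \<le> H" "a + 1 \<le> X_T G T h \<omega>"
    show "1 \<le> (\<integral>\<^sup>+h. g \<omega> h \<partial>unif H)"
      unfolding g_def
    proof (rule one_le_time_plus_variation_above[OF H *(2)])
      show "a + 1 \<le> X \<omega> h" using *(3) by (simp add: X_T_eq_lin X_def F_def)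
      show "(X \<omega> has_real_derivative X' \<omega> x) (at x)" for x unfolding X_def X'_def by (rule lin_cf_deriv)
      show "isCont (X' \<omega>) x" for x unfolding X'_def by (rule lin_cfd_isCont)
    qed
  qed
  hence "emeasure M {\<omega>\<in>space M. \<exists>h. \<bar>h\<bar> \<le> H \<and> X_T G T h \<omega> \<ge> a + 1} \<le> emeasure M {\<omega>\<in>space M. 1 \<le> (\<integral>\<^sup>+h. g \<omega> h \<partial>unif H)}"
    by (intro emeasure_mono) measurable
  also have "\<dots> \<le> (\<integral>\<^sup>+\<omega>. (\<integral>\<^sup>+h. g \<omega> h \<partial>unif H) \<partial>M)"
  proof -
    have "emeasure M {\<omega>\<in>space M. 1 \<le> 1 * (\<integral>\<^sup>+h. g \<omega> h \<partial>unif H)}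
        \<le> 1 * (\<integral>\<^sup>+\<omega>. (\<integral>\<^sup>+h. g \<omega> h \<partial>unif H) * indicator (space M) \<omega> \<partial>M)"
      using Zm by (intro nn_integral_Markov_inequality) measurable
    also have "(\<integral>\<^sup>+\<omega>. (\<integral>\<^sup>+h. g \<omega> h \<partial>unif H) * indicator (space M) \<omega> \<partial>M) = (\<integral>\<^sup>+\<omega>. (\<integral>\<^sup>+h. g \<omega> h \<partial>unif H) \<partial>M)"
      by (intro nn_integral_cong) auto
    finally show ?thesis by simp
  qed
  also have "\<dots> = (\<integral>\<^sup>+h. (\<integral>\<^sup>+\<omega>. g \<omega> h \<partial>M) \<partial>unif H)"
    by (intro MU.Fubini'[symmetric]) (use gm in \<open>simp add: case_prod_beta'\<close>)
  also have "\<dots> \<le> (\<integral>\<^sup>+h. ennreal ((1 + 4 * H * ln T) * B) \<partial>unif H)" by (intro nn_integral_mono g_le)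
  also have "\<dots> = ennreal ((1 + 4 * H * ln T) * B)" using U.emeasure_space_1 by simp
  finally have "ennreal (prob {\<omega>\<in>space M. \<exists>h. \<bar>h\<bar> \<le> H \<and> X_T G T h \<omega> \<ge> a + 1}) \<le> ennreal ((1 + 4 * H * ln T) * B)"
    by (simp add: emeasure_eq_measure)
  thus ?thesis using H lT B0 unfolding B_def[symmetric] by (subst (asm) ennreal_le_iff) auto
qed

end

lemma exp_exp_ge: "n \<ge> 0 \<Longrightarrow> exp (exp n) \<ge> exp (1::real)"
  by simp

lemma variance_asymp:
  assumes "n \<ge> (0::real)"
  shows "\<bar>prime_cos_sum (exp (exp n)) 0 - n\<bar> \<le> 20"
  using mertens_second[OF exp_exp_ge[OF assms]] by simp

context prime_gaussian
begin

text \<open>H ln T contributes exp (\<alpha>^2 n), the Gaussian exponent exp (- \<alpha>^2 n + 2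
  \<alpha> b n) up to a constant, and Mills' ratio n^(-1/2). As exp (2 \<alpha> b n) is a constant
  times n^(1/2 - 2 \<alpha> \<epsilon>), the total decays like n^(- 2 \<alpha> \<epsilon>).\<close>

lemma upper_limit:
  fixes \<theta> \<epsilon> :: real
  assumes \<theta>: "\<theta> > 0" and \<epsilon>: "\<epsilon> > 0"
  defines "\<alpha> \<equiv> sqrt (1 + \<theta>)"
  shows "((\<lambda>n. prob {\<omega>\<in>space M. \<exists>h. \<bar>h\<bar> \<le> exp (\<theta> * n) \<and>
            X_T G (exp (exp n)) h \<omega> \<ge> \<alpha> * n - (1 / (4 * \<alpha>) - \<epsilon>) * ln n}) \<longlongrightarrow> 0) at_top"
proof -
  have \<alpha>: "\<alpha> > 0" "\<alpha>\<^sup>2 = 1 + \<theta>" using \<theta> by (auto simp: \<alpha>_def)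
  \<comment> \<open>The added 1 compensates the unit climb in \<open>prob_exceeds_le\<close>, whose
    event is reaching \<open>a + 1\<close>.\<close>
  define b where "b = (\<lambda>n. (1 / (4 * \<alpha>) - \<epsilon>) * ln n + 1)"
  define a where "a = (\<lambda>n. \<alpha> * n - b n)"
  define D where "D = 5 * exp (20 * \<alpha>\<^sup>2 + 2 * \<alpha>) / \<alpha>"
  define \<kappa> where "\<kappa> = 2 * \<alpha> * \<epsilon>"
  have \<kappa>: "\<kappa> > 0" using \<alpha> \<epsilon> by (simp add: \<kappa>_def)
  define f where "f = (\<lambda>n::real. D * (n powr (1/2 - \<kappa>) * ((n + 20) / n) / sqrt (n - 20)))"
  have "((\<lambda>n::real. n powr (1/2 - \<kappa>) * ((n + 20) / n) / sqrt (n - 20)) \<longlongrightarrow> 0) at_top"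
    using \<kappa> by real_asymp
  hence "(f \<longlongrightarrow> D * 0) at_top" unfolding f_def by (intro tendsto_mult tendsto_const)
  hence f0: "(f \<longlongrightarrow> 0) at_top" by simp
  have "\<forall>\<^sub>F n in at_top. a n \<ge> \<alpha> * n / 2"
  proof -
    define c where "c = 1 / (4 * \<alpha>) - \<epsilon>"
    have "\<forall>\<^sub>F n in at_top. \<alpha> * n - (c * ln n + 1) \<ge> \<alpha> * n / 2"
      using \<alpha>(1) by real_asymp
    thus ?thesis by (simp add: a_def b_def c_def)
  qed
  hence ev: "\<forall>\<^sub>F n in at_top. a n \<ge> \<alpha> * n / 2 \<and> n \<ge> (21::real)"
    using eventually_ge_at_top[of "21::real"] by eventually_elim auto
  have bound: "prob {\<omega>\<in>space M. \<exists>h. \<bar>h\<bar> \<le> exp (\<theta> * n) \<and>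
            X_T G (exp (exp n)) h \<omega> \<ge> \<alpha> * n - (1 / (4 * \<alpha>) - \<epsilon>) * ln n} \<le> f n"
    if n: "a n \<ge> \<alpha> * n / 2" "n \<ge> 21" for n
  proof -
    define T where "T = exp (exp n)"
    define v where "v = prime_cos_sum T 0 / 2"
    have v: "2 * v \<ge> n - 20" "2 * v \<le> n + 20" "v > 0"
      using variance_asymp[of n] n(2) by (auto simp: v_def T_def abs_le_iff)
    have an: "a n > 0" using n \<alpha> by (smt (verit) half_gt_zero mult_pos_pos)
    have "T \<ge> exp 1" using n by (simp add: T_def)
    hence T2: "T \<ge> 2" using exp_ge_add_one_self[of 1] by linarith
    have thr: "\<alpha> * n - (1 / (4 * \<alpha>) - \<epsilon>) * ln n = a n + 1" by (simp add: a_def b_def)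
    have "prob {\<omega>\<in>space M. \<exists>h. \<bar>h\<bar> \<le> exp (\<theta> * n) \<and> X_T G T h \<omega> \<ge> a n + 1}
       \<le> (1 + 4 * exp (\<theta> * n) * ln T) * (v / a n * (exp (- (a n)\<^sup>2 / (2 * v)) / sqrt (2 * pi * v)))"
      using an v by (intro prob_exceeds_le T2) (auto simp: v_def)
    also have "\<dots> \<le> (5 * exp (\<alpha>\<^sup>2 * n)) * ((n + 20) / (\<alpha> * n) * (exp (20 * \<alpha>\<^sup>2 + 2 * \<alpha> * b n - \<alpha>\<^sup>2 * n) / sqrt (n - 20)))"
    proof (rule mult_mono[OF _ mult_mono[OF _ frac_le]])
      have "exp (\<theta> * n) * ln T = exp (\<theta> * n + n)" by (simp add: T_def exp_add)
      also have "\<theta> * n + n = \<alpha>\<^sup>2 * n" by (simp add: \<alpha> algebra_simps)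
      finally have "exp (\<theta> * n) * ln T = exp (\<alpha>\<^sup>2 * n)" .
      moreover have "1 \<le> exp (\<alpha>\<^sup>2 * n)" using n by simp
      ultimately have "1 + 4 * (exp (\<theta> * n) * ln T) \<le> 5 * exp (\<alpha>\<^sup>2 * n)" by linarith
      thus "1 + 4 * exp (\<theta> * n) * ln T \<le> 5 * exp (\<alpha>\<^sup>2 * n)" by (simp only: mult.assoc)
      show "v / a n \<le> (n + 20) / (\<alpha> * n)"
      proof -
        have "v / a n \<le> ((n + 20) / 2) / (\<alpha> * n / 2)"
          using v n \<alpha> by (intro frac_le) auto
        also have "((n + 20) / 2) / (\<alpha> * n / 2) = (n + 20) / (\<alpha> * n)" using n \<alpha> by (simp add: divide_simps)
        finally show ?thesis .
      qed
      have "(a n)\<^sup>2 / (2 * v) \<ge> (a n)\<^sup>2 / (n + 20)" using v n by (intro divide_left_mono) auto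
      moreover have "(a n)\<^sup>2 / (n + 20) \<ge> \<alpha>\<^sup>2 * n - 20 * \<alpha>\<^sup>2 - 2 * \<alpha> * b n"
      proof -
        have "(a n)\<^sup>2 - (n + 20) * (\<alpha>\<^sup>2 * n - 20 * \<alpha>\<^sup>2 - 2 * \<alpha> * b n) = (20 * \<alpha> + b n)\<^sup>2"
          by (simp add: a_def power2_eq_square algebra_simps)
        also have "\<dots> \<ge> 0" by simp
        finally have "(\<alpha>\<^sup>2 * n - 20 * \<alpha>\<^sup>2 - 2 * \<alpha> * b n) * (n + 20) \<le> (a n)\<^sup>2" by (simp add: mult.commute)
        thus ?thesis using n by (simp add: le_divide_eq)
      qed
      ultimately show "exp (- (a n)\<^sup>2 / (2 * v)) \<le> exp (20 * \<alpha>\<^sup>2 + 2 * \<alpha> * b n - \<alpha>\<^sup>2 * n)" by simp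
      have "1 * v \<le> pi * v" using pi_gt3 v by (intro mult_right_mono) auto
      hence "n - 20 \<le> 2 * (pi * v)" using v(1) by linarith
      thus "sqrt (n - 20) \<le> sqrt (2 * pi * v)" by (simp add: mult.assoc)
    qed (use v an n \<alpha> in auto)
    also have "\<dots> = 5 * exp (20 * \<alpha>\<^sup>2) * exp (2 * \<alpha> * b n) * ((n + 20) / (\<alpha> * n)) / sqrt (n - 20)"
      by (simp add: exp_add exp_diff ac_simps)
    also have "exp (2 * \<alpha> * b n) = exp (2 * \<alpha>) * n powr (1/2 - \<kappa>)"
    proof -
      have "2 * \<alpha> * b n = 2 * \<alpha> + (1/2 - \<kappa>) * ln n"
        using \<alpha> by (simp add: b_def \<kappa>_def field_simps)
      thus ?thesis using n by (simp add: exp_add powr_def)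
    qed
    also have "5 * exp (20 * \<alpha>\<^sup>2) * (exp (2 * \<alpha>) * n powr (1/2 - \<kappa>)) * ((n + 20) / (\<alpha> * n)) / sqrt (n - 20) = f n"
      by (simp add: f_def D_def exp_add ac_simps)
    finally show ?thesis unfolding thr T_def .
  qed
  show ?thesis
  proof (rule tendsto_sandwich[OF _ _ tendsto_const f0])
    show "\<forall>\<^sub>F n in at_top. prob {\<omega>\<in>space M. \<exists>h. \<bar>h\<bar> \<le> exp (\<theta> * n) \<and>
            X_T G (exp (exp n)) h \<omega> \<ge> \<alpha> * n - (1 / (4 * \<alpha>) - \<epsilon>) * ln n} \<le> f n"
      using ev by eventually_elim (auto intro: bound)
  qed auto
qed

end

subsection \<open>The second moment at a fixed scale\<close>

text \<open>Scales are measured on the ln ln axis: by \<open>KK_0_asymp\<close> the primes up to exp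
  (exp k) have reciprocal sum k up to 20, so variance grows linearly in the scale.\<close>

definition lv :: "real \<Rightarrow> nat set" where "lv k = primes_upto (exp (exp k))"
definition KK :: "real \<Rightarrow> real \<Rightarrow> real" where "KK k t = prime_cos_sum (exp (exp k)) t"

lemma lv_mono: "k \<le> l \<Longrightarrow> lv k \<subseteq> lv l"
  unfolding lv_def by (intro primes_upto_mono) simp

lemma finite_lv [simp, intro]: "finite (lv k)" by (simp add: lv_def)

lemma lv_prime: "lv k \<subseteq> {p. prime p}" by (auto simp: lv_def primes_upto_def)

lemma lv_pos: "p \<in> lv k \<Longrightarrow> p > 0" by (auto simp: lv_def dest: primes_uptoD)

lemma KK_alt: "KK k t = (\<Sum>p\<in>lv k. cos (t * ln (real p)) / real p)"
  by (simp add: KK_def prime_cos_sum_def lv_def)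

lemma sum_lv_diff: "k \<le> l \<Longrightarrow> (\<Sum>p\<in>lv l - lv k. cos (t * ln (real p)) / real p) = KK l t - KK k t"
  unfolding KK_alt using lv_mono[of k l] by (subst sum_diff) auto

lemma KK_0_asymp: "n \<ge> 0 \<Longrightarrow> \<bar>KK n 0 - n\<bar> \<le> 20"
  using variance_asymp by (simp add: KK_def)

lemma KK_abs_le: "\<bar>KK k t\<bar> \<le> KK k 0"
proof -
  have "\<bar>KK k t\<bar> \<le> (\<Sum>p\<in>lv k. \<bar>cos (t * ln (real p)) / real p\<bar>)" unfolding KK_alt by (rule sum_abs)
  also have "\<dots> \<le> (\<Sum>p\<in>lv k. cos (0 * ln (real p)) / real p)" by (intro sum_mono) (auto intro!: divide_right_mono)
  finally show ?thesis by (simp only: KK_alt)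
qed

lemma KK_mono_0: "k \<le> l \<Longrightarrow> KK k 0 \<le> KK l 0"
  unfolding KK_alt using lv_mono[of k l] by (intro sum_mono2) auto

lemma KK_ge:
  assumes "k \<ge> 0" "\<bar>t\<bar> \<le> exp (- k)"
  shows "KK k t \<ge> KK k 0 - 1"
proof -
  have "\<bar>t\<bar> * ln (exp (exp k)) \<le> exp (- k) * exp k" using assms by simp
  also have "\<dots> = 1" by (simp flip: exp_add)
  finally show ?thesis unfolding KK_def by (intro prime_cos_sum_ge) auto
qed

lemma KK_le_small: "k \<ge> 0 \<Longrightarrow> t \<noteq> 0 \<Longrightarrow> \<bar>t\<bar> \<le> 1 \<Longrightarrow> KK k t \<le> 20 - ln \<bar>t\<bar>"
  unfolding KK_def by (intro prime_cos_sum_le_small exp_exp_ge)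

lemma KK_le_large: "k \<ge> 0 \<Longrightarrow> \<bar>t\<bar> \<ge> 1 \<Longrightarrow> KK k t \<le> 20 + ln (ln (\<bar>t\<bar> + 2))"
  unfolding KK_def by (intro prime_cos_sum_le_large exp_exp_ge)

context prime_gaussian
begin

lemma inn_lv:
  assumes "a \<le> b" "b \<le> n" "P \<inter> Q = lv b - lv a"
  shows "inn (lv n) (cf P h) (cf Q h') = KK b (h - h') - KK a (h - h')"
proof -
  have "lv b \<subseteq> lv n" using assms by (intro lv_mono)
  thus ?thesis using assms sum_lv_diff[of a b "h - h'"] lv_pos
    by (subst inn_cf) auto
qed

lemma lin_uminus: "lin F (\<lambda>i. - b i) \<omega> = - lin F b \<omega>"
  by (simp add: lin_def sum_negf[symmetric])

lemma nsq_uminus: "nsq F (\<lambda>i. - b i) = nsq F b" by (simp add: nsq_def)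

lemma inn_uminus: "inn F a (\<lambda>i. - b i) = - inn F a b"
  by (simp add: inn_def sum_negf[symmetric])

end

text \<open>\<open>U\<close> collects the primes between the scales \<open>m\<close> and \<open>n\<close>, \<open>\<Delta> j\<close> those in the top \<open>j\<close> scales and \<open>R\<close>
  those below scale \<open>m\<close>. The variance of \<open>U h\<close> is \<open>V / 2\<close> and the covariance of \<open>U h\<close> and \<open>U h'\<close>
  is \<open>S (h - h') / 2\<close>. The constants 40 and 42 below absorb the errors 20 and 1 in the estimates for \<open>KK\<close>.\<close>
locale prime_gaussian_scales = prime_gaussian M G for M :: "'a measure" and G +
  fixes n m x \<gamma> s :: real and j0 :: nat
  assumes m: "0 \<le> m" "m \<le> n" and x: "x \<ge> 0" and s: "s \<ge> 0" and V_pos: "KK n 0 - KK m 0 > 0"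
begin

definition V :: real where "V = KK n 0 - KK m 0"
definition S :: "real \<Rightarrow> real" where "S t = KK n t - KK m t"
definition U :: "real \<Rightarrow> 'a \<Rightarrow> real" where "U h = lin (lv n) (cf (lv n - lv m) h)"
definition \<Delta> :: "nat \<Rightarrow> real \<Rightarrow> 'a \<Rightarrow> real" where "\<Delta> j h = lin (lv n) (cf (lv n - lv (n - real j)) h)"
definition R :: "real \<Rightarrow> 'a \<Rightarrow> real" where "R h = lin (lv n) (cf (lv m) h)"
text \<open>The barrier is imposed only from \<open>j0\<close> scales on, where the bounded errors
  in the variances are negligible against j, and down to the scale \<open>m\<close> below which
  \<open>U\<close> has no primes.\<close>

definition J :: "nat set" where "J = {j. j0 \<le> j \<and> real j \<le> n - m}"
definition q :: real where "q = prob {\<omega>\<in>space M. U 0 \<omega> \<in> {x..x+1}}"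
text \<open>The window pins \<open>U\<close> so that its probability \<open>q\<close> is the same at
  every h; the last clause makes the whole field at least \<open>x - s\<close> at a good
  point.\<close>

definition good :: "real \<Rightarrow> 'a \<Rightarrow> bool" where
  "good h \<omega> \<longleftrightarrow> U h \<omega> \<in> {x..x+1} \<and> (\<forall>j\<in>J. \<Delta> j h \<omega> \<ge> \<gamma> * real j) \<and> R h \<omega> \<ge> - s"

lemma V0: "V > 0" using V_pos by (simp add: V_def)

lemma finite_J [simp, intro]: "finite J"
proof (rule finite_subset)
  show "J \<subseteq> {..nat \<lfloor>n\<rfloor>}" using m by (auto simp: J_def le_nat_floor)
qed auto

lemma rv [measurable]: "U h \<in> borel_measurable M" "\<Delta> j h \<in> borel_measurable M" "R h \<in> borel_measurable M"
  unfolding U_def \<Delta>_def R_def by (rule lin_measurable[OF lv_prime])+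

lemma good_sets [measurable]: "{\<omega>\<in>space M. good h \<omega>} \<in> sets M"
proof -
  have "{\<omega>\<in>space M. U h \<omega> \<in> {x..x+1} \<and> (\<forall>j\<in>J. \<Delta> j h \<omega> \<ge> \<gamma> * real j) \<and> R h \<omega> \<ge> - s} \<in> sets M"
    by measurable
  thus ?thesis by (simp add: good_def)
qed

lemma nsq_U: "nsq (lv n) (cf (lv n - lv m) h) = V"
  unfolding nsq_eq_inn using inn_lv[of m n n "lv n - lv m" "lv n - lv m" h h] m by (simp add: V_def)

lemma inn_U: "inn (lv n) (cf (lv n - lv m) h) (cf (lv n - lv m) h') = S (h - h')"
  using inn_lv[of m n n "lv n - lv m" "lv n - lv m" h h'] m by (simp add: S_def)

lemma prob_U: "prob {\<omega>\<in>space M. U h \<omega> \<in> {x..x+1}} = q"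
proof -
  have "emeasure M {\<omega>\<in>space M. U h \<omega> \<in> {x..x+1}} = emeasure M {\<omega>\<in>space M. U 0 \<omega> \<in> {x..x+1}}"
    unfolding U_def using V0 by (subst (1 2) emeasure_lin[OF lv_prime]) (simp_all add: nsq_U)
  thus ?thesis by (simp add: q_def emeasure_eq_measure)
qed

lemma q_ge: "q \<ge> exp (- (x + 1)\<^sup>2 / V) / sqrt (pi * V)"
  using prob_lin_window_ge[OF lv_prime, of n "cf (lv n - lv m) 0" "V / 2" x] V0 x
  by (simp add: nsq_U q_def U_def)

lemma q_pos: "q > 0"
  using q_ge V0 by (smt (verit) divide_pos_pos exp_gt_zero mult_pos_pos pi_gt_zero real_sqrt_gt_zero)

lemma window_tail:
  assumes k: "inn (lv n) (cf (lv n - lv m) h) d = \<kappa>" and c: "\<And>u. u \<in> {x..x+1} \<Longrightarrow> \<kappa> / V * u \<le> c"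
    and w: "nsq (lv n) d \<le> w" "w > 0" and y: "y - c \<ge> 0"
  shows "prob {\<omega>\<in>space M. U h \<omega> \<in> {x..x+1} \<and> lin (lv n) d \<omega> \<ge> y} \<le> q * exp (- (y - c)\<^sup>2 / w)"
  using prob_lin_window_and_tail_le[OF lv_prime, of n "cf (lv n - lv m) h" "V / 2" d "\<kappa> / 2" x c w y] assms V0 prob_U[of h]
  by (simp add: nsq_U flip: U_def)

text \<open>Given U h in the window, the conditional mean of \<open>\<Delta> j h\<close> is at least
  its share of the variance times x, which by assumption lies \<eta> j above the barrier. Each
  clause of \<open>good\<close> fails with a Gaussian tail relative to \<open>q\<close>, and these
  are summed; \<open>R h\<close> is uncorrelated with \<open>U h\<close> since the primes are
  disjoint.\<close>

lemma first_moment: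
  assumes \<eta>: "\<eta> > 0" "\<And>j. j \<in> J \<Longrightarrow> (KK n 0 - KK (n - real j) 0) / V * x - \<gamma> * real j \<ge> \<eta> * real j"
  shows "prob {\<omega>\<in>space M. good h \<omega>} \<ge> q * (1 - ((\<Sum>j\<in>J. exp (- (\<eta> * real j)\<^sup>2 / (real j + 40))) + exp (- s\<^sup>2 / (m + 20))))"
proof -
  let ?W = "\<lambda>\<omega>. U h \<omega> \<in> {x..x+1}"
  have 1: "prob {\<omega>\<in>space M. ?W \<omega> \<and> - \<Delta> j h \<omega> \<ge> - (\<gamma> * real j)} \<le> q * exp (- (\<eta> * real j)\<^sup>2 / (real j + 40))"
    if j: "j \<in> J" for j
  proof -
    define k where "k = n - real j"
    have k: "m \<le> k" "k \<le> n" "0 \<le> k" using j m by (auto simp: J_def k_def)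
    define Vk where "Vk = KK n 0 - KK k 0"
    have Vk: "Vk \<ge> 0" "Vk \<le> real j + 40"
      using KK_mono_0[OF k(2)] KK_0_asymp[of n] KK_0_asymp[of k] k by (auto simp: Vk_def k_def abs_le_iff)
    let ?d = "\<lambda>i. - cf (lv n - lv k) h i"
    have "(lv n - lv m) \<inter> (lv n - lv k) = lv n - lv k" using lv_mono[OF k(1)] by auto
    hence inn: "inn (lv n) (cf (lv n - lv m) h) ?d = - Vk"
      using inn_lv[of k n n "lv n - lv m" "lv n - lv k" h h] k by (simp add: inn_uminus Vk_def)
    have nsq: "nsq (lv n) ?d = Vk"
      unfolding nsq_uminus nsq_eq_inn using inn_lv[of k n n "lv n - lv k" "lv n - lv k" h h] k by (simp add: Vk_def)
    have y: "- (\<gamma> * real j) - (- (Vk / V * x)) \<ge> \<eta> * real j" using \<eta>(2)[OF j] by (simp add: Vk_def k_def)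
    have "prob {\<omega>\<in>space M. ?W \<omega> \<and> lin (lv n) ?d \<omega> \<ge> - (\<gamma> * real j)}
      \<le> q * exp (- (- (\<gamma> * real j) - (- (Vk / V * x)))\<^sup>2 / (real j + 40))"
    proof (rule window_tail[OF inn])
      show "- Vk / V * u \<le> - (Vk / V * x)" if "u \<in> {x..x+1}" for u
        using that Vk V0 by (simp add: mult_left_mono divide_right_mono)
      show "0 \<le> - (\<gamma> * real j) - (- (Vk / V * x))" using y \<eta>(1) by (smt (verit) mult_nonneg_nonneg of_nat_0_le_iff)
    qed (use nsq Vk in auto)
    also have "\<dots> \<le> q * exp (- (\<eta> * real j)\<^sup>2 / (real j + 40))"
    proof -
      have "(\<eta> * real j)\<^sup>2 \<le> (- (\<gamma> * real j) - (- (Vk / V * x)))\<^sup>2" using y \<eta>(1) by (intro power_mono) auto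
      hence "- (- (\<gamma> * real j) - (- (Vk / V * x)))\<^sup>2 / (real j + 40) \<le> - (\<eta> * real j)\<^sup>2 / (real j + 40)"
        by (intro divide_right_mono) auto
      thus ?thesis using q_pos by (intro mult_left_mono) (auto simp only: exp_le_cancel_iff)
    qed
    finally show ?thesis by (simp add: lin_uminus \<Delta>_def k_def)
  qed
  have 2: "prob {\<omega>\<in>space M. ?W \<omega> \<and> - R h \<omega> \<ge> s} \<le> q * exp (- s\<^sup>2 / (m + 20))"
  proof -
    let ?d = "\<lambda>i. - cf (lv m) h i"
    have inn: "inn (lv n) (cf (lv n - lv m) h) ?d = 0"
    proof -
      have "(lv n - lv m) \<inter> lv m = lv m - lv m" by auto
      from inn_lv[OF order_refl m(2) this, of h h] show ?thesis by (simp add: inn_uminus)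
    qed
    have "nsq (lv n) ?d = inn (lv n) (cf (lv m) h) (cf (lv m) h)"
      unfolding nsq_uminus nsq_eq_inn ..
    also have "\<dots> = (\<Sum>p\<in>lv m. cos (0 * ln (real p)) / real p)"
      using lv_mono[OF m(2)] lv_pos by (subst inn_cf) auto
    also have "\<dots> = KK m 0" by (simp only: KK_alt)
    also have "\<dots> \<le> m + 20" using KK_0_asymp[OF m(1)] by (simp add: abs_le_iff)
    finally have nsq: "nsq (lv n) ?d \<le> m + 20" .
    have "prob {\<omega>\<in>space M. ?W \<omega> \<and> lin (lv n) ?d \<omega> \<ge> s} \<le> q * exp (- (s - 0)\<^sup>2 / (m + 20))"
      by (rule window_tail[OF inn]) (use nsq m s in auto)
    thus ?thesis by (simp add: lin_uminus R_def)
  qed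
  let ?A = "{\<omega>\<in>space M. good h \<omega>}"
  let ?B = "\<lambda>j. {\<omega>\<in>space M. ?W \<omega> \<and> - \<Delta> j h \<omega> \<ge> - (\<gamma> * real j)}"
  let ?C = "{\<omega>\<in>space M. ?W \<omega> \<and> - R h \<omega> \<ge> s}"
  have sub: "{\<omega>\<in>space M. ?W \<omega>} \<subseteq> ?A \<union> (\<Union>j\<in>J. ?B j) \<union> ?C"
    by (auto simp: good_def not_le intro: less_imp_le)
  have "q = prob {\<omega>\<in>space M. ?W \<omega>}" by (rule prob_U[symmetric])
  also have "\<dots> \<le> prob (?A \<union> (\<Union>j\<in>J. ?B j) \<union> ?C)" by (intro finite_measure_mono sub) measurable
  also have "\<dots> \<le> prob (?A \<union> (\<Union>j\<in>J. ?B j)) + prob ?C" by (intro measure_subadditive) (auto simp: fmeasurable_def emeasure_eq_measure)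
  also have "prob (?A \<union> (\<Union>j\<in>J. ?B j)) \<le> prob ?A + prob (\<Union>j\<in>J. ?B j)" by (intro measure_subadditive) (auto simp: fmeasurable_def emeasure_eq_measure)
  also have "prob (\<Union>j\<in>J. ?B j) \<le> (\<Sum>j\<in>J. prob (?B j))" by (intro finite_measure_subadditive_finite) auto
  also have "\<dots> \<le> (\<Sum>j\<in>J. q * exp (- (\<eta> * real j)\<^sup>2 / (real j + 40)))" by (intro sum_mono 1)
  also note 2
  finally show ?thesis by (simp add: sum_distrib_left algebra_simps)
qed

text \<open>For \<open>h\<close> and \<open>h'\<close> at distance about \<open>exp (j - n)\<close>, the first \<open>n - j\<close> scales of \<open>U h\<close> and \<open>U h'\<close>
  nearly agree, so that \<open>U h'\<close> minus these scales of \<open>U h\<close> is almost uncorrelated with \<open>U h\<close>.\<close>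
lemma pair_near:
  assumes j: "j \<in> J" and t: "exp (- (n - real j + 1)) \<le> \<bar>h - h'\<bar>" "\<bar>h - h'\<bar> \<le> exp (- (n - real j))"
    and c: "42 * (x + 1) / V \<le> c" "c + 1 \<le> \<gamma> * real j"
  shows "prob {\<omega>\<in>space M. good h \<omega> \<and> good h' \<omega>} \<le> q * exp (- (\<gamma> * real j - 1 - c)\<^sup>2 / (real j + 42))"
proof -
  define k where "k = n - real j"
  define t where "t = h - h'"
  have k: "m \<le> k" "k \<le> n" "0 \<le> k" using j m by (auto simp: J_def k_def)
  have t0: "t \<noteq> 0" using assms(2) by (auto simp: t_def simp flip: exp_zero)
  have tk: "\<bar>t\<bar> \<le> exp (- k)" and tk1: "exp (- (k + 1)) \<le> \<bar>t\<bar>" using assms(2,3) by (auto simp: t_def k_def)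
  have t1: "\<bar>t\<bar> \<le> 1" using tk k(3) by (meson exp_le_one_iff neg_le_0_iff_le order_trans)
  have tm: "\<bar>t\<bar> \<le> exp (- m)" using tk k(1) by (smt (verit) exp_le_cancel_iff)
  have lnt: "- ln \<bar>t\<bar> \<le> k + 1"
  proof -
    have "ln (exp (- (k + 1))) \<le> ln \<bar>t\<bar>" using tk1 t0 by (subst ln_le_cancel_iff) auto
    thus ?thesis by simp
  qed
  let ?a = "cf (lv n - lv m) h" and ?b = "cf (lv n - lv m) h'" and ?w = "cf (lv k - lv m) h"
  \<comment> \<open>The form with coefficients d is U h' minus the first n - j scales of U h. On the
    event both U h and U h' lie in the unit window and \<Delta> j h \<ge> \<gamma> j, so it is at
    least \<gamma> j - 1.\<close>
  define d where "d = (\<lambda>i. ?b i - of_real 1 * ?w i)"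
  have int: "(lv n - lv m) \<inter> (lv k - lv m) = lv k - lv m" using lv_mono[OF k(2)] by auto
  have inn_aw: "inn (lv n) ?a ?w = KK k 0 - KK m 0" using inn_lv[OF k(1,2) int, of h h] by simp
  have wb: "inn (lv n) ?w ?b = KK k t - KK m t"
    using inn_lv[OF k(1,2), of "lv k - lv m" "lv n - lv m" h h'] int by (simp add: t_def Int_commute)
  have ww: "nsq (lv n) ?w = KK k 0 - KK m 0"
    unfolding nsq_eq_inn using inn_lv[OF k(1,2), of "lv k - lv m" "lv k - lv m" h h] by simp
  have Kk: "KK k t \<ge> KK k 0 - 1" by (rule KK_ge[OF k(3) tk])
  have Km: "KK m t \<ge> KK m 0 - 1" by (rule KK_ge[OF m(1) tm])
  have Km': "KK m t \<le> KK m 0" using KK_abs_le[of m t] by linarith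
  have Kn: "KK n t \<le> 20 + (k + 1)" using KK_le_small[of n t] t0 t1 m lnt by linarith
  have K0: "KK n 0 \<le> n + 20" "KK k 0 \<ge> k - 20" using KK_0_asymp[of n] KK_0_asymp[of k] k by (auto simp: abs_le_iff)
  \<comment> \<open>42 is twice the Mertens error 20 plus twice the error 1 of \<open>KK_ge\<close>.
    The covariance bound below has the same value: 20 + 1 from \<open>KK n t\<close>, 20 from
    \<open>KK k 0\<close> and 1 from \<open>KK m t\<close>.\<close>
  have nd: "nsq (lv n) d \<le> real j + 42"
    unfolding d_def nsq_diff wb ww nsq_U using Kk Km' K0 by (simp add: V_def k_def)
  have "inn (lv n) ?a d = S t - (KK k 0 - KK m 0)"
    unfolding d_def inn_minus_right inn_U inn_aw by (simp add: t_def)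
  also have "\<dots> \<le> 42" using Kn K0 Km unfolding S_def by linarith
  finally have id: "inn (lv n) ?a d \<le> 42" .
  have dc: "inn (lv n) ?a d / V * u \<le> c" if u: "u \<in> {x..x+1}" for u
  proof -
    have "inn (lv n) ?a d / V * u \<le> 42 / V * u" using id V0 u x by (intro mult_right_mono divide_right_mono) auto
    also have "\<dots> \<le> 42 / V * (x + 1)" using V0 u by (intro mult_left_mono) auto
    also have "\<dots> \<le> c" using c(1) by simp
    finally show ?thesis .
  qed
  have disj: "lv n - lv m = (lv k - lv m) \<union> (lv n - lv k)" using lv_mono[OF k(1)] lv_mono[OF k(2)] by auto
  have Uw: "U h \<omega> = lin (lv n) ?w \<omega> + \<Delta> j h \<omega>" for \<omega>
    unfolding U_def \<Delta>_def k_def[symmetric] by (subst disj, subst cf_Un) auto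
  have ld: "lin (lv n) d \<omega> = U h' \<omega> - (U h \<omega> - \<Delta> j h \<omega>)" for \<omega>
    unfolding d_def lin_diff Uw by (simp add: U_def)
  have "prob {\<omega>\<in>space M. good h \<omega> \<and> good h' \<omega>} \<le> prob {\<omega>\<in>space M. U h \<omega> \<in> {x..x+1} \<and> lin (lv n) d \<omega> \<ge> \<gamma> * real j - 1}"
  proof (intro finite_measure_mono)
    show "{\<omega>\<in>space M. good h \<omega> \<and> good h' \<omega>} \<subseteq> {\<omega>\<in>space M. U h \<omega> \<in> {x..x+1} \<and> lin (lv n) d \<omega> \<ge> \<gamma> * real j - 1}"
    proof
      fix \<omega> assume \<omega>: "\<omega> \<in> {\<omega>\<in>space M. good h \<omega> \<and> good h' \<omega>}"
      hence "U h \<omega> \<in> {x..x+1}" "U h' \<omega> \<in> {x..x+1}" "\<Delta> j h \<omega> \<ge> \<gamma> * real j" using j by (auto simp: good_def)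
      thus "\<omega> \<in> {\<omega>\<in>space M. U h \<omega> \<in> {x..x+1} \<and> lin (lv n) d \<omega> \<ge> \<gamma> * real j - 1}" using \<omega> by (simp add: ld)
    qed
    have [measurable]: "lin (lv n) d \<in> borel_measurable M" by (rule lin_measurable[OF lv_prime])
    show "{\<omega>\<in>space M. U h \<omega> \<in> {x..x+1} \<and> lin (lv n) d \<omega> \<ge> \<gamma> * real j - 1} \<in> events" by measurable
  qed
  also have "\<dots> \<le> q * exp (- (\<gamma> * real j - 1 - c)\<^sup>2 / (real j + 42))"
    by (rule window_tail[OF refl dc nd]) (use c in auto)
  finally show ?thesis .
qed

lemma pair_le_q: "prob {\<omega>\<in>space M. good h \<omega> \<and> good h' \<omega>} \<le> q"
  unfolding prob_U[of h, symmetric] by (intro finite_measure_mono) (auto simp: good_def)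

lemma pair_le_UU:
  "prob {\<omega>\<in>space M. good h \<omega> \<and> good h' \<omega>} \<le> prob {\<omega>\<in>space M. U h \<omega> \<in> {x..x+1} \<and> U h' \<omega> \<in> {x..x+1}}"
  by (intro finite_measure_mono) (auto simp: good_def)

text \<open>If (x + 1) / V stays bounded and d0 tends to 0, the factor in front of q^2 tends to 1:
  such pairs are asymptotically independent, as the second moment requires.\<close>

lemma pair_far_good:
  assumes d0: "\<bar>S (h - h')\<bar> \<le> d0" "d0 < V"
  shows "prob {\<omega>\<in>space M. good h \<omega> \<and> good h' \<omega>} \<le> exp (2 * d0 * (x + 1)\<^sup>2 / V\<^sup>2) / sqrt (1 - (d0 / V)\<^sup>2) * q\<^sup>2"
proof -
  define \<rho> where "\<rho> = S (h - h') / V"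
  have d00: "d0 \<ge> 0" using d0(1) by linarith
  have \<rho>: "\<bar>\<rho>\<bar> \<le> d0 / V" using d0(1) V0 by (simp add: \<rho>_def abs_divide divide_right_mono)
  have dV: "0 \<le> d0 / V" "d0 / V < 1" "\<bar>S (h - h')\<bar> < V" using d0 d00 V0 by auto
  have "prob {\<omega>\<in>space M. U h \<omega> \<in> {x..x+1} \<and> U h' \<omega> \<in> {x..x+1}}
     \<le> exp (max 0 \<rho> * (x + 1)\<^sup>2 / (V / 2)) / sqrt (1 - \<rho>\<^sup>2) * q * q"
    using prob_lin_window_window_le[OF lv_prime, of n "cf (lv n - lv m) h" "V / 2" "cf (lv n - lv m) h'" \<rho> x]
      V0 x \<rho> dV prob_U[of h] prob_U[of h'] by (simp add: nsq_U inn_U \<rho>_def flip: U_def)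
  also have "\<dots> \<le> exp (2 * d0 * (x + 1)\<^sup>2 / V\<^sup>2) / sqrt (1 - (d0 / V)\<^sup>2) * q * q"
  proof (intro mult_right_mono frac_le)
    have "max 0 \<rho> \<le> d0 / V" using \<rho> dV by linarith
    hence "max 0 \<rho> * ((x + 1)\<^sup>2 / (V / 2)) \<le> d0 / V * ((x + 1)\<^sup>2 / (V / 2))" using V0 by (intro mult_right_mono) auto
    also have "\<dots> = 2 * d0 * (x + 1)\<^sup>2 / V\<^sup>2" by (simp add: power2_eq_square)
    finally show "exp (max 0 \<rho> * (x + 1)\<^sup>2 / (V / 2)) \<le> exp (2 * d0 * (x + 1)\<^sup>2 / V\<^sup>2)" by simp
    have "\<bar>\<rho>\<bar>\<^sup>2 \<le> (d0 / V)\<^sup>2" using \<rho> by (intro power_mono) auto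
    hence "\<rho>\<^sup>2 \<le> (d0 / V)\<^sup>2" by simp
    thus "sqrt (1 - (d0 / V)\<^sup>2) \<le> sqrt (1 - \<rho>\<^sup>2)" by simp
    have "\<bar>d0 / V\<bar> < 1" using dV by linarith
    hence "(d0 / V)\<^sup>2 < 1" by (simp only: abs_square_less_1)
    thus "0 < sqrt (1 - (d0 / V)\<^sup>2)" by simp
  qed (use q_pos in auto)
  finally show ?thesis using pair_le_UU[of h h'] by (simp add: power2_eq_square)
qed

text \<open>The correlation may be close to \<open>-1\<close> here, which rules out \<open>pair_far_good\<close>; the bound is only used
  on a set of pairs of tiny measure.\<close>
lemma pair_far_bad:
  assumes B: "S (h - h') \<le> B" "B \<ge> 0" "B * (x + 1) / V \<le> x"
  shows "prob {\<omega>\<in>space M. good h \<omega> \<and> good h' \<omega>} \<le> q * exp (- (x - B * (x + 1) / V)\<^sup>2 / V)"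
proof -
  have "prob {\<omega>\<in>space M. good h \<omega> \<and> good h' \<omega>} \<le> prob {\<omega>\<in>space M. U h \<omega> \<in> {x..x+1} \<and> U h' \<omega> \<ge> x}"
    by (intro finite_measure_mono) (auto simp: good_def)
  also have "\<dots> \<le> q * exp (- (x - B * (x + 1) / V)\<^sup>2 / V)"
    unfolding U_def[of h']
  proof (rule window_tail[OF inn_U])
    fix u assume u: "u \<in> {x..x+1}"
    have "S (h - h') / V * u \<le> B / V * u" using B(1) V0 u x by (intro mult_right_mono divide_right_mono) auto
    also have "\<dots> \<le> B / V * (x + 1)" using V0 u B by (intro mult_left_mono) auto
    finally show "S (h - h') / V * u \<le> B * (x + 1) / V" by simp
  qed (use V0 B nsq_U in auto)
  finally show ?thesis .
qed

end

context prime_gaussian_scales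
begin

lemma S_eq_sum: "S t = (\<Sum>p\<in>lv n - lv m. cos (t * ln (real p)) / real p)"
  using sum_lv_diff[OF m(2), of t] by (simp add: S_def)

lemma S_abs_le: "\<bar>S t\<bar> \<le> V"
proof -
  have "\<bar>S t\<bar> \<le> (\<Sum>p\<in>lv n - lv m. \<bar>cos (t * ln (real p)) / real p\<bar>)" unfolding S_eq_sum by (rule sum_abs)
  also have "\<dots> \<le> (\<Sum>p\<in>lv n - lv m. cos (0 * ln (real p)) / real p)" by (intro sum_mono) (auto intro!: divide_right_mono)
  also have "\<dots> = V" using sum_lv_diff[OF m(2), of 0] by (simp add: V_def)
  finally show ?thesis .
qed

lemma S_measurable [measurable]: "S \<in> borel_measurable borel"
  unfolding S_eq_sum[abs_def] by measurable

definition mean_sq_bound :: "real \<Rightarrow> real" where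
  "mean_sq_bound H = V\<^sup>2 / H + 12 * V / sqrt H + 6 / exp (exp m)"

lemma nn_integral_S_sq_le:
  assumes H: "H \<ge> 1"
  shows "(\<integral>\<^sup>+h. \<integral>\<^sup>+h'. ennreal ((S (h - h'))\<^sup>2) \<partial>unif H \<partial>unif H) \<le> ennreal (mean_sq_bound H)"
proof -
  have H0: "H > 0" using H by simp
  interpret U: prob_space "unif H" by (rule prob_space_unif[OF H0])
  have S2: "(S t)\<^sup>2 \<le> V\<^sup>2" for t using S_abs_le[of t] V0 by (simp add: abs_le_square_iff[symmetric])
  have i: "integrable (unif H) (\<lambda>h'. (S (h - h'))\<^sup>2)" for h
    by (rule integrable_unif_bounded[of _ _ "V\<^sup>2"]) (use H0 S2 in auto)
  have inner: "(\<integral>\<^sup>+h'. ennreal ((S (h - h'))\<^sup>2) \<partial>unif H) = ennreal (LINT h'|unif H. (S (h - h'))\<^sup>2)" for h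
    by (intro nn_integral_eq_integral i) auto
  have bnd: "\<bar>LINT h'|unif H. (S (h - h'))\<^sup>2\<bar> \<le> V\<^sup>2" for h
  proof -
    have "(LINT h'|unif H. (S (h - h'))\<^sup>2) \<le> (LINT h'|unif H. V\<^sup>2)" by (intro integral_mono i S2) auto
    also have "\<dots> = V\<^sup>2" using U.prob_space by simp
    finally show ?thesis by (simp add: abs_of_nonneg)
  qed
  have "(\<lambda>h. LINT h'|unif H. (S (h - h'))\<^sup>2) \<in> borel_measurable borel"
    by (intro U.borel_measurable_lebesgue_integral) measurable
  hence io: "integrable (unif H) (\<lambda>h. LINT h'|unif H. (S (h - h'))\<^sup>2)"
    by (intro integrable_unif_bounded[of _ _ "V\<^sup>2"] H0 bnd)
  have "(\<integral>\<^sup>+h. \<integral>\<^sup>+h'. ennreal ((S (h - h'))\<^sup>2) \<partial>unif H \<partial>unif H) = ennreal (LINT h|unif H. LINT h'|unif H. (S (h - h'))\<^sup>2)"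
    unfolding inner by (intro nn_integral_eq_integral io) auto
  also have "\<dots> \<le> ennreal (mean_sq_bound H)"
  proof (rule ennreal_leI)
    have V1: "(\<Sum>p\<in>lv n - lv m. 1 / real p) = V"
      using sum_lv_diff[OF m(2), of 0] by (simp add: V_def)
    have "(LINT h|unif H. LINT h'|unif H. (S (h - h'))\<^sup>2)
      \<le> (\<Sum>p\<in>lv n - lv m. 1 / real p)\<^sup>2 / H + 12 * (\<Sum>p\<in>lv n - lv m. 1 / real p) / sqrt H + 6 / exp (exp m)"
      unfolding S_eq_sum
      by (rule mean_square_prime_sum_le[OF H, of "exp (exp m)" _ "exp (exp n)"]) (auto simp: lv_def)
    thus "(LINT h|unif H. LINT h'|unif H. (S (h - h'))\<^sup>2) \<le> mean_sq_bound H" by (simp add: mean_sq_bound_def V1)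
  qed
  finally show ?thesis .
qed

text \<open>Removing the scales up to m can raise the covariance by at most m + 20, because
  \<open>KK m t\<close> may be negative. The full kernel is at most 21 + m for distances up to 1 and
  doubly logarithmic beyond.\<close>

lemma S_far_le:
  assumes t: "exp (- (m + 1)) \<le> \<bar>t\<bar>" "\<bar>t\<bar> \<le> 2 * H"
    and B: "41 + 2 * m \<le> B" "40 + m + ln (ln (2 * H + 2)) \<le> B"
  shows "S t \<le> B"
proof -
  have t0: "t \<noteq> 0" using t(1) exp_gt_zero[of "- (m + 1)"] by auto
  have km: "- KK m t \<le> m + 20"
    using KK_abs_le[of m t] KK_0_asymp[OF m(1)] by (simp add: abs_le_iff)
  show ?thesis
  proof (cases "\<bar>t\<bar> \<le> 1")
    case True
    have "ln (exp (- (m + 1))) \<le> ln \<bar>t\<bar>" using t t0 by (subst ln_le_cancel_iff) auto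
    hence "- ln \<bar>t\<bar> \<le> m + 1" by simp
    moreover have "KK n t \<le> 20 - ln \<bar>t\<bar>" using m t0 True by (intro KK_le_small) auto
    ultimately show ?thesis using km B(1) unfolding S_def by linarith
  next
    case False
    have "KK n t \<le> 20 + ln (ln (\<bar>t\<bar> + 2))" using m False by (intro KK_le_large) auto
    also have "ln (ln (\<bar>t\<bar> + 2)) \<le> ln (ln (2 * H + 2))"
      using t(2) False by (subst ln_le_cancel_iff) auto
    finally show ?thesis using km B(2) unfolding S_def by linarith
  qed
qed

text \<open>Upper bound for the cost of a second good point at distance about exp (j - n), relative
  to \<open>q\<close>; \<open>far_factor\<close> is relative to q^2, and \<open>bad_factor\<close>
  again to \<open>q\<close>.\<close>

definition near_factor :: "real \<Rightarrow> nat \<Rightarrow> real" where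
  "near_factor c j = exp (- (\<gamma> * real j - 1 - c)\<^sup>2 / (real j + 42))"

definition far_factor :: "real \<Rightarrow> real" where
  "far_factor d0 = exp (2 * d0 * (x + 1)\<^sup>2 / V\<^sup>2) / sqrt (1 - (d0 / V)\<^sup>2)"

definition bad_factor :: "real \<Rightarrow> real" where
  "bad_factor B = exp (- (x - B * (x + 1) / V)\<^sup>2 / V)"

lemma far_factor_nonneg:
  assumes "0 < d0" "d0 < V" shows "far_factor d0 \<ge> 0"
proof -
  have "\<bar>d0 / V\<bar> < 1" using assms by simp
  hence "(d0 / V)\<^sup>2 < 1" by (simp add: abs_square_less_1)
  thus ?thesis by (simp add: far_factor_def)
qed

text \<open>Pairs within exp (j0 - n) get the trivial bound q, intermediate ones the barrier
  estimate at their scale, and distant ones are split by whether |S| \<le> d0. For the exceptional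
  distant pairs the indicator is replaced by the larger S^2 / d0^2, so that integration over the
  pairs brings in the mean square.\<close>

lemma pair_le:
  assumes t: "\<bar>h - h'\<bar> \<le> 2 * H"
    and c: "42 * (x + 1) / V \<le> c" "\<And>j. j \<in> J \<Longrightarrow> c + 1 \<le> \<gamma> * real j"
    and d0: "0 < d0" "d0 < V"
    and B: "41 + 2 * m \<le> B" "40 + m + ln (ln (2 * H + 2)) \<le> B" "B * (x + 1) / V \<le> x"
  shows "prob {\<omega>\<in>space M. good h \<omega> \<and> good h' \<omega>}
     \<le> q * indicator {h'. \<bar>h - h'\<bar> \<le> exp (- (n - real j0))} h'
       + (\<Sum>j\<in>J. q * near_factor c j * indicator {h'. \<bar>h - h'\<bar> \<le> exp (- (n - real j))} h')
       + far_factor d0 * q\<^sup>2 + q * bad_factor B / d0\<^sup>2 * (S (h - h'))\<^sup>2"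
    (is "?P \<le> ?a + ?b + ?c + ?d")
proof -
  have nn: "?a \<ge> 0" "?b \<ge> 0" "?c \<ge> 0" "?d \<ge> 0"
    using q_pos far_factor_nonneg[OF d0]
    by (auto simp: near_factor_def bad_factor_def intro!: sum_nonneg mult_nonneg_nonneg)
  define t where "t = h - h'"
  consider "\<bar>t\<bar> \<le> exp (- (n - real j0))" | "exp (- (m + 1)) \<le> \<bar>t\<bar>"
    | "exp (- (n - real j0)) < \<bar>t\<bar>" "\<bar>t\<bar> < exp (- (m + 1))" by linarith
  thus ?thesis
  proof cases
    case 1
    hence "?P \<le> ?a" using pair_le_q[of h h'] by (simp add: t_def)
    thus ?thesis using nn by linarith
  next
    case 2
    show ?thesis
    proof (cases "\<bar>S t\<bar> \<le> d0")
      case True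
      hence "?P \<le> ?c" unfolding far_factor_def using pair_far_good[of h h' d0] d0 by (simp add: t_def)
      thus ?thesis using nn by linarith
    next
      case False
      have "S t \<le> B" using 2 assms(1) B by (intro S_far_le[where H = H]) (auto simp: t_def)
      hence "?P \<le> q * bad_factor B * 1" unfolding bad_factor_def using pair_far_bad[of h h' B] B m by (simp add: t_def)
      also have "\<dots> \<le> q * bad_factor B * ((S t)\<^sup>2 / d0\<^sup>2)"
      proof (intro mult_left_mono)
        have "d0\<^sup>2 \<le> \<bar>S t\<bar>\<^sup>2" using False d0 by (intro power_mono) auto
        thus "1 \<le> (S t)\<^sup>2 / d0\<^sup>2" using d0 by simp
      qed (use q_pos in \<open>auto simp: bad_factor_def\<close>)
      finally have "?P \<le> ?d" by (simp add: t_def)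
      thus ?thesis using nn by linarith
    qed
  next
    case 3
    have t0: "\<bar>t\<bar> > 0" using 3(1) exp_gt_zero[of "- (n - real j0)"] by linarith
    \<comment> \<open>The distance is exp (y - n), and j is y rounded up. The far case starts at exp
      (- (m + 1)) and not at exp (- m), so that rounding up still leaves j \<le> n - m, as
      membership in \<open>J\<close> demands.\<close>
    define y where "y = n + ln \<bar>t\<bar>"
    have et: "\<bar>t\<bar> = exp (y - n)" using t0 by (simp add: y_def)
    have y: "real j0 < y" "y < n - m - 1" using 3 unfolding et by auto
    define j where "j = nat \<lceil>y\<rceil>"
    have jy: "y \<le> real j" "real j < y + 1" using y unfolding j_def by linarith+
    have j: "j \<in> J" using jy y by (auto simp: J_def)
    have "?P \<le> q * near_factor c j"
      unfolding near_factor_def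
    proof (rule pair_near[OF j])
      show "exp (- (n - real j + 1)) \<le> \<bar>h - h'\<bar>" "\<bar>h - h'\<bar> \<le> exp (- (n - real j))"
        using jy unfolding t_def[symmetric] et by auto
      show "c + 1 \<le> \<gamma> * real j" using c(2)[OF j] .
    qed (rule c)
    also have "\<dots> = q * near_factor c j * indicator {h'. \<bar>h - h'\<bar> \<le> exp (- (n - real j))} h'"
      using jy unfolding indicator_def mem_Collect_eq t_def[symmetric] et by simp
    also have "\<dots> \<le> ?b"
      using j q_pos by (intro member_le_sum) (auto simp: near_factor_def)
    finally show ?thesis using nn by linarith
  qed
qed

definition second_bound :: "real \<Rightarrow> real \<Rightarrow> real \<Rightarrow> real \<Rightarrow> real" where
  "second_bound H c d0 B = q * (exp (- (n - real j0)) / H) + (\<Sum>j\<in>J. q * near_factor c j * (exp (- (n - real j)) / H))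
      + far_factor d0 * q\<^sup>2 + q * bad_factor B / d0\<^sup>2 * mean_sq_bound H"

lemma second_moment:
  assumes H: "H \<ge> 1"
    and c: "42 * (x + 1) / V \<le> c" "\<And>j. j \<in> J \<Longrightarrow> c + 1 \<le> \<gamma> * real j"
    and d0: "0 < d0" "d0 < V"
    and B: "41 + 2 * m \<le> B" "40 + m + ln (ln (2 * H + 2)) \<le> B" "B * (x + 1) / V \<le> x"
  shows "(\<integral>\<^sup>+h. \<integral>\<^sup>+h'. emeasure M {\<omega>\<in>space M. good h \<omega> \<and> good h' \<omega>} \<partial>unif H \<partial>unif H)
    \<le> ennreal (second_bound H c d0 B)"
proof -
  have H0: "H > 0" using H by simp
  interpret U: prob_space "unif H" by (rule prob_space_unif[OF H0])
  define A where "A = (\<lambda>h r. {h'. \<bar>h - h'\<bar> \<le> r} :: real set)"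
  have [measurable]: "A h r \<in> sets borel" for h r unfolding A_def by measurable
  define r where "r = (\<lambda>j::nat. exp (- (n - real j)))"
  define ff where "ff = far_factor d0 * q\<^sup>2"
  define bf where "bf = q * bad_factor B / d0\<^sup>2"
  define nf where "nf = (\<lambda>j. q * near_factor c j)"
  have nn: "ff \<ge> 0" "bf \<ge> 0" "nf j \<ge> 0" "r j \<ge> 0" "q \<ge> 0" for j
    using q_pos far_factor_nonneg[OF d0] by (auto simp: ff_def bf_def nf_def r_def near_factor_def bad_factor_def)
  let ?I = "\<lambda>h. \<integral>\<^sup>+h'. ennreal ((S (h - h'))\<^sup>2) \<partial>unif H"
  have Im [measurable]: "?I \<in> borel_measurable borel"
    by (intro U.borel_measurable_nn_integral) measurable
  define K where "K = ennreal q * ennreal (r j0 / H) + (\<Sum>j\<in>J. ennreal (nf j) * ennreal (r j / H)) + ennreal ff"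
  have inner: "(\<integral>\<^sup>+h'. emeasure M {\<omega>\<in>space M. good h \<omega> \<and> good h' \<omega>} \<partial>unif H) \<le> K + ennreal bf * ?I h"
    if h: "\<bar>h\<bar> \<le> H" for h
  proof -
    have "(\<integral>\<^sup>+h'. emeasure M {\<omega>\<in>space M. good h \<omega> \<and> good h' \<omega>} \<partial>unif H)
      \<le> (\<integral>\<^sup>+h'. ennreal q * indicator (A h (r j0)) h' + (\<Sum>j\<in>J. ennreal (nf j) * indicator (A h (r j)) h')
            + ennreal ff + ennreal bf * ennreal ((S (h - h'))\<^sup>2) \<partial>unif H)"
    proof (rule nn_integral_mono_AE)
      show "AE h' in unif H. emeasure M {\<omega>\<in>space M. good h \<omega> \<and> good h' \<omega>}
         \<le> ennreal q * indicator (A h (r j0)) h' + (\<Sum>j\<in>J. ennreal (nf j) * indicator (A h (r j)) h')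
            + ennreal ff + ennreal bf * ennreal ((S (h - h'))\<^sup>2)"
        using AE_unif[OF H0]
      proof eventually_elim
        case (elim h')
        have "prob {\<omega>\<in>space M. good h \<omega> \<and> good h' \<omega>}
          \<le> q * indicator (A h (r j0)) h' + (\<Sum>j\<in>J. nf j * indicator (A h (r j)) h') + ff + bf * (S (h - h'))\<^sup>2"
          unfolding A_def r_def ff_def bf_def nf_def
          using h elim by (intro pair_le[OF _ c d0 B]) linarith
        hence "emeasure M {\<omega>\<in>space M. good h \<omega> \<and> good h' \<omega>}
          \<le> ennreal (q * indicator (A h (r j0)) h' + (\<Sum>j\<in>J. nf j * indicator (A h (r j)) h') + ff + bf * (S (h - h'))\<^sup>2)"
          by (simp add: emeasure_eq_measure ennreal_leI)
        also have "\<dots> = ennreal q * indicator (A h (r j0)) h' + (\<Sum>j\<in>J. ennreal (nf j) * indicator (A h (r j)) h')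
            + ennreal ff + ennreal bf * ennreal ((S (h - h'))\<^sup>2)"
        proof -
          have "ennreal (\<Sum>j\<in>J. nf j * indicator (A h (r j)) h') = (\<Sum>j\<in>J. ennreal (nf j) * indicator (A h (r j)) h')"
            using nn by (subst sum_ennreal[symmetric]) (auto simp: ennreal_mult ennreal_indicator)
          moreover have "0 \<le> (\<Sum>j\<in>J. nf j * indicator (A h (r j)) h')" using nn by (intro sum_nonneg) auto
          ultimately show ?thesis using nn by (simp add: ennreal_plus ennreal_mult ennreal_indicator)
        qed
        finally show ?case .
      qed
    qed
    also have "\<dots> = ennreal q * emeasure (unif H) (A h (r j0)) + (\<Sum>j\<in>J. ennreal (nf j) * emeasure (unif H) (A h (r j)))
            + ennreal ff + ennreal bf * ?I h"
      using U.emeasure_space_1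
      by (simp add: nn_integral_add nn_integral_sum nn_integral_cmult del: sum_mult_indicator)
    also have "\<dots> \<le> K + ennreal bf * ?I h"
      unfolding K_def A_def
      by (intro add_mono sum_mono mult_left_mono emeasure_unif_interval_le H0 nn order_refl) auto
    finally show ?thesis .
  qed
  have "(\<integral>\<^sup>+h. \<integral>\<^sup>+h'. emeasure M {\<omega>\<in>space M. good h \<omega> \<and> good h' \<omega>} \<partial>unif H \<partial>unif H)
    \<le> (\<integral>\<^sup>+h. K + ennreal bf * ?I h \<partial>unif H)"
    by (rule nn_integral_mono_AE) (use AE_unif[OF H0] inner in auto)
  also have "\<dots> = K + ennreal bf * (\<integral>\<^sup>+h. ?I h \<partial>unif H)"
    using U.emeasure_space_1 by (simp add: nn_integral_add nn_integral_cmult)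
  also have "\<dots> \<le> K + ennreal bf * ennreal (mean_sq_bound H)"
    by (intro add_mono mult_left_mono nn_integral_S_sq_le H) auto
  also have "\<dots> = ennreal (second_bound H c d0 B)"
  proof -
    have M0: "mean_sq_bound H \<ge> 0" using V0 H0 by (simp add: mean_sq_bound_def)
    have 1: "(\<Sum>j\<in>J. ennreal (nf j) * ennreal (r j / H)) = ennreal (\<Sum>j\<in>J. nf j * (r j / H))"
    proof -
      have "(\<Sum>j\<in>J. ennreal (nf j) * ennreal (r j / H)) = (\<Sum>j\<in>J. ennreal (nf j * (r j / H)))"
        using nn H0 by (intro sum.cong refl ennreal_mult[symmetric]) auto
      also have "\<dots> = ennreal (\<Sum>j\<in>J. nf j * (r j / H))"
        using nn H0 by (intro sum_ennreal) auto
      finally show ?thesis .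
    qed
    have 2: "0 \<le> (\<Sum>j\<in>J. nf j * (r j / H))" using nn H0 by (intro sum_nonneg) auto
    have "second_bound H c d0 B = q * (r j0 / H) + (\<Sum>j\<in>J. nf j * (r j / H)) + ff + bf * mean_sq_bound H"
      by (simp only: second_bound_def r_def nf_def ff_def bf_def)
    also have "ennreal \<dots> = ennreal (q * (r j0 / H)) + ennreal (\<Sum>j\<in>J. nf j * (r j / H)) + ennreal ff + ennreal (bf * mean_sq_bound H)"
      using nn 2 M0 H0 by (simp add: ennreal_plus)
    also have "\<dots> = K + ennreal bf * ennreal (mean_sq_bound H)"
      unfolding K_def 1 using nn M0 H0 by (simp only: ennreal_mult divide_nonneg_nonneg less_imp_le)
    finally show ?thesis by simp
  qed
  finally show ?thesis .
qed

lemma good_measurable_pair: "{z \<in> space (M \<Otimes>\<^sub>M unif H). good (snd z) (fst z)} \<in> sets (M \<Otimes>\<^sub>M unif H)"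
proof -
  have *: "(\<lambda>z. lin (lv n) (cf P (snd z)) (fst z)) \<in> borel_measurable (M \<Otimes>\<^sub>M unif H)" for P
    using lin_cf_measurable_pair[OF lv_prime, of n P]
    by (simp add: measurable_cong_sets[OF sets_pair_measure_cong[OF refl sets_unif] refl])
  note [measurable] = *
  show ?thesis unfolding good_def U_def \<Delta>_def R_def by measurable
qed

lemma X_T_eq: "X_T G (exp (exp n)) h \<omega> = U h \<omega> + R h \<omega>"
proof -
  have e: "lv n = (lv n - lv m) \<union> lv m" using lv_mono[OF m(2)] by auto
  have "X_T G (exp (exp n)) h \<omega> = lin (lv n) (cf (lv n) h) \<omega>"
    unfolding X_T_eq_lin lv_def ..
  also have "cf (lv n) h = cf ((lv n - lv m) \<union> lv m) h" by (rule arg_cong[OF e])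
  also have "lin (lv n) \<dots> \<omega> = U h \<omega> + R h \<omega>" unfolding U_def R_def by (rule cf_Un) auto
  finally show ?thesis .
qed

text \<open>By \<open>X_T_eq\<close> a good point has field value at least x - s, so on this event
  almost no h is good, and \<open>prob_no_hit_le\<close> applies with the set of good
  points.\<close>

lemma prob_max_small_le:
  assumes H: "H \<ge> 1"
    and c: "42 * (x + 1) / V \<le> c" "\<And>j. j \<in> J \<Longrightarrow> c + 1 \<le> \<gamma> * real j"
    and d0: "0 < d0" "d0 < V"
    and B: "41 + 2 * m \<le> B" "40 + m + ln (ln (2 * H + 2)) \<le> B" "B * (x + 1) / V \<le> x"
    and \<eta>: "\<eta> > 0" "\<And>j. j \<in> J \<Longrightarrow> (KK n 0 - KK (n - real j) 0) / V * x - \<gamma> * real j \<ge> \<eta> * real j"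
    and e1: "(\<Sum>j\<in>J. exp (- (\<eta> * real j)\<^sup>2 / (real j + 40))) + exp (- s\<^sup>2 / (m + 20)) \<le> e1"
    and e2: "second_bound H c d0 B \<le> q\<^sup>2 * (1 + e2)" "1 + e2 \<ge> 0"
  shows "prob {\<omega>\<in>space M. \<forall>h. \<bar>h\<bar> \<le> H \<longrightarrow> X_T G (exp (exp n)) h \<omega> < x - s} \<le> e2 + 2 * e1"
proof -
  have H0: "H > 0" using H by simp
  interpret U: prob_space "unif H" by (rule prob_space_unif[OF H0])
  define C where "C = {z \<in> space (M \<Otimes>\<^sub>M unif H). good (snd z) (fst z)}"
  have C [measurable]: "C \<in> sets (M \<Otimes>\<^sub>M unif H)" unfolding C_def by (rule good_measurable_pair)
  have inC: "(\<omega>, h) \<in> C \<longleftrightarrow> good h \<omega>" if "\<omega> \<in> space M" for \<omega> h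
    using that by (simp add: C_def space_pair_measure)
  show ?thesis
  proof (rule prob_no_hit_le[OF prob_space_axioms U.prob_space_axioms C q_pos])
    fix h
    have "{\<omega>\<in>space M. (\<omega>, h) \<in> C} = {\<omega>\<in>space M. good h \<omega>}" using inC by auto
    moreover have "q * (1 - e1) \<le> q * (1 - ((\<Sum>j\<in>J. exp (- (\<eta> * real j)\<^sup>2 / (real j + 40))) + exp (- s\<^sup>2 / (m + 20))))"
      using e1 q_pos by (intro mult_left_mono) auto
    ultimately show "prob {\<omega>\<in>space M. (\<omega>, h) \<in> C} \<ge> q * (1 - e1)"
      using first_moment[OF \<eta>, of h] by simp
  next
    have "{\<omega>\<in>space M. (\<omega>, h) \<in> C \<and> (\<omega>, h') \<in> C} = {\<omega>\<in>space M. good h \<omega> \<and> good h' \<omega>}" for h h'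
      using inC by auto
    thus "(\<integral>\<^sup>+h. \<integral>\<^sup>+h'. emeasure M {\<omega>\<in>space M. (\<omega>, h) \<in> C \<and> (\<omega>, h') \<in> C} \<partial>unif H \<partial>unif H) \<le> ennreal (q\<^sup>2 * (1 + e2))"
      using second_moment[OF H c d0 B] ennreal_leI[OF e2(1)] by (simp add: order_trans)
  next
    show "{\<omega>\<in>space M. \<forall>h. \<bar>h\<bar> \<le> H \<longrightarrow> X_T G (exp (exp n)) h \<omega> < x - s} \<subseteq> {\<omega>\<in>space M. AE h in unif H. (\<omega>, h) \<notin> C}"
    proof
      fix \<omega> assume \<omega>: "\<omega> \<in> {\<omega>\<in>space M. \<forall>h. \<bar>h\<bar> \<le> H \<longrightarrow> X_T G (exp (exp n)) h \<omega> < x - s}"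
      have "AE h in unif H. (\<omega>, h) \<notin> C"
        using AE_unif[OF H0]
      proof eventually_elim
        case (elim h)
        hence "U h \<omega> + R h \<omega> < x - s" using \<omega> by (simp add: X_T_eq)
        hence "\<not> good h \<omega>" by (auto simp: good_def)
        thus ?case using inC \<omega> by auto
      qed
      thus "\<omega> \<in> {\<omega>\<in>space M. AE h in unif H. (\<omega>, h) \<notin> C}" using \<omega> by simp
    qed
  qed fact
qed

end

subsection \<open>The lower bound\<close>

text \<open>The function is a lower bound for q exp (n) H, the mean number of hits among cells of
  size exp (- n). The squared logarithm divided by n tends to 0, so it grows like n^k up to a
  constant.\<close>

lemma filterlim_expected_hits_lower:
  fixes k A e C0 A' :: real
  assumes "k > 0"
  shows "filterlim (\<lambda>n. exp ((1/2 + k) * ln n - C0 - (A * ln n + A')\<^sup>2 / (n - e * ln n - 40)) / sqrt (2 * pi * n)) at_top at_top"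
proof -
  have 1: "((\<lambda>n. (ln n)\<^sup>2 / (n - e * ln n - 40)) \<longlongrightarrow> 0) at_top"
    and 2: "((\<lambda>n. ln n / (n - e * ln n - 40)) \<longlongrightarrow> 0) at_top"
    and 3: "((\<lambda>n. 1 / (n - e * ln n - 40)) \<longlongrightarrow> 0) at_top"
    by real_asymp+
  have "((\<lambda>n. A\<^sup>2 * ((ln n)\<^sup>2 / (n - e * ln n - 40)) + 2 * A * A' * (ln n / (n - e * ln n - 40)) + A'\<^sup>2 * (1 / (n - e * ln n - 40)))
      \<longlongrightarrow> A\<^sup>2 * 0 + 2 * A * A' * 0 + A'\<^sup>2 * 0) at_top"
    by (intro tendsto_intros 1 2 3)
  moreover have "A\<^sup>2 * ((ln n)\<^sup>2 / (n - e * ln n - 40)) + 2 * A * A' * (ln n / (n - e * ln n - 40)) + A'\<^sup>2 * (1 / (n - e * ln n - 40))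
      = (A * ln n + A')\<^sup>2 / (n - e * ln n - 40)" for n
    by (simp add: power2_eq_square add_divide_distrib algebra_simps)
  ultimately have "((\<lambda>n. (A * ln n + A')\<^sup>2 / (n - e * ln n - 40)) \<longlongrightarrow> 0) at_top" by simp
  hence "\<forall>\<^sub>F n in at_top. (A * ln n + A')\<^sup>2 / (n - e * ln n - 40) < 1"
    by (rule order_tendstoD) simp
  hence ev: "\<forall>\<^sub>F n in at_top. exp (- C0 - 1) * (exp ((1/2 + k) * ln n) / sqrt (2 * pi * n))
      \<le> exp ((1/2 + k) * ln n - C0 - (A * ln n + A')\<^sup>2 / (n - e * ln n - 40)) / sqrt (2 * pi * n)"
    using eventually_gt_at_top[of 0]
  proof eventually_elim
    case (elim n)
    have "exp (- C0 - 1) * exp ((1/2 + k) * ln n) = exp ((1/2 + k) * ln n - C0 - 1)"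
      by (simp flip: exp_add)
    also have "\<dots> \<le> exp ((1/2 + k) * ln n - C0 - (A * ln n + A')\<^sup>2 / (n - e * ln n - 40))"
      using elim by simp
    finally show ?case using elim by (simp add: divide_right_mono)
  qed
  have "filterlim (\<lambda>n::real. exp ((1/2 + k) * ln n) / sqrt (2 * pi * n)) at_top at_top"
    using assms by real_asymp
  hence "filterlim (\<lambda>n. exp (- C0 - 1) * (exp ((1/2 + k) * ln n) / sqrt (2 * pi * n))) at_top at_top"
    by (intro filterlim_tendsto_pos_mult_at_top[OF tendsto_const]) auto
  thus ?thesis by (rule filterlim_at_top_mono[OF _ ev])
qed

text \<open>Substituting y = n^e reduces this to a power of y against exp (- y).\<close>

lemma tendsto_powr_mult_exp_neg_powr:
  fixes K e :: real
  assumes e: "e > 0"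
  shows "((\<lambda>n. n powr K * exp (- (n powr e))) \<longlongrightarrow> 0) at_top"
proof -
  have "((\<lambda>y::real. y powr (K / e) * exp (- y)) \<longlongrightarrow> 0) at_top" by real_asymp
  moreover have "filterlim (\<lambda>n::real. n powr e) at_top at_top" using e by real_asymp
  ultimately have "((\<lambda>n. (n powr e) powr (K / e) * exp (- (n powr e))) \<longlongrightarrow> 0) at_top"
    by (rule filterlim_compose)
  thus ?thesis using e by (simp add: powr_powr)
qed

text \<open>The last bracket is the mean square bound, each summand of which decays faster than any
  power of n. The rest is at most a power of n, since \<theta> n + 2 \<le> (\<theta> + 2) n for n
  \<ge> 1.\<close>

lemma tendsto_bad_pairs_factor:
  fixes k1 k2 \<theta> e :: real
  assumes k: "k1 > 0" "k2 > 0" and \<theta>: "\<theta> > 0" and e: "e > 0"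
  shows "((\<lambda>n. sqrt (2 * pi * n) * (n powr k1 * (\<theta> * n + 2) powr k2) * n\<^sup>2 * (4 * n\<^sup>2 * exp (- (\<theta> * n)) + 24 * n * exp (- (\<theta> * n / 2)) + 6 * exp (- (n powr e)))) \<longlongrightarrow> 0) at_top"
proof -
  define K where "K = 1/2 + k1 + k2 + 2"
  define D where "D = sqrt (2 * pi) * (\<theta> + 2) powr k2"
  let ?f = "\<lambda>n. D * (4 * (n powr (K + 2) * exp (- (\<theta> * n))) + 24 * (n powr (K + 1) * exp (- (\<theta> * n / 2))) + 6 * (n powr K * exp (- (n powr e))))"
  have 1: "((\<lambda>n. n powr (K + 2) * exp (- (\<theta> * n))) \<longlongrightarrow> 0) at_top"
    and 2: "((\<lambda>n. n powr (K + 1) * exp (- (\<theta> * n / 2))) \<longlongrightarrow> 0) at_top"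
    using \<theta> by real_asymp+
  have "(?f \<longlongrightarrow> D * (4 * 0 + 24 * 0 + 6 * 0)) at_top"
    by (intro tendsto_intros 1 2 tendsto_powr_mult_exp_neg_powr e)
  hence lim: "(?f \<longlongrightarrow> 0) at_top" by simp
  show ?thesis
  proof (rule tendsto_sandwich[OF _ _ tendsto_const lim])
    show "\<forall>\<^sub>F n in at_top. 0 \<le> sqrt (2 * pi * n) * (n powr k1 * (\<theta> * n + 2) powr k2) * n\<^sup>2 * (4 * n\<^sup>2 * exp (- (\<theta> * n)) + 24 * n * exp (- (\<theta> * n / 2)) + 6 * exp (- (n powr e)))"
      using eventually_ge_at_top[of 0] by eventually_elim auto
    show "\<forall>\<^sub>F n in at_top. sqrt (2 * pi * n) * (n powr k1 * (\<theta> * n + 2) powr k2) * n\<^sup>2 * (4 * n\<^sup>2 * exp (- (\<theta> * n)) + 24 * n * exp (- (\<theta> * n / 2)) + 6 * exp (- (n powr e))) \<le> ?f n"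
      using eventually_ge_at_top[of 1]
    proof eventually_elim
      case (elim n)
      have "(\<theta> * n + 2) powr k2 \<le> ((\<theta> + 2) * n) powr k2"
        using elim \<theta> k by (intro powr_mono2) (auto simp: algebra_simps)
      also have "\<dots> = (\<theta> + 2) powr k2 * n powr k2" using elim \<theta> by (simp add: powr_mult)
      finally have p: "(\<theta> * n + 2) powr k2 \<le> (\<theta> + 2) powr k2 * n powr k2" .
      have "sqrt (2 * pi * n) * (n powr k1 * (\<theta> * n + 2) powr k2) * n\<^sup>2
        \<le> sqrt (2 * pi * n) * (n powr k1 * ((\<theta> + 2) powr k2 * n powr k2)) * n\<^sup>2"
        using elim p by (intro mult_right_mono mult_left_mono) auto
      also have "\<dots> = D * (n powr (1/2) * n powr k1 * n powr k2 * n powr 2)"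
        using elim by (simp add: D_def real_sqrt_mult powr_half_sqrt)
      also have "n powr (1/2) * n powr k1 * n powr k2 * n powr 2 = n powr K"
        unfolding K_def by (simp only: powr_add)
      finally have P: "sqrt (2 * pi * n) * (n powr k1 * (\<theta> * n + 2) powr k2) * n\<^sup>2 \<le> D * n powr K" .
      have "sqrt (2 * pi * n) * (n powr k1 * (\<theta> * n + 2) powr k2) * n\<^sup>2 * (4 * n\<^sup>2 * exp (- (\<theta> * n)) + 24 * n * exp (- (\<theta> * n / 2)) + 6 * exp (- (n powr e)))
        \<le> D * n powr K * (4 * n\<^sup>2 * exp (- (\<theta> * n)) + 24 * n * exp (- (\<theta> * n / 2)) + 6 * exp (- (n powr e)))"
        using elim by (intro mult_right_mono P) auto
      also have "\<dots> = ?f n" using elim by (simp add: powr_add algebra_simps)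
      finally show ?case .
    qed
  qed
qed

lemma tendsto_small_primes_tail: "a > 0 \<Longrightarrow> e > 0 \<Longrightarrow> ((\<lambda>n::real. exp (- ((a * ln n)\<^sup>2 / (e * ln n + 20)))) \<longlongrightarrow> 0) at_top"
  by real_asymp

lemma tendsto_far_pairs_factor: "((\<lambda>n::real. exp (k / n) / sqrt (1 - (1 / n)\<^sup>2)) \<longlongrightarrow> 1) at_top"
  by real_asymp

lemma eventually_level_le_variance: "a > 0 \<Longrightarrow> \<forall>\<^sub>F n::real in at_top. a * n - c * ln n + 1 \<le> 2 * a * (n - e * ln n - 40)"
  by real_asymp

lemma eventually_level_ge_variance: "a2 < a \<Longrightarrow> \<forall>\<^sub>F n::real in at_top. a * n - c * ln n \<ge> a2 * (n - e * ln n + 40)"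
  by real_asymp

lemma eventually_covariance_times_level_le: "a > 0 \<Longrightarrow> \<theta> > 0 \<Longrightarrow> \<forall>\<^sub>F n::real in at_top. (41 + 2 * (e * ln n) + ln (\<theta> * n + 2)) * (2 * a) \<le> a * n - c * ln n"
  by real_asymp

lemma eventually_variance_ge_half: "\<forall>\<^sub>F n::real in at_top. n / 2 \<le> n - e * ln n - 40"
  by real_asymp

lemma sum_geometric_tail_le:
  fixes r :: real
  assumes r: "0 < r" "r < 1" and A: "finite A" "A \<subseteq> {k..}"
  shows "(\<Sum>j\<in>A. r ^ j) \<le> r ^ k / (1 - r)"
proof -
  have k: "k \<le> j" if "j \<in> A" for j using A(2) that by blast
  have inj: "inj_on (\<lambda>j. j - k) A"
  proof (rule inj_onI)
    fix i j assume "i \<in> A" "j \<in> A" "i - k = j - k"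
    thus "i = j" using k[of i] k[of j] by linarith
  qed
  have "(\<Sum>j\<in>A. r ^ j) = (\<Sum>j\<in>A. r ^ k * r ^ (j - k))"
    using k by (intro sum.cong refl) (simp add: power_add[symmetric])
  also have "\<dots> = r ^ k * (\<Sum>i\<in>(\<lambda>j. j - k) ` A. r ^ i)"
    using inj by (simp add: sum.reindex sum_distrib_left)
  also have "(\<Sum>i\<in>(\<lambda>j. j - k) ` A. r ^ i) \<le> (\<Sum>i. r ^ i)"
    using r A by (intro sum_le_suminf) auto
  also have "\<dots> = 1 / (1 - r)" using r by (intro suminf_geometric) auto
  finally show ?thesis using r by (simp add: mult_left_mono)
qed

context prime_gaussian
begin

text \<open>Removing the primes up to \<open>exp (n powr e)\<close> costs only \<open>e * ln n\<close> in the variance, and decorrelates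
  most pairs at distance at least \<open>n powr - e\<close>. The slope \<open>\<gamma>\<close> of the barrier satisfies \<open>1 < \<gamma> < \<alpha>\<close>:
  \<open>\<gamma> < \<alpha>\<close> makes the barrier typical, and \<open>\<gamma> > 1\<close> beats the \<open>exp j\<close> neighbours at distance \<open>exp (j - n)\<close>.\<close>
lemma lower_limit:
  fixes \<theta> \<epsilon> :: real
  assumes \<theta>: "\<theta> > 0" and \<epsilon>: "\<epsilon> > 0"
  defines "\<alpha> \<equiv> sqrt (1 + \<theta>)"
  shows "((\<lambda>n. prob {\<omega>\<in>space M. \<forall>h. \<bar>h\<bar> \<le> exp (\<theta> * n) \<longrightarrow>
            X_T G (exp (exp n)) h \<omega> < \<alpha> * n - (1 / (4 * \<alpha>) + \<epsilon>) * ln n}) \<longlongrightarrow> 0) at_top"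
proof -
  have \<alpha>: "\<alpha> > 1" "\<alpha>\<^sup>2 = 1 + \<theta>" using \<theta> by (auto simp: \<alpha>_def)
  \<comment> \<open>Discarding the variance e ln n costs \<alpha>^2 e ln n = (\<alpha> \<epsilon> /
    2) ln n in the exponent, half of the gain \<alpha> \<epsilon> ln n from the lowered level. The
    other half is \<open>\<kappa>\<close> below.\<close>
  define e where "e = \<epsilon> / (2 * \<alpha>)"
  have e: "e > 0" using \<epsilon> \<alpha> by (simp add: e_def)
  \<comment> \<open>Half of \<epsilon> lowers the level of \<open>U\<close>; the other half is the
    allowance \<open>s\<close> for the discarded primes, which suffices because s^2 / (m + 20) is of
    order ln n.\<close>
  define p where "p = 1 / (4 * \<alpha>) + \<epsilon> / 2"
  define m where "m = (\<lambda>n. e * ln n)"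
  define s where "s = (\<lambda>n. \<epsilon> / 2 * ln n)"
  define x where "x = (\<lambda>n. \<alpha> * n - p * ln n)"
  \<comment> \<open>Covers both hypotheses of \<open>S_far_le\<close>, as ln (2 H + 2) is at most
    \<theta> n + 2.\<close>
  define B where "B = (\<lambda>n. 41 + 2 * m n + ln (\<theta> * n + 2))"
  define \<gamma> where "\<gamma> = (1 + \<alpha>) / 2"
  \<comment> \<open>Slack parameters. \<gamma>' lies between 1 and \<gamma> and absorbs the bounded
    terms in the near factor; \<alpha>' lies between \<gamma> + \<eta> and \<alpha> and is the lower
    bound actually available for x / V.\<close>
  define \<gamma>' where "\<gamma>' = (1 + \<gamma>) / 2"
  define \<eta> where "\<eta> = (\<alpha> - 1) / 4"
  define \<alpha>' where "\<alpha>' = (1 + 7 * \<alpha>) / 8"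
  define c where "c = 84 * \<alpha>"
  have par: "1 < \<gamma>'" "\<gamma>' < \<gamma>" "\<gamma> < \<alpha>" "\<eta> > 0" "\<gamma> + \<eta> < \<alpha>'" "\<alpha>' < \<alpha>" "c > 0"
    using \<alpha>(1) by (auto simp: \<gamma>'_def \<gamma>_def \<eta>_def \<alpha>'_def c_def field_simps)
  define r1 where "r1 = exp (- (\<eta>\<^sup>2 / 2))"
  define r2 where "r2 = exp (- (\<gamma>' - 1))"
  have r1: "0 < r1" "r1 < 1" using par by (auto simp: r1_def)
  have r2: "0 < r2" "r2 < 1" using par by (auto simp: r2_def)
  define P where "P = (\<lambda>n. prob {\<omega>\<in>space M. \<forall>h. \<bar>h\<bar> \<le> exp (\<theta> * n) \<longrightarrow>
            X_T G (exp (exp n)) h \<omega> < \<alpha> * n - (1 / (4 * \<alpha>) + \<epsilon>) * ln n})"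
  define A where "A = \<alpha> * e - p"
  define A' where "A' = 40 * \<alpha> + 1"
  define C0 where "C0 = 2 * \<alpha> + 40 * \<alpha>\<^sup>2"
  define \<kappa> where "\<kappa> = \<alpha> * \<epsilon> / 2"
  define Q0 where "Q0 = (\<lambda>n. exp ((1/2 + \<kappa>) * ln n - C0 - (A * ln n + A')\<^sup>2 / (n - e * ln n - 40)) / sqrt (2 * pi * n))"
  define k1 where "k1 = 16 * \<alpha>\<^sup>2 * e"
  define k2 where "k2 = 8 * \<alpha>\<^sup>2"
  define C1 where "C1 = exp (4 * \<alpha> + 8 * \<alpha>\<^sup>2 * 41)"
  define g where "g = (\<lambda>n. C1 * (sqrt (2 * pi * n) * (n powr k1 * (\<theta> * n + 2) powr k2) * n\<^sup>2 * (4 * n\<^sup>2 * exp (- (\<theta> * n)) + 24 * n * exp (- (\<theta> * n / 2)) + 6 * exp (- (n powr e)))))"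
  \<comment> \<open>8 \<tau> is e2 + 2 e1 with e2 = 4 \<tau>, from the four parts of the second
    moment, and e1 = 2 \<tau>, from barrier and small primes in the first moment.\<close>
  have main: "\<forall>\<^sub>F n in at_top. P n \<le> 8 * \<tau>" if \<tau>: "\<tau> > 0" for \<tau>
  proof -
    have "(\<lambda>j. r1 ^ j / (1 - r1)) \<longlonglongrightarrow> 0 / (1 - r1)"
      using r1 by (intro tendsto_divide LIMSEQ_power_zero tendsto_const) auto
    hence "\<forall>\<^sub>F j in sequentially. r1 ^ j / (1 - r1) < \<tau>" using \<tau> by (intro order_tendstoD) auto
    moreover have "filterlim real at_top sequentially" by (rule filterlim_real_sequentially)
    hence "\<forall>\<^sub>F j in sequentially. real j \<ge> max (max 40 (40 * \<alpha>' / (\<alpha>' - (\<gamma> + \<eta>)))) (max ((1 + c) / (\<gamma> - \<gamma>')) (max (42 / (\<gamma>' - 1)) (1 + c)))"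
      unfolding filterlim_at_top by blast
    ultimately have "\<forall>\<^sub>F j in sequentially. r1 ^ j / (1 - r1) < \<tau> \<and> real j \<ge> max (max 40 (40 * \<alpha>' / (\<alpha>' - (\<gamma> + \<eta>)))) (max ((1 + c) / (\<gamma> - \<gamma>')) (max (42 / (\<gamma>' - 1)) (1 + c)))"
      by eventually_elim auto
    \<comment> \<open>All requirements on j0 involve only \<tau> and \<alpha>, so j0 is fixed before
      n grows. This matters because the closest pairs cost a factor exp j0.\<close>
    from eventually_happens[OF this] obtain j0 :: nat where j0: "r1 ^ j0 / (1 - r1) < \<tau>" "real j0 \<ge> 40"
      "real j0 \<ge> 40 * \<alpha>' / (\<alpha>' - (\<gamma> + \<eta>))" "real j0 \<ge> (1 + c) / (\<gamma> - \<gamma>')" "real j0 \<ge> 42 / (\<gamma>' - 1)" "real j0 \<ge> 1 + c"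
      by auto
    have "filterlim Q0 at_top at_top"
      unfolding Q0_def by (rule filterlim_expected_hits_lower) (use \<alpha> \<epsilon> in \<open>auto simp: \<kappa>_def\<close>)
    hence E7: "\<forall>\<^sub>F n in at_top. Q0 n \<ge> max (exp (real j0) / \<tau>) (1 / (1 - r2) / \<tau>)"
      unfolding filterlim_at_top by blast
    have "(g \<longlongrightarrow> C1 * 0) at_top" unfolding g_def
      by (intro tendsto_mult tendsto_const tendsto_bad_pairs_factor) (use \<alpha> \<theta> e in \<open>auto simp: k1_def k2_def\<close>)
    hence E9: "\<forall>\<^sub>F n in at_top. g n < \<tau>" using \<tau> by (intro order_tendstoD) auto
    have E8: "\<forall>\<^sub>F n in at_top. exp (8 * \<alpha>\<^sup>2 / n) / sqrt (1 - (1 / n)\<^sup>2) < 1 + \<tau>"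
      by (intro order_tendstoD[OF tendsto_far_pairs_factor]) (use \<tau> in auto)
    have E6: "\<forall>\<^sub>F n in at_top. exp (- ((\<epsilon> / 2 * ln n)\<^sup>2 / (e * ln n + 20))) < \<tau>"
      by (intro order_tendstoD[OF tendsto_small_primes_tail]) (use \<tau> \<epsilon> e in auto)
    have E5: "\<forall>\<^sub>F n in at_top. (41 + 2 * (e * ln n) + ln (\<theta> * n + 2)) * (2 * \<alpha>) \<le> \<alpha> * n - p * ln n"
      by (intro eventually_covariance_times_level_le) (use \<alpha> \<theta> in auto)
    have E4: "\<forall>\<^sub>F n in at_top. \<alpha> * n - p * ln n \<ge> \<alpha>' * (n - e * ln n + 40)"
      by (rule eventually_level_ge_variance) (rule par)
    have E3: "\<forall>\<^sub>F n in at_top. \<alpha> * n - p * ln n + 1 \<le> 2 * \<alpha> * (n - e * ln n - 40)"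
      by (rule eventually_level_le_variance) (use \<alpha> in auto)
    have E2: "\<forall>\<^sub>F n in at_top. n / 2 \<le> n - e * ln n - 40" by (rule eventually_variance_ge_half)
    from E2 E3 E4 E5 E6 E7 E8 E9 eventually_ge_at_top[of 40] show "\<forall>\<^sub>F n in at_top. P n \<le> 8 * \<tau>"
    proof eventually_elim
      case (elim n)
      note E = elim
      define H where "H = exp (\<theta> * n)"
      \<comment> \<open>The exponent of the far factor is then at most 8 \<alpha>^2 / n, tending to
        0, while 1 / d0^2 = n^2 is only polynomial and is absorbed by the mean square.\<close>
      define d0 where "d0 = 1 / n"
      have n: "n \<ge> 40" by (rule E)
      have ln0: "ln n \<ge> 0" using n by simp
      have m: "0 \<le> m n" "m n \<le> n" using E(1) ln0 e n by (auto simp: m_def)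
      have Vb: "KK n 0 - KK (m n) 0 \<ge> n - m n - 40" "KK n 0 - KK (m n) 0 \<le> n - m n + 40"
        using KK_0_asymp[of n] KK_0_asymp[OF m(1)] n by (auto simp: abs_le_iff)
      have Vh: "KK n 0 - KK (m n) 0 \<ge> n / 2" using Vb(1) E(1) by (simp add: m_def)
      have x0: "x n \<ge> 0"
      proof -
        have "0 \<le> \<alpha>' * (n - e * ln n + 40)" using E(1) par n by (intro mult_nonneg_nonneg) auto
        thus ?thesis using E(3) by (simp add: x_def)
      qed
      interpret S: prime_gaussian_scales M G n "m n" "x n" \<gamma> "s n" j0
        by standard (use m x0 Vh n ln0 \<epsilon> in \<open>auto simp: s_def\<close>)
      have V: "S.V \<ge> n - m n - 40" "S.V \<le> n - m n + 40" "S.V \<ge> n / 2" "S.V \<le> 2 * n" "S.V \<ge> 1"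
        using Vb Vh n m unfolding S.V_def by auto
      have V0: "S.V > 0" using V by linarith
      have xV: "x n + 1 \<le> 2 * \<alpha> * S.V"
      proof -
        have "2 * \<alpha> * (n - e * ln n - 40) \<le> 2 * \<alpha> * S.V" using V(1) \<alpha> by (intro mult_left_mono) (auto simp: m_def)
        thus ?thesis using E(2) by (simp add: x_def)
      qed
      hence xV': "(x n + 1) / S.V \<le> 2 * \<alpha>" using V0 by (simp add: divide_le_eq)
      have xV2: "x n / S.V \<ge> \<alpha>'"
      proof -
        have "\<alpha>' * S.V \<le> \<alpha>' * (n - e * ln n + 40)" using V(2) par by (intro mult_left_mono) (auto simp: m_def)
        thus ?thesis using E(3) V0 by (simp add: x_def le_divide_eq)
      qed
      have H1: "H \<ge> 1" using \<theta> n by (simp add: H_def)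
      have Jj0: "real j \<ge> real j0" if "j \<in> S.J" for j using that by (simp add: S.J_def)
      have c1: "42 * (x n + 1) / S.V \<le> c"
      proof -
        have "42 * ((x n + 1) / S.V) \<le> c" using xV' unfolding c_def by linarith
        thus ?thesis by (simp only: times_divide_eq_right)
      qed
      have c2: "c + 1 \<le> \<gamma> * real j" if "j \<in> S.J" for j
      proof -
        have "c + 1 \<le> 1 * real j" using j0(6) Jj0[OF that] by simp
        also have "\<dots> \<le> \<gamma> * real j" using par by (intro mult_right_mono) auto
        finally show ?thesis .
      qed
      have d0: "0 < d0" "d0 < S.V"
      proof -
        show "0 < d0" using n by (simp add: d0_def)
        have "d0 < 1" using n by (simp add: d0_def)
        thus "d0 < S.V" using V(5) by linarith
      qed
      have th0: "\<theta> * n \<ge> 0" using \<theta> n by simp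
      have lnth: "ln (\<theta> * n + 2) \<ge> 0" using \<theta> n by (simp add: ln_ge_zero)
      have B1: "41 + 2 * m n \<le> B n" using lnth by (simp add: B_def)
      have B2: "40 + m n + ln (ln (2 * H + 2)) \<le> B n"
      proof -
        have "2 * H + 2 \<le> exp 2 * H"
        proof -
          have "(4::real) \<le> exp 2" using exp_ge_add_one_self[of 1] power_mono[of 2 "exp 1 :: real" 2] by (simp flip: exp_double)
          hence "4 * H \<le> exp 2 * H" using H1 by (intro mult_right_mono) auto
          thus ?thesis using H1 by linarith
        qed
        also have "\<dots> = exp (\<theta> * n + 2)" by (simp add: H_def exp_add)
        finally have "ln (2 * H + 2) \<le> ln (exp (\<theta> * n + 2))" using H1 by (subst ln_le_cancel_iff) auto
        hence "ln (2 * H + 2) \<le> \<theta> * n + 2" by simp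
        hence "ln (ln (2 * H + 2)) \<le> ln (\<theta> * n + 2)" using H1 th0 by (subst ln_le_cancel_iff) auto
        thus ?thesis using m by (simp add: B_def)
      qed
      have B0: "B n \<ge> 0" using B1 m by linarith
      have B3: "B n * (x n + 1) / S.V \<le> x n"
      proof -
        have "B n * ((x n + 1) / S.V) \<le> B n * (2 * \<alpha>)" using xV' B0 by (intro mult_left_mono) auto
        also have "\<dots> \<le> x n" using E(4) by (simp add: B_def x_def m_def)
        finally show ?thesis by simp
      qed
      \<comment> \<open>The conditional mean of \<Delta> j is at least (j - 40) \<alpha>'; since
        \<alpha>' > \<gamma> + \<eta>, the loss of 40 \<alpha>' is absorbed once j \<ge> j0.\<close>
      have \<eta>2: "(KK n 0 - KK (n - real j) 0) / S.V * x n - \<gamma> * real j \<ge> \<eta> * real j" if j: "j \<in> S.J" for j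
      proof -
        have jn: "0 \<le> n - real j" using j m by (auto simp: S.J_def)
        have "(\<gamma> + \<eta>) * real j \<le> (real j - 40) * \<alpha>'"
        proof -
          have "40 * \<alpha>' \<le> real j0 * (\<alpha>' - (\<gamma> + \<eta>))" using j0(3) par by (simp add: divide_le_eq)
          also have "\<dots> \<le> real j * (\<alpha>' - (\<gamma> + \<eta>))" using Jj0[OF j] par by (intro mult_right_mono) auto
          finally show ?thesis by (simp add: algebra_simps)
        qed
        also have "\<dots> \<le> (real j - 40) * (x n / S.V)" using xV2 Jj0[OF j] j0(2) by (intro mult_left_mono) auto
        also have "\<dots> \<le> (KK n 0 - KK (n - real j) 0) * (x n / S.V)"
          using KK_0_asymp[of n] KK_0_asymp[OF jn] n x0 V0 by (intro mult_right_mono) (auto simp: abs_le_iff)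
        also have "\<dots> = (KK n 0 - KK (n - real j) 0) / S.V * x n" by simp
        finally show ?thesis unfolding distrib_right by linarith
      qed
      have e1: "(\<Sum>j\<in>S.J. exp (- (\<eta> * real j)\<^sup>2 / (real j + 40))) + exp (- (s n)\<^sup>2 / (m n + 20)) \<le> 2 * \<tau>"
      proof -
        have "(\<Sum>j\<in>S.J. exp (- (\<eta> * real j)\<^sup>2 / (real j + 40))) \<le> (\<Sum>j\<in>S.J. r1 ^ j)"
        proof (rule sum_mono)
          fix j assume j: "j \<in> S.J"
          have j40: "real j \<ge> 40" using Jj0[OF j] j0(2) by linarith
          have "real j * (real j + 40) \<le> real j * (2 * real j)" using j40 by (intro mult_left_mono) auto
          hence "\<eta>\<^sup>2 / 2 * (real j * (real j + 40)) \<le> \<eta>\<^sup>2 / 2 * (real j * (2 * real j))" by (rule mult_left_mono) simp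
          also have "\<dots> = (\<eta> * real j)\<^sup>2" by (simp add: power2_eq_square)
          finally have "\<eta>\<^sup>2 / 2 * real j * (real j + 40) \<le> (\<eta> * real j)\<^sup>2" by (simp only: mult.assoc)
          hence "\<eta>\<^sup>2 / 2 * real j \<le> (\<eta> * real j)\<^sup>2 / (real j + 40)" by (subst le_divide_eq) auto
          hence "exp (- (\<eta> * real j)\<^sup>2 / (real j + 40)) \<le> exp (- (\<eta>\<^sup>2 / 2 * real j))" by simp
          also have "\<dots> = r1 ^ j" by (simp add: r1_def exp_of_nat_mult[symmetric] mult.commute)
          finally show "exp (- (\<eta> * real j)\<^sup>2 / (real j + 40)) \<le> r1 ^ j" .
        qed
        also have "\<dots> \<le> r1 ^ j0 / (1 - r1)" by (rule sum_geometric_tail_le[OF r1 S.finite_J]) (auto simp: S.J_def)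
        also have "\<dots> \<le> \<tau>" using j0(1) by simp
        finally show ?thesis using E(5) by (simp add: s_def m_def)
      qed
      have q: "S.q * (exp n * H) \<ge> Q0 n"
      proof -
        define b where "b = p * ln n - 1"
        define M where "M = m n + 40"
        have nM: "n - M > 0" using E(1) n by (simp add: M_def m_def)
        have x1: "x n + 1 = \<alpha> * n - b" by (simp add: x_def b_def)
        \<comment> \<open>Exact polynomial division of the squared level by n - M, which isolates
          \<alpha>^2 n so that it cancels against exp n * H.\<close>
        have id: "(\<alpha> * n - b)\<^sup>2 / (n - M) = \<alpha>\<^sup>2 * n + \<alpha>\<^sup>2 * M - 2 * \<alpha> * b + (\<alpha> * M - b)\<^sup>2 / (n - M)"
        proof -
          have "(\<alpha> * n - b)\<^sup>2 = (\<alpha>\<^sup>2 * n + \<alpha>\<^sup>2 * M - 2 * \<alpha> * b) * (n - M) + (\<alpha> * M - b)\<^sup>2"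
            by (simp add: power2_eq_square algebra_simps)
          hence "(\<alpha> * n - b)\<^sup>2 / (n - M) = ((\<alpha>\<^sup>2 * n + \<alpha>\<^sup>2 * M - 2 * \<alpha> * b) * (n - M) + (\<alpha> * M - b)\<^sup>2) / (n - M)" by simp
          thus ?thesis using nM by (simp add: add_divide_distrib)
        qed
        have "(x n + 1)\<^sup>2 / S.V \<le> (x n + 1)\<^sup>2 / (n - M)"
          using V(1) nM V0 by (intro divide_left_mono) (auto simp: M_def)
        also have "\<dots> = \<alpha>\<^sup>2 * n + \<alpha>\<^sup>2 * M - 2 * \<alpha> * b + (\<alpha> * M - b)\<^sup>2 / (n - M)" unfolding x1 id ..
        finally have ex: "- ((x n + 1)\<^sup>2 / S.V) + \<alpha>\<^sup>2 * n \<ge> 2 * \<alpha> * b - \<alpha>\<^sup>2 * M - (\<alpha> * M - b)\<^sup>2 / (n - M)" by linarith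
        have hA: "\<alpha> * M - b = A * ln n + A'" by (simp add: A_def A'_def M_def b_def m_def algebra_simps)
        \<comment> \<open>Net balance of the exponent: 1/2 pays for the normalisation 1 / sqrt n,
          and \<open>\<kappa>\<close> is the surplus left after paying for the discarded
          primes.\<close>
        have hB: "2 * \<alpha> * b - \<alpha>\<^sup>2 * M = (1/2 + \<kappa>) * ln n - C0"
        proof -
          have h1: "2 * \<alpha> * p = 1/2 + \<alpha> * \<epsilon>" using \<alpha>(1) by (simp add: p_def field_simps)
          have h2: "\<alpha>\<^sup>2 * e = \<alpha> * \<epsilon> / 2" using \<alpha>(1) by (simp add: e_def power2_eq_square)
          have h3: "2 * \<alpha> * b - \<alpha>\<^sup>2 * M = (2 * \<alpha> * p) * ln n - (\<alpha>\<^sup>2 * e) * ln n - C0"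
            by (simp add: b_def M_def m_def C0_def algebra_simps)
          show ?thesis unfolding h3 h1 h2 \<kappa>_def by (simp add: field_simps)
        qed
        have hC: "n - M = n - e * ln n - 40" by (simp add: M_def m_def)
        have ex2: "(1/2 + \<kappa>) * ln n - C0 - (A * ln n + A')\<^sup>2 / (n - e * ln n - 40) \<le> - ((x n + 1)\<^sup>2 / S.V) + \<alpha>\<^sup>2 * n"
          using ex unfolding hA hB hC .
        have "Q0 n \<le> exp (- ((x n + 1)\<^sup>2 / S.V) + \<alpha>\<^sup>2 * n) / sqrt (pi * S.V)"
          unfolding Q0_def
        proof (rule frac_le)
          have "pi * S.V \<le> pi * (2 * n)" using V by (intro mult_left_mono) auto
          thus "sqrt (pi * S.V) \<le> sqrt (2 * pi * n)" by (simp add: algebra_simps)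
          show "exp ((1/2 + \<kappa>) * ln n - C0 - (A * ln n + A')\<^sup>2 / (n - e * ln n - 40)) \<le> exp (- ((x n + 1)\<^sup>2 / S.V) + \<alpha>\<^sup>2 * n)"
            using ex2 by (simp only: exp_le_cancel_iff)
        qed (use V0 in auto)
        also have "\<dots> = exp (- (x n + 1)\<^sup>2 / S.V) / sqrt (pi * S.V) * exp (\<alpha>\<^sup>2 * n)" by (simp only: exp_add) simp
        also have "\<dots> \<le> S.q * exp (\<alpha>\<^sup>2 * n)" by (intro mult_right_mono S.q_ge) auto
        also have "exp (\<alpha>\<^sup>2 * n) = exp n * H" by (simp add: H_def \<alpha> distrib_right exp_add)
        finally show ?thesis .
      qed
      have q0: "S.q > 0" by (rule S.q_pos)
      have Q1: "exp (real j0) \<le> \<tau> * (S.q * (exp n * H))" and Q2: "1 / (1 - r2) \<le> \<tau> * (S.q * (exp n * H))"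
      proof -
        have hh: "z \<le> \<tau> * (S.q * (exp n * H))" if "z / \<tau> \<le> Q0 n" for z
        proof -
          have "z / \<tau> \<le> S.q * (exp n * H)" using that q by (rule order_trans)
          hence "\<tau> * (z / \<tau>) \<le> \<tau> * (S.q * (exp n * H))" by (rule mult_left_mono) (use \<tau> in simp)
          thus ?thesis using \<tau> by simp
        qed
        have "exp (real j0) / \<tau> \<le> Q0 n" "1 / (1 - r2) / \<tau> \<le> Q0 n" using E(6) by (simp_all only: max.bounded_iff)
        thus "exp (real j0) \<le> \<tau> * (S.q * (exp n * H))" "1 / (1 - r2) \<le> \<tau> * (S.q * (exp n * H))"
          using hh by blast+
      qed
      have Hen: "exp n * H > 0" using H1 by simp
      \<comment> \<open>Such pairs have measure at most exp (j0 - n) / H and cost q instead of q^2,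
        so they are negligible as soon as q exp (n) H exceeds exp j0 / \<tau>.\<close>
      have T1: "S.q * (exp (- (n - real j0)) / H) \<le> \<tau> * S.q\<^sup>2"
      proof -
        have "S.q * (exp (- (n - real j0)) / H) = S.q * (exp (real j0) / (exp n * H))" by (simp add: exp_diff)
        also have "\<dots> \<le> S.q * (\<tau> * (S.q * (exp n * H)) / (exp n * H))"
          using q0 Q1 Hen by (intro mult_left_mono divide_right_mono) auto
        also have "\<dots> = \<tau> * S.q\<^sup>2" using H1 by (simp add: power2_eq_square)
        finally show ?thesis .
      qed
      \<comment> \<open>Here \<gamma> > 1 is used: with \<gamma> j - 1 - c \<ge> \<gamma>' j and j +
        42 \<le> \<gamma>' j the near factor is at most exp (- \<gamma>' j), which beats the exp j
        cells at that distance.\<close>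
      have nf: "S.near_factor c j * exp (real j) \<le> r2 ^ j" if j: "j \<in> S.J" for j
      proof -
        have "1 + c \<le> real j0 * (\<gamma> - \<gamma>')" using j0(4) par by (simp add: divide_le_eq)
        also have "\<dots> \<le> real j * (\<gamma> - \<gamma>')" using Jj0[OF j] par by (intro mult_right_mono) auto
        finally have g1: "\<gamma>' * real j \<le> \<gamma> * real j - 1 - c" by (simp add: algebra_simps)
        have "42 \<le> real j0 * (\<gamma>' - 1)" using j0(5) par by (simp add: divide_le_eq)
        also have "\<dots> \<le> real j * (\<gamma>' - 1)" using Jj0[OF j] par by (intro mult_right_mono) auto
        finally have g2: "real j + 42 \<le> \<gamma>' * real j" by (simp add: algebra_simps)
        have "\<gamma>' * real j * (real j + 42) \<le> \<gamma>' * real j * (\<gamma>' * real j)" using g2 par by (intro mult_left_mono) auto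
        also have "\<dots> = (\<gamma>' * real j)\<^sup>2" by (simp add: power2_eq_square)
        also have "\<dots> \<le> (\<gamma> * real j - 1 - c)\<^sup>2" using g1 par by (intro power_mono) auto
        finally have "\<gamma>' * real j \<le> (\<gamma> * real j - 1 - c)\<^sup>2 / (real j + 42)" by (subst le_divide_eq) auto
        hence "S.near_factor c j \<le> exp (- (\<gamma>' * real j))" by (simp add: S.near_factor_def)
        hence "S.near_factor c j * exp (real j) \<le> exp (- (\<gamma>' * real j)) * exp (real j)" by (intro mult_right_mono) auto
        also have "\<dots> = exp (real j * - (\<gamma>' - 1))" by (simp add: algebra_simps flip: exp_add)
        also have "\<dots> = r2 ^ j" unfolding r2_def exp_of_nat_mult ..
        finally show ?thesis .
      qed
      have T2: "(\<Sum>j\<in>S.J. S.q * S.near_factor c j * (exp (- (n - real j)) / H)) \<le> \<tau> * S.q\<^sup>2"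
      proof -
        have "(\<Sum>j\<in>S.J. S.q * S.near_factor c j * (exp (- (n - real j)) / H))
          = S.q / (exp n * H) * (\<Sum>j\<in>S.J. S.near_factor c j * exp (real j))"
          unfolding sum_distrib_left by (intro sum.cong refl) (simp add: exp_diff)
        also have "\<dots> \<le> S.q / (exp n * H) * (\<tau> * (S.q * (exp n * H)))"
        proof (rule mult_left_mono)
          have "(\<Sum>j\<in>S.J. S.near_factor c j * exp (real j)) \<le> (\<Sum>j\<in>S.J. r2 ^ j)" by (intro sum_mono nf)
          also have "\<dots> \<le> r2 ^ 0 / (1 - r2)" by (rule sum_geometric_tail_le[OF r2 S.finite_J]) simp
          also have "\<dots> \<le> \<tau> * (S.q * (exp n * H))" using Q2 by (simp only: power_0)
          finally show "(\<Sum>j\<in>S.J. S.near_factor c j * exp (real j)) \<le> \<tau> * (S.q * (exp n * H))" .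
        qed (use q0 Hen in auto)
        also have "\<dots> = \<tau> * S.q\<^sup>2" using H1 by (simp add: power2_eq_square)
        finally show ?thesis .
      qed
      have T3: "S.far_factor d0 * S.q\<^sup>2 \<le> (1 + \<tau>) * S.q\<^sup>2"
      proof (intro mult_right_mono)
        have "S.far_factor d0 \<le> exp (8 * \<alpha>\<^sup>2 / n) / sqrt (1 - (1 / n)\<^sup>2)"
          unfolding S.far_factor_def
        proof (rule frac_le)
          have "((x n + 1) / S.V)\<^sup>2 \<le> (2 * \<alpha>)\<^sup>2" using xV' x0 V0 by (intro power_mono) auto
          hence "2 * d0 * ((x n + 1) / S.V)\<^sup>2 \<le> 2 * d0 * (2 * \<alpha>)\<^sup>2" using d0 by (intro mult_left_mono) auto
          moreover have "2 * d0 * ((x n + 1) / S.V)\<^sup>2 = 2 * d0 * (x n + 1)\<^sup>2 / S.V\<^sup>2" by (simp add: power_divide)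
          moreover have "2 * d0 * (2 * \<alpha>)\<^sup>2 = 8 * \<alpha>\<^sup>2 / n" by (simp add: d0_def power_mult_distrib)
          ultimately show "exp (2 * d0 * (x n + 1)\<^sup>2 / S.V\<^sup>2) \<le> exp (8 * \<alpha>\<^sup>2 / n)" by (simp only: exp_le_cancel_iff)
          have "d0 / S.V \<le> d0 / 1" using V(5) d0 by (intro divide_left_mono) auto
          hence "(d0 / S.V)\<^sup>2 \<le> (1 / n)\<^sup>2" using d0 V0 by (intro power_mono) (auto simp: d0_def)
          thus "sqrt (1 - (1 / n)\<^sup>2) \<le> sqrt (1 - (d0 / S.V)\<^sup>2)" by simp
          have "\<bar>1 / n\<bar> < 1" using n by simp
          hence "(1 / n)\<^sup>2 < 1" by (simp only: abs_square_less_1)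
          thus "0 < sqrt (1 - (1 / n)\<^sup>2)" by simp
        qed auto
        thus "S.far_factor d0 \<le> 1 + \<tau>" using E(7) by linarith
      qed auto
      have T4: "S.q * S.bad_factor (B n) / d0\<^sup>2 * S.mean_sq_bound H \<le> \<tau> * S.q\<^sup>2"
      proof -
        \<comment> \<open>Replacing x - y by x + 1 changes the Gaussian exponent by at most 4
          \<alpha> + 8 \<alpha>^2 B, and B is of order ln n: an exceptional pair costs q^2 times a
          power of n.\<close>
        have bq: "S.bad_factor (B n) \<le> S.q * (sqrt (2 * pi * n) * exp (4 * \<alpha> + 8 * \<alpha>\<^sup>2 * B n))"
        proof -
          define y where "y = B n * (x n + 1) / S.V"
          have yle: "y \<le> B n * (2 * \<alpha>)" 
          proof -
            have "B n * ((x n + 1) / S.V) \<le> B n * (2 * \<alpha>)" using xV' B0 by (intro mult_left_mono) auto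
            thus ?thesis by (simp add: y_def)
          qed
          have y0: "y \<ge> 0" using B0 x0 V0 by (simp add: y_def)
          have "(x n + 1)\<^sup>2 - (x n - y)\<^sup>2 = 2 * x n + 1 + 2 * x n * y - y\<^sup>2"
            by (simp add: power2_eq_square algebra_simps)
          hence "(x n + 1)\<^sup>2 - (x n - y)\<^sup>2 \<le> 2 * x n + 1 + 2 * x n * y" by simp
          also have "\<dots> \<le> 2 * (x n + 1) + 2 * (x n + 1) * y" using y0 x0 by (intro add_mono mult_right_mono) auto
          also have "\<dots> = 2 * (x n + 1) * (1 + y)" by (simp add: algebra_simps)
          finally have "((x n + 1)\<^sup>2 - (x n - y)\<^sup>2) / S.V \<le> 2 * (x n + 1) * (1 + y) / S.V" using V0 by (intro divide_right_mono) auto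
          also have "\<dots> = 2 * ((x n + 1) / S.V) * (1 + y)" by simp
          also have "\<dots> \<le> 2 * (2 * \<alpha>) * (1 + B n * (2 * \<alpha>))"
            using xV' yle y0 \<alpha>(1) x0 V0 by (intro mult_mono add_mono) auto
          also have "\<dots> = 4 * \<alpha> + 8 * \<alpha>\<^sup>2 * B n" by (simp add: power2_eq_square algebra_simps)
          finally have "- (x n - y)\<^sup>2 / S.V \<le> - (x n + 1)\<^sup>2 / S.V + (4 * \<alpha> + 8 * \<alpha>\<^sup>2 * B n)"
            by (simp add: diff_divide_distrib)
          hence "S.bad_factor (B n) \<le> exp (- (x n + 1)\<^sup>2 / S.V + (4 * \<alpha> + 8 * \<alpha>\<^sup>2 * B n))"
            unfolding S.bad_factor_def y_def by simp
          also have "\<dots> = (exp (- (x n + 1)\<^sup>2 / S.V) / sqrt (pi * S.V)) * (sqrt (pi * S.V) * exp (4 * \<alpha> + 8 * \<alpha>\<^sup>2 * B n))"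
            unfolding exp_add using V0 by simp
          also have "\<dots> \<le> S.q * (sqrt (2 * pi * n) * exp (4 * \<alpha> + 8 * \<alpha>\<^sup>2 * B n))"
          proof (intro mult_mono S.q_ge)
            have "pi * S.V \<le> pi * (2 * n)" using V by (intro mult_left_mono) auto
            thus "sqrt (pi * S.V) \<le> sqrt (2 * pi * n)" by (simp add: algebra_simps)
          qed (use q0 n V0 in auto)
          finally show ?thesis .
        qed
        have eB: "exp (4 * \<alpha> + 8 * \<alpha>\<^sup>2 * B n) = C1 * (n powr k1 * (\<theta> * n + 2) powr k2)"
        proof -
          have h: "4 * \<alpha> + 8 * \<alpha>\<^sup>2 * B n = (4 * \<alpha> + 8 * \<alpha>\<^sup>2 * 41) + (k1 * ln n + k2 * ln (\<theta> * n + 2))"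
            by (simp add: B_def m_def k1_def k2_def algebra_simps)
          have h1: "n powr k1 = exp (k1 * ln n)" "(\<theta> * n + 2) powr k2 = exp (k2 * ln (\<theta> * n + 2))"
            using n th0 by (auto simp: powr_def)
          show ?thesis unfolding h unfolding C1_def h1 exp_add by (simp only: mult.assoc)
        qed
        have MS: "S.mean_sq_bound H \<le> 4 * n\<^sup>2 * exp (- (\<theta> * n)) + 24 * n * exp (- (\<theta> * n / 2)) + 6 * exp (- (n powr e))"
        proof -
          have "S.V\<^sup>2 / H \<le> (2 * n)\<^sup>2 / H" using V V0 H1 by (intro divide_right_mono power_mono) auto
          also have "\<dots> = 4 * n\<^sup>2 * exp (- (\<theta> * n))" by (simp add: H_def exp_minus power_mult_distrib divide_inverse)
          finally have 1: "S.V\<^sup>2 / H \<le> 4 * n\<^sup>2 * exp (- (\<theta> * n))" .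
          have sH: "sqrt H = exp (\<theta> * n / 2)" by (rule real_sqrt_unique) (auto simp: H_def simp flip: exp_double)
          have "12 * S.V / sqrt H \<le> 12 * (2 * n) / sqrt H" using V H1 by (intro divide_right_mono) auto
          also have "\<dots> = 24 * n * exp (- (\<theta> * n / 2))" unfolding sH by (simp add: exp_minus field_simps)
          finally have 2: "12 * S.V / sqrt H \<le> 24 * n * exp (- (\<theta> * n / 2))" .
          have "exp (m n) = n powr e" using n by (simp add: m_def powr_def)
          hence 3: "6 / exp (exp (m n)) = 6 * exp (- (n powr e))" by (simp add: exp_minus divide_inverse)
          show ?thesis unfolding S.mean_sq_bound_def 3 using 1 2 by linarith
        qed
        have MS0: "S.mean_sq_bound H \<ge> 0" using V0 H1 by (simp add: S.mean_sq_bound_def)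
        have bad0: "S.bad_factor (B n) \<ge> 0" by (simp add: S.bad_factor_def)
        have bq': "S.bad_factor (B n) \<le> S.q * (sqrt (2 * pi * n) * (C1 * (n powr k1 * (\<theta> * n + 2) powr k2)))"
          using bq unfolding eB .
        have "S.q * S.bad_factor (B n) / d0\<^sup>2 * S.mean_sq_bound H = S.q * (S.bad_factor (B n) * n\<^sup>2 * S.mean_sq_bound H)"
          by (simp add: d0_def power_divide)
        also have "\<dots> \<le> S.q * ((S.q * (sqrt (2 * pi * n) * (C1 * (n powr k1 * (\<theta> * n + 2) powr k2)))) * n\<^sup>2
            * (4 * n\<^sup>2 * exp (- (\<theta> * n)) + 24 * n * exp (- (\<theta> * n / 2)) + 6 * exp (- (n powr e))))"
          by (intro mult_left_mono mult_mono bq' MS) (use MS0 bad0 q0 n in \<open>auto simp: C1_def\<close>)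
        also have "\<dots> = S.q\<^sup>2 * g n" by (simp add: g_def power2_eq_square ac_simps)
        also have "\<dots> \<le> S.q\<^sup>2 * \<tau>" using E(8) by (intro mult_left_mono) auto
        finally show ?thesis by (simp add: mult.commute)
      qed
      have e2: "S.second_bound H c d0 (B n) \<le> S.q\<^sup>2 * (1 + 4 * \<tau>)"
      proof -
        have "S.second_bound H c d0 (B n) \<le> \<tau> * S.q\<^sup>2 + \<tau> * S.q\<^sup>2 + (1 + \<tau>) * S.q\<^sup>2 + \<tau> * S.q\<^sup>2"
          unfolding S.second_bound_def by (intro add_mono T1 T2 T3 T4)
        also have "\<dots> = S.q\<^sup>2 * (1 + 4 * \<tau>)" by (simp add: algebra_simps)
        finally show ?thesis .
      qed
      have "prob {\<omega>\<in>space M. \<forall>h. \<bar>h\<bar> \<le> H \<longrightarrow> X_T G (exp (exp n)) h \<omega> < x n - s n} \<le> 4 * \<tau> + 2 * (2 * \<tau>)"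
        by (rule S.prob_max_small_le[OF H1 c1 c2 d0 B1 B2 B3 par(4) \<eta>2 e1 e2]) (use \<tau> in auto)
      moreover have "x n - s n = \<alpha> * n - (1 / (4 * \<alpha>) + \<epsilon>) * ln n"
        by (simp add: x_def s_def p_def algebra_simps)
      ultimately show "P n \<le> 8 * \<tau>" by (simp add: P_def H_def)
    qed
  qed
  have "(P \<longlongrightarrow> 0) at_top"
  proof (rule tendstoI)
    fix \<tau> :: real assume "\<tau> > 0"
    hence "\<forall>\<^sub>F n in at_top. P n \<le> 8 * (\<tau> / 16)" by (intro main) auto
    thus "\<forall>\<^sub>F n in at_top. dist (P n) 0 < \<tau>"
    proof eventually_elim
      case (elim n)
      have "P n \<ge> 0" by (simp add: P_def)
      thus ?case using elim \<open>\<tau> > 0\<close> by (simp add: dist_real_def)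
    qed
  qed
  thus ?thesis by (simp only: P_def)
qed

end

section \<open>Measurability of the extremal events and passage to the normalised maximum\<close>

context prime_gaussian
begin

lemma X_T_continuous: "continuous_on A (\<lambda>h. X_T G T h \<omega>)"
proof -
  have "continuous_on A (\<lambda>h. lin (primes_upto T) (cf (primes_upto T) h) \<omega>)"
    by (rule DERIV_continuous_on[OF has_field_derivative_at_within[OF lin_cf_deriv]])
  thus ?thesis by (simp only: X_T_eq_lin)
qed

lemma X_T_measurable [measurable]: "X_T G T h \<in> borel_measurable M"
  unfolding X_T_eq_lin[abs_def] by (rule lin_measurable[OF primes_upto_prime])

text \<open>Continuity in h reduces the uncountable condition to a countable dense set D. Strictness
  does not survive closure, but the maximum over the compact interval is attained, so the condition
  is equivalent to a uniform margin 1 / (k + 1) on D.\<close>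

lemma all_less_events: "{\<omega>\<in>space M. \<forall>h. \<bar>h\<bar> \<le> H \<longrightarrow> X_T G T h \<omega> < c} \<in> events"
proof -
  obtain D :: "real set" where D: "countable D" "D \<subseteq> {-H..H}" "{-H..H} \<subseteq> closure D"
    using separable[of "{-H..H}"] by auto
  have "{\<omega>\<in>space M. \<forall>h. \<bar>h\<bar> \<le> H \<longrightarrow> X_T G T h \<omega> < c}
     = {\<omega>\<in>space M. \<exists>k::nat. \<forall>h\<in>D. X_T G T h \<omega> \<le> c - 1 / real (Suc k)}" (is "?L = ?R")
  proof (intro set_eqI iffI)
    fix \<omega> assume \<omega>: "\<omega> \<in> ?L"
    show "\<omega> \<in> ?R"
    proof (cases "{-H..H} = {}")
      case True
      thus ?thesis using \<omega> D by auto
    next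
      case False
      then obtain z where z: "z \<in> {-H..H}" "\<And>h. h \<in> {-H..H} \<Longrightarrow> X_T G T h \<omega> \<le> X_T G T z \<omega>"
        using continuous_attains_sup[OF compact_Icc _ X_T_continuous] by metis
      have "X_T G T z \<omega> < c" using \<omega> z(1) by (simp add: abs_le_iff)
      then obtain k where "1 / real (Suc k) < c - X_T G T z \<omega>"
        using reals_Archimedean[of "c - X_T G T z \<omega>"] by (auto simp: inverse_eq_divide)
      hence "\<forall>h\<in>D. X_T G T h \<omega> \<le> c - 1 / real (Suc k)" using z(2) D(2) by fastforce
      thus ?thesis using \<omega> by blast
    qed
  next
    fix \<omega> assume \<omega>: "\<omega> \<in> ?R"
    then obtain k where k: "\<And>h. h \<in> D \<Longrightarrow> X_T G T h \<omega> \<le> c - 1 / real (Suc k)" by auto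
    have "X_T G T h \<omega> < c" if "\<bar>h\<bar> \<le> H" for h
    proof -
      have "h \<in> closure D" using that D(3) by (auto simp: abs_le_iff subset_iff)
      hence "X_T G T h \<omega> \<le> c - 1 / real (Suc k)"
        using continuous_le_on_closure[OF X_T_continuous _ k] by blast
      also have "\<dots> < c" by simp
      finally show ?thesis .
    qed
    thus "\<omega> \<in> ?L" using \<omega> by auto
  qed
  also have "?R \<in> events" using D(1) by measurable
  finally show ?thesis .
qed

end

theorem theorem1p1:
  fixes M :: "'a measure" and G :: "nat \<Rightarrow> 'a \<Rightarrow> complex" and \<theta> :: real
  assumes "prob_space M"
    and "prob_space.indep_vars M (\<lambda>_. borel) G {p::nat. prime p}"
    and "\<And>p. prime p \<Longrightarrow> distr M borel (G p) = std_complex_gaussian"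
    and "\<theta> > 0"
  shows "\<forall>\<epsilon>>0. ((\<lambda>T. measure M {\<omega> \<in> space M.
            \<bar>normalized_max G \<theta> T \<omega> - (- 1 / (4 * sqrt (1 + \<theta>)))\<bar> > \<epsilon>})
          \<longlongrightarrow> 0) at_top"
proof (intro allI impI)
  fix \<epsilon> :: real assume \<epsilon>: "\<epsilon> > 0"
  interpret prob_space M by fact
  interpret prime_gaussian M G
    by unfold_locales (use assms in auto)
  define \<alpha> where "\<alpha> = sqrt (1 + \<theta>)"
  \<comment> \<open>The two ways to deviate, in terms of n = ln (ln T): some value of the field too
    large, or all values too small.\<close>
  define EU where "EU = (\<lambda>n. {\<omega>\<in>space M. \<exists>h. \<bar>h\<bar> \<le> exp (\<theta> * n) \<and>
            X_T G (exp (exp n)) h \<omega> \<ge> \<alpha> * n - (1 / (4 * \<alpha>) - \<epsilon>) * ln n})"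
  define EL where "EL = (\<lambda>n. {\<omega>\<in>space M. \<forall>h. \<bar>h\<bar> \<le> exp (\<theta> * n) \<longrightarrow>
            X_T G (exp (exp n)) h \<omega> < \<alpha> * n - (1 / (4 * \<alpha>) + \<epsilon>) * ln n})"
  have EL: "EL n \<in> events" for n unfolding EL_def by (rule all_less_events)
  have EU: "EU n \<in> events" for n
  proof -
    have "EU n = space M - {\<omega>\<in>space M. \<forall>h. \<bar>h\<bar> \<le> exp (\<theta> * n) \<longrightarrow>
            X_T G (exp (exp n)) h \<omega> < \<alpha> * n - (1 / (4 * \<alpha>) - \<epsilon>) * ln n}"
      unfolding EU_def by (auto simp: not_less)
    thus ?thesis using all_less_events by auto
  qed
  let ?n = "\<lambda>T::real. ln (ln T)"
  have lim: "filterlim ?n at_top at_top"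
    by (intro filterlim_compose[OF ln_at_top] ln_at_top)
  have "((\<lambda>n. prob (EU n) + prob (EL n)) \<longlongrightarrow> 0 + 0) at_top"
    unfolding EU_def EL_def \<alpha>_def by (intro tendsto_add upper_limit lower_limit assms \<epsilon>)
  hence "((\<lambda>T. prob (EU (?n T)) + prob (EL (?n T))) \<longlongrightarrow> 0) at_top"
    using filterlim_compose[OF _ lim, of "\<lambda>n. prob (EU n) + prob (EL n)" "nhds 0"] by simp
  thus "((\<lambda>T. prob {\<omega> \<in> space M. \<bar>normalized_max G \<theta> T \<omega> - (- 1 / (4 * sqrt (1 + \<theta>)))\<bar> > \<epsilon>}) \<longlongrightarrow> 0) at_top"
  proof (rule tendsto_sandwich[OF _ _ tendsto_const, rotated -1])
    show "\<forall>\<^sub>F T in at_top. prob {\<omega> \<in> space M. \<bar>normalized_max G \<theta> T \<omega> - (- 1 / (4 * sqrt (1 + \<theta>)))\<bar> > \<epsilon>}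
        \<le> prob (EU (?n T)) + prob (EL (?n T))"
      \<comment> \<open>Beyond exp (exp 1) one has ln (ln (ln T)) > 0, so inequalities may be
        multiplied through by the normalisation.\<close>
      using eventually_gt_at_top[of "exp (exp (1::real))"]
    proof eventually_elim
      case (elim T)
      define n where "n = ln (ln T)"
      have T0: "T > 0" using elim exp_gt_zero[of "exp (1::real)"] by linarith
      have lT: "ln T > exp 1" 
      proof -
        have "ln (exp (exp 1)) < ln T" using elim T0 by (subst ln_less_cancel_iff) auto
        thus ?thesis by simp
      qed
      have lT0: "ln T > 0" using lT exp_gt_zero[of "1::real"] by linarith
      have n1: "n > 1"
      proof -
        have "ln (exp 1) < ln (ln T)" using lT lT0 by (subst ln_less_cancel_iff) auto
        thus ?thesis by (simp add: n_def)
      qed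
      hence lnn: "ln n > 0" by simp
      have T: "exp (exp n) = T" using T0 lT0 by (simp add: n_def)
      have H: "ln T powr \<theta> = exp (\<theta> * n)" using lT0 by (simp add: powr_def n_def)
      have "{\<omega> \<in> space M. \<bar>normalized_max G \<theta> T \<omega> - (- 1 / (4 * sqrt (1 + \<theta>)))\<bar> > \<epsilon>} \<subseteq> EU n \<union> EL n"
      proof
        fix \<omega> assume \<omega>: "\<omega> \<in> {\<omega> \<in> space M. \<bar>normalized_max G \<theta> T \<omega> - (- 1 / (4 * sqrt (1 + \<theta>)))\<bar> > \<epsilon>}"
        define f where "f = (\<lambda>h. (X_T G T h \<omega> - \<alpha> * n) / ln n)"
        let ?I = "{- exp (\<theta> * n)..exp (\<theta> * n)}"
        have nm: "normalized_max G \<theta> T \<omega> = (SUP h\<in>?I. f h)"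
          by (simp only: normalized_max_def H f_def \<alpha>_def n_def)
        have ne: "?I \<noteq> {}" by simp
        have "continuous_on ?I f" unfolding f_def by (intro continuous_intros X_T_continuous) (use lnn in auto)
        \<comment> \<open>Without an upper bound the real supremum would be an unspecified value, so
          it must be known before values of f can be compared with it.\<close>
        hence bdd: "bdd_above (f ` ?I)"
          by (intro bounded_imp_bdd_above compact_imp_bounded compact_continuous_image compact_Icc)
        have "\<bar>(SUP h\<in>?I. f h) - (- 1 / (4 * \<alpha>))\<bar> > \<epsilon>"
        proof -
          have "\<bar>normalized_max G \<theta> T \<omega> - (- 1 / (4 * sqrt (1 + \<theta>)))\<bar> > \<epsilon>" using \<omega> by blast
          thus ?thesis unfolding nm \<alpha>_def .
        qed
        then consider "(SUP h\<in>?I. f h) > - 1 / (4 * \<alpha>) + \<epsilon>" | "(SUP h\<in>?I. f h) < - 1 / (4 * \<alpha>) - \<epsilon>"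
          by linarith
        thus "\<omega> \<in> EU n \<union> EL n"
        proof cases
          case 1
          then obtain h where h: "h \<in> ?I" "f h > - 1 / (4 * \<alpha>) + \<epsilon>"
            using less_cSUP_iff[OF ne bdd] by blast
          have "(- 1 / (4 * \<alpha>) + \<epsilon>) * ln n < X_T G T h \<omega> - \<alpha> * n"
            using h(2) lnn by (simp only: f_def pos_less_divide_eq)
          moreover have "(- 1 / (4 * \<alpha>) + \<epsilon>) * ln n = - ((1 / (4 * \<alpha>) - \<epsilon>) * ln n)" by (simp add: algebra_simps)
          ultimately have "X_T G T h \<omega> \<ge> \<alpha> * n - (1 / (4 * \<alpha>) - \<epsilon>) * ln n" by linarith
          moreover have "\<bar>h\<bar> \<le> exp (\<theta> * n)" using h(1) by (simp add: abs_le_iff)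
          ultimately have "\<omega> \<in> EU n" using \<omega> unfolding EU_def T by blast
          thus ?thesis by blast
        next
          case 2
          have "X_T G T h \<omega> < \<alpha> * n - (1 / (4 * \<alpha>) + \<epsilon>) * ln n" if "\<bar>h\<bar> \<le> exp (\<theta> * n)" for h
          proof -
            have "h \<in> ?I" using that by (simp add: abs_le_iff)
            hence "f h < - 1 / (4 * \<alpha>) - \<epsilon>" using cSUP_upper[OF _ bdd, of h] 2 by linarith
            hence "X_T G T h \<omega> - \<alpha> * n < (- 1 / (4 * \<alpha>) - \<epsilon>) * ln n"
              using lnn by (simp only: f_def pos_divide_less_eq)
            moreover have "(- 1 / (4 * \<alpha>) - \<epsilon>) * ln n = - ((1 / (4 * \<alpha>) + \<epsilon>) * ln n)" by (simp add: algebra_simps)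
            ultimately show ?thesis by linarith
          qed
          hence "\<omega> \<in> EL n" using \<omega> unfolding EL_def T by blast
          thus ?thesis by blast
        qed
      qed
      hence "prob {\<omega> \<in> space M. \<bar>normalized_max G \<theta> T \<omega> - (- 1 / (4 * sqrt (1 + \<theta>)))\<bar> > \<epsilon>} \<le> prob (EU n \<union> EL n)"
        by (rule finite_measure_mono) (use EU EL in auto)
      also have "\<dots> \<le> prob (EU n) + prob (EL n)"
        by (rule measure_Un_le[OF EU EL])
      finally show ?case by (simp add: n_def)
    qed
  qed auto
qed

end
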